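(* The triple $(\mathcal H,D,\pi)$ on $\mathcal A_\infty$ given by $\mathcal H=\bigoplus_n\mathcal H_n$, $D=\bigoplus_nD_n$, $\pi=\bigoplus_n\pi_n$ is a spectral triple with metric dimension $d=\frac{\log3}{\log2}$. The formula $$a\mapsto\mathrm{Res}_{s=d}\,\mathrm{tr}(a|D|^{-s}),\qquad a\in\mathcal A_\infty,$$ produces, up to a positive multiplicative constant, the restriction to $\mathcal A_\infty$ of the normalized trace on $\mathrm{UHF}(3^\infty)$. The formula $$\mathrm{Res}_{s=\delta}\,\mathrm{tr}\big(|[D,a]|^2|D|^{-s}\big),\qquad\delta=2-\frac{\log(5/3)}{\log2},$$ reproduces, up to a positive multiplicative constant, the Dirichlet form $\mathcal E_\infty[a]$ for $a$ in the domain $\mathcal B$ of the Dirichlet form.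
   Context: Indices $j\in\{1,2,3\}$ are taken mod $3$. $M_3(\mathbb C)$ has matrix units $e_{ij}$, and $\mathbb C^3$ is identified with its diagonal subalgebra. $\mathrm{UHF}(3^\infty)$ is the $C^*$-inductive limit of $M_3(\mathbb C)^{\otimes n}$ under $x\mapsto x\otimes I_3$; each $M_3(\mathbb C)^{\otimes n}$ is regarded as a unital subalgebra of it. For $n\ge0$ put $\alpha^n_j=e_{jj}\otimes e_{22}^{\otimes n}\in M_3(\mathbb C)^{\otimes(n+1)}$, and for $k\ge1$ put $\beta^k_j=(e_{jj}\otimes e_{11}+e_{j+2,j+2}\otimes e_{33})\otimes e_{22}^{\otimes(k-1)}\in M_3(\mathbb C)^{\otimes(k+1)}$. The finite-dimensional $*$-algebra $\mathcal A_n\subset M_3(\mathbb C)^{\otimes n}\otimes\mathbb C^3\subset M_3(\mathbb C)^{\otimes(n+1)}$ is the linear span of the $\alpha^n_j$ and of the $x\otimes\beta^k_j$ with $j=1,2,3$, $k=1,\dots,n$, $x\in M_3(\mathbb C)^{\otimes(n-k)}$. $\mathcal A_\infty$ is the $C^*$-subalgebra of $\mathrm{UHF}(3^\infty)$ of all norm limits $\lim_n a_n$ with $a_n\in\mathcal A_n$. The slice map $\rho_n:\mathrm{UHF}(3^\infty)\to M_3(\mathbb C)^{\otimes(n+1)}$, identity on the first $n+1$ tensor factors and applying the state $x\mapsto x_{22}$ to each of the others, restricts to a $*$-homomorphism $\rho_n:\mathcal A_\infty\to\mathcal A_n$. Let $E=\{x\in M_3(\mathbb C):x_{jj}=0,\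 j=1,2,3\}$ with inner product $(x,y)=\mathrm{Tr}(x^*y)$. For $n\ge0$ let $\mathcal H_n=(\mathbb C^3)^{\otimes n}\otimes E$ (with $(\mathbb C^3)^{\otimes n}$ the Hilbert space), $F_n(x\otimes m)=x\otimes m^T$ (transpose), $D_n=2^nF_n$, and $\pi_n(a)z=\rho_n(a)z$ for $a\in\mathcal A_\infty$, $z\in\mathcal H_n$, where $M_3(\mathbb C)^{\otimes n}\otimes\mathbb C^3$ acts on $\mathcal H_n$ by $(a\otimes b)(x\otimes m)=ax\otimes bm$ (matrix acting on a vector, and matrix multiplication of the diagonal matrix $b$ with $m$). Dirichlet form: an element $b\in M_3(\mathbb C)^{\otimes n}\otimes\mathbb C^3$ is written $b=\sum_i b(v_i)\otimes e_{ii}$ with $b(v_i)\in M_3(\mathbb C)^{\otimes n}$; for $b\in\mathcal A_n$, $\mathcal E_n[b]=\sum_{i\ne j}\mathrm{Tr}(|b(v_i)-b(v_j)|^2)$ with $\mathrm{Tr}$ the unnormalized trace; for $a\in\mathcal A_\infty$, $\mathcal E_\infty[a]=\lim_m(5/3)^m\mathcal E_m[\rho_m(a)]\in[0,\infty]$ (a nondecreasing limit), with domain $\mathcal B=\{a\in\mathcal A_\infty:\mathcal E_\infty[a]<\infty\}$. Conventions: a spectral triple on $\mathcal A_\infty$ consists of a Hilbert space, a representation $\pi$ and a self-adjoint $D$ with compact resolvent such that $[D,\pi(a)]$ is bounded for $a$ in a dense $*$-subalgebra of $\mathcal A_\infty$; its metric dimension is $\inf\{s>0:\mathrm{tr}(|D|^{-s})<\infty\}$.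 In the formulas $a$ stands for $\pi(a)$, $\mathrm{tr}$ is the operator trace on $\mathcal H$, and $\mathrm{tr}(|[D,a]|^2|D|^{-s})=\sum_n2^{-sn}\,\mathrm{tr}_{\mathcal H_n}(|[D_n,\pi_n(a)]|^2)$. $\mathrm{Res}_{s=s_0}f(s)$ denotes $\lim_{s\to s_0^+}(s-s_0)f(s)$. *)

theory Defs
  imports "HOL-Analysis.Analysis" "HOL-Library.Function_Algebras"
begin

section \<open>Complex vector spaces and C*-algebras\<close>

class complex_vector = ab_group_add +
  fixes scaleC :: "complex \<Rightarrow> 'a \<Rightarrow> 'a"  (infixr "*\<^sub>C" 75)
  assumes scaleC_add_right: "a *\<^sub>C (x + y) = a *\<^sub>C x + a *\<^sub>C y"
    and scaleC_add_left: "(a + b) *\<^sub>C x = a *\<^sub>C x + b *\<^sub>C x"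
    and scaleC_scaleC: "a *\<^sub>C b *\<^sub>C x = (a * b) *\<^sub>C x"
    and scaleC_one: "1 *\<^sub>C x = x"

interpretation cvec: vector_space "scaleC :: complex \<Rightarrow> 'a \<Rightarrow> 'a::complex_vector"
  by standard (simp_all add: scaleC_add_right scaleC_add_left scaleC_scaleC scaleC_one)

instantiation complex :: complex_vector
begin
definition scaleC_complex_def: "c *\<^sub>C (x::complex) = c * x"
instance by standard (simp_all add: scaleC_complex_def algebra_simps)
end

instantiation "fun" :: (type, complex_vector) complex_vector
begin
definition scaleC_fun_def: "c *\<^sub>C f = (\<lambda>x. c *\<^sub>C f x)"
instance by standard
  (simp_all add: scaleC_fun_def fun_eq_iff scaleC_add_right scaleC_add_left scaleC_scaleC scaleC_one)
end

instantiation vec :: (complex_vector, finite) complex_vector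
begin
definition scaleC_vec_def: "c *\<^sub>C v = (\<chi> i. c *\<^sub>C v $ i)"
instance by standard
  (simp_all add: scaleC_vec_def vec_eq_iff scaleC_add_right scaleC_add_left scaleC_scaleC scaleC_one)
end

class cstar_algebra = complex_vector + real_normed_algebra_1 + banach +
  fixes star :: "'a \<Rightarrow> 'a"
  assumes scaleR_scaleC: "r *\<^sub>R x = complex_of_real r *\<^sub>C x"
    and mult_scaleC_left: "(c *\<^sub>C x) * y = c *\<^sub>C (x * y)"
    and mult_scaleC_right: "x * (c *\<^sub>C y) = c *\<^sub>C (x * y)"
    and norm_scaleC: "norm (c *\<^sub>C x) = cmod c * norm x"
    and star_add: "star (x + y) = star x + star y"
    and star_scaleC: "star (c *\<^sub>C x) = cnj c *\<^sub>C star x"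
    and star_mult: "star (x * y) = star y * star x"
    and star_star: "star (star x) = x"
    and cstar_identity: "norm (star x * x) = (norm x)\<^sup>2"

definition star_subalgebra :: "'a::cstar_algebra set \<Rightarrow> bool" where
  "star_subalgebra S \<longleftrightarrow> cvec.subspace S \<and> (\<forall>a\<in>S. \<forall>b\<in>S. a * b \<in> S) \<and> (\<forall>a\<in>S. star a \<in> S)"

section \<open>Operators on Hilbert spaces and spectral triples\<close>

text \<open>
  A Hilbert space is given by its underlying set \<open>H\<close> of vectors, a linear subspace of an ambient
  complex vector space, and its inner product \<open>ip\<close>, linear in the second argument. An operator
  is a total function on the ambient space; only its values on its domain matter.
\<close>

definition hnorm :: "('h \<Rightarrow> 'h \<Rightarrow> complex) \<Rightarrow> 'h \<Rightarrow> real" where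
  "hnorm ip \<xi> = sqrt (Re (ip \<xi> \<xi>))"

definition hilbert_space :: "'h::complex_vector set \<Rightarrow> ('h \<Rightarrow> 'h \<Rightarrow> complex) \<Rightarrow> bool" where
  "hilbert_space H ip \<longleftrightarrow> cvec.subspace H \<and>
     (\<forall>\<xi>\<in>H. \<forall>\<eta>\<in>H. \<forall>\<zeta>\<in>H. ip \<xi> (\<eta> + \<zeta>) = ip \<xi> \<eta> + ip \<xi> \<zeta>) \<and>
     (\<forall>\<xi>\<in>H. \<forall>\<eta>\<in>H. \<forall>c. ip \<xi> (c *\<^sub>C \<eta>) = c * ip \<xi> \<eta>) \<and>
     (\<forall>\<xi>\<in>H. \<forall>\<eta>\<in>H. ip \<eta> \<xi> = cnj (ip \<xi> \<eta>)) \<and>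
     (\<forall>\<xi>\<in>H. 0 \<le> Re (ip \<xi> \<xi>)) \<and> (\<forall>\<xi>\<in>H. ip \<xi> \<xi> = 0 \<longrightarrow> \<xi> = 0) \<and>
     (\<forall>X. (\<forall>k::nat. X k \<in> H) \<and> (\<forall>e>0. \<exists>N. \<forall>k\<ge>N. \<forall>l\<ge>N. hnorm ip (X k - X l) < e) \<longrightarrow>
        (\<exists>L\<in>H. (\<lambda>k. hnorm ip (X k - L)) \<longlonglongrightarrow> 0))"

definition dense_in :: "'h::complex_vector set \<Rightarrow> ('h \<Rightarrow> 'h \<Rightarrow> complex) \<Rightarrow> 'h set \<Rightarrow> bool" where
  "dense_in H ip V \<longleftrightarrow> V \<subseteq> H \<and> (\<forall>\<xi>\<in>H. \<forall>e>0. \<exists>\<eta>\<in>V. hnorm ip (\<xi> - \<eta>) < e)"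

definition linear_into :: "'h::complex_vector set \<Rightarrow> 'h set \<Rightarrow> ('h \<Rightarrow> 'h) \<Rightarrow> bool" where
  "linear_into V H T \<longleftrightarrow> (\<forall>\<xi>\<in>V. T \<xi> \<in> H) \<and>
     (\<forall>\<xi>\<in>V. \<forall>\<eta>\<in>V. T (\<xi> + \<eta>) = T \<xi> + T \<eta>) \<and> (\<forall>\<xi>\<in>V. \<forall>c. T (c *\<^sub>C \<xi>) = c *\<^sub>C T \<xi>)"

definition bounded_op ::
  "'h::complex_vector set \<Rightarrow> 'h set \<Rightarrow> ('h \<Rightarrow> 'h \<Rightarrow> complex) \<Rightarrow> ('h \<Rightarrow> 'h) \<Rightarrow> bool" where
  "bounded_op V H ip T \<longleftrightarrow> linear_into V H T \<and> (\<exists>C. \<forall>\<xi>\<in>V. hnorm ip (T \<xi>) \<le> C * hnorm ip \<xi>)"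

definition compact_op :: "'h::complex_vector set \<Rightarrow> ('h \<Rightarrow> 'h \<Rightarrow> complex) \<Rightarrow> ('h \<Rightarrow> 'h) \<Rightarrow> bool" where
  "compact_op H ip T \<longleftrightarrow> bounded_op H H ip T \<and>
     (\<forall>X. (\<forall>k::nat. X k \<in> H \<and> hnorm ip (X k) \<le> 1) \<longrightarrow>
        (\<exists>r L. strict_mono r \<and> L \<in> H \<and> (\<lambda>k. hnorm ip (T (X (r k)) - L)) \<longlonglongrightarrow> 0))"

text \<open>\<open>D\<close> with domain \<open>V\<close> is densely defined, symmetric, and the domain of its adjoint is \<open>V\<close>.\<close>

definition self_adjoint ::
  "'h::complex_vector set \<Rightarrow> ('h \<Rightarrow> 'h \<Rightarrow> complex) \<Rightarrow> 'h set \<Rightarrow> ('h \<Rightarrow> 'h) \<Rightarrow> bool" where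
  "self_adjoint H ip V D \<longleftrightarrow> cvec.subspace V \<and> dense_in H ip V \<and> linear_into V H D \<and>
     (\<forall>\<xi>\<in>V. \<forall>\<eta>\<in>V. ip (D \<xi>) \<eta> = ip \<xi> (D \<eta>)) \<and>
     (\<forall>\<eta>\<in>H. (\<exists>\<zeta>\<in>H. \<forall>\<xi>\<in>V. ip (D \<xi>) \<eta> = ip \<xi> \<zeta>) \<longrightarrow> \<eta> \<in> V)"

definition compact_resolvent ::
  "'h::complex_vector set \<Rightarrow> ('h \<Rightarrow> 'h \<Rightarrow> complex) \<Rightarrow> 'h set \<Rightarrow> ('h \<Rightarrow> 'h) \<Rightarrow> bool" where
  "compact_resolvent H ip V D \<longleftrightarrow> (\<exists>z R. compact_op H ip R \<and>
     (\<forall>\<xi>\<in>H. R \<xi> \<in> V \<and> D (R \<xi>) - z *\<^sub>C R \<xi> = \<xi>) \<and> (\<forall>\<xi>\<in>V. R (D \<xi> - z *\<^sub>C \<xi>) = \<xi>))"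

definition representation ::
  "'a::cstar_algebra set \<Rightarrow> 'h::complex_vector set \<Rightarrow> ('h \<Rightarrow> 'h \<Rightarrow> complex) \<Rightarrow> ('a \<Rightarrow> 'h \<Rightarrow> 'h) \<Rightarrow> bool"
  where
  "representation A H ip \<pi> \<longleftrightarrow> (\<forall>a\<in>A. bounded_op H H ip (\<pi> a)) \<and>
     (\<forall>a\<in>A. \<forall>b\<in>A. \<forall>\<xi>\<in>H. \<pi> (a + b) \<xi> = \<pi> a \<xi> + \<pi> b \<xi>) \<and>
     (\<forall>a\<in>A. \<forall>c. \<forall>\<xi>\<in>H. \<pi> (c *\<^sub>C a) \<xi> = c *\<^sub>C \<pi> a \<xi>) \<and>
     (\<forall>a\<in>A. \<forall>b\<in>A. \<forall>\<xi>\<in>H. \<pi> (a * b) \<xi> = \<pi> a (\<pi> b \<xi>)) \<and>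
     (\<forall>a\<in>A. \<forall>\<xi>\<in>H. \<forall>\<eta>\<in>H. ip (\<pi> (star a) \<xi>) \<eta> = ip \<xi> (\<pi> a \<eta>))"

text \<open>
  \<open>[D, \<pi>(a)]\<close> is bounded: \<open>\<pi>(a)\<close> maps the domain \<open>V\<close> of \<open>D\<close> into itself, and the commutator,
  defined on \<open>V\<close>, is bounded there.
\<close>

definition spectral_triple ::
  "'a::cstar_algebra set \<Rightarrow> 'h::complex_vector set \<Rightarrow> ('h \<Rightarrow> 'h \<Rightarrow> complex) \<Rightarrow> ('a \<Rightarrow> 'h \<Rightarrow> 'h) \<Rightarrow>
     'h set \<Rightarrow> ('h \<Rightarrow> 'h) \<Rightarrow> bool" where
  "spectral_triple A H ip \<pi> V D \<longleftrightarrow>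
     star_subalgebra A \<and> closed A \<and> hilbert_space H ip \<and> representation A H ip \<pi> \<and>
     self_adjoint H ip V D \<and> compact_resolvent H ip V D \<and>
     (\<exists>S. star_subalgebra S \<and> S \<subseteq> A \<and> A \<subseteq> closure S \<and>
        (\<forall>a\<in>S. (\<forall>\<xi>\<in>V. \<pi> a \<xi> \<in> V) \<and> bounded_op V H ip (\<lambda>\<xi>. D (\<pi> a \<xi>) - \<pi> a (D \<xi>))))"

text \<open>
  \<open>|D|\<^sup>p\<close> for \<open>p \<le> 0\<close> and a self-adjoint \<open>D\<close> with compact resolvent and trivial kernel, by
  functional calculus: since the eigenvectors of \<open>D\<close> span a dense subspace, \<open>|D|\<^sup>p\<close> is the bounded
  operator that multiplies each \<open>\<lambda>\<close>-eigenvector by \<open>|\<lambda>|\<^sup>p\<close>. (Its value outside \<open>H\<close> is set to \<open>0\<close>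
  to make it unique as a function.)
\<close>

definition abs_power :: "'h::complex_vector set \<Rightarrow> ('h \<Rightarrow> 'h \<Rightarrow> complex) \<Rightarrow> 'h set \<Rightarrow> ('h \<Rightarrow> 'h) \<Rightarrow>
     real \<Rightarrow> 'h \<Rightarrow> 'h" where
  "abs_power H ip V D p = (THE S. bounded_op H H ip S \<and> (\<forall>\<xi>. \<xi> \<notin> H \<longrightarrow> S \<xi> = 0) \<and>
     (\<forall>l::real. \<forall>\<xi>\<in>V. D \<xi> = complex_of_real l *\<^sub>C \<xi> \<longrightarrow>
        S \<xi> = complex_of_real (\<bar>l\<bar> powr p) *\<^sub>C \<xi>))"

definition is_onb :: "'h::complex_vector set \<Rightarrow> ('h \<Rightarrow> 'h \<Rightarrow> complex) \<Rightarrow> 'h set \<Rightarrow> bool" where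
  "is_onb H ip B \<longleftrightarrow> B \<subseteq> H \<and> (\<forall>b\<in>B. \<forall>b'\<in>B. ip b b' = (if b = b' then 1 else 0)) \<and>
     dense_in H ip (cvec.span B)"

text \<open>
  A bounded operator \<open>T\<close> is trace class with trace \<open>t\<close> if its diagonal sums converge unconditionally
  to \<open>t\<close> in every orthonormal basis.
\<close>

definition has_op_trace ::
  "'h::complex_vector set \<Rightarrow> ('h \<Rightarrow> 'h \<Rightarrow> complex) \<Rightarrow> ('h \<Rightarrow> 'h) \<Rightarrow> complex \<Rightarrow> bool" where
  "has_op_trace H ip T t \<longleftrightarrow> bounded_op H H ip T \<and>
     (\<forall>B. is_onb H ip B \<longrightarrow> ((\<lambda>b. ip b (T b)) has_sum t) B)"

definition trace_class :: "'h::complex_vector set \<Rightarrow> ('h \<Rightarrow> 'h \<Rightarrow> complex) \<Rightarrow> ('h \<Rightarrow> 'h) \<Rightarrow> bool" where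
  "trace_class H ip T \<longleftrightarrow> (\<exists>t. has_op_trace H ip T t)"

definition op_trace :: "'h::complex_vector set \<Rightarrow> ('h \<Rightarrow> 'h \<Rightarrow> complex) \<Rightarrow> ('h \<Rightarrow> 'h) \<Rightarrow> complex" where
  "op_trace H ip T = (THE t. has_op_trace H ip T t)"

definition op_adjoint ::
  "'h::complex_vector set \<Rightarrow> ('h \<Rightarrow> 'h \<Rightarrow> complex) \<Rightarrow> ('h \<Rightarrow> 'h) \<Rightarrow> 'h \<Rightarrow> 'h" where
  "op_adjoint H ip T \<eta> = (THE \<zeta>. \<zeta> \<in> H \<and> (\<forall>\<xi>\<in>H. ip (T \<xi>) \<eta> = ip \<xi> \<zeta>))"

definition metric_dimension ::
  "'h::complex_vector set \<Rightarrow> ('h \<Rightarrow> 'h \<Rightarrow> complex) \<Rightarrow> 'h set \<Rightarrow> ('h \<Rightarrow> 'h) \<Rightarrow> real" where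
  "metric_dimension H ip V D = Inf {s. s > 0 \<and> trace_class H ip (abs_power H ip V D (- s))}"

definition has_residue :: "(real \<Rightarrow> complex) \<Rightarrow> real \<Rightarrow> complex \<Rightarrow> bool" where
  "has_residue f s0 L \<longleftrightarrow> ((\<lambda>s. complex_of_real (s - s0) * f s) \<longlongrightarrow> L) (at_right s0)"

section \<open>The matrix algebras\<close>

text \<open>
  The index set \<open>{1, 2, 3}\<close> with arithmetic modulo 3 is the type \<^typ>\<open>3\<close> (where \<open>3 = 0\<close>). An element
  of the \<open>n\<close>-fold tensor power of \<open>M\<^sub>3(\<complex>)\<close> is a matrix indexed by the words of length \<open>n\<close>, that is,
  a function of two words that vanishes unless both have length \<open>n\<close>.
\<close>

type_synonym cmat = "3 list \<Rightarrow> 3 list \<Rightarrow> complex"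

definition words :: "nat \<Rightarrow> 3 list set" where
  "words n = {w. length w = n}"

definition mats :: "nat \<Rightarrow> cmat set" where
  "mats n = {x. \<forall>u v. u \<notin> words n \<or> v \<notin> words n \<longrightarrow> x u v = 0}"

definition mmul :: "nat \<Rightarrow> cmat \<Rightarrow> cmat \<Rightarrow> cmat" where
  "mmul n x y u v = (\<Sum>w\<in>words n. x u w * y w v)"

definition mstar :: "cmat \<Rightarrow> cmat" where
  "mstar x u v = cnj (x v u)"

definition mone :: "nat \<Rightarrow> cmat" where
  "mone n u v = (if u \<in> words n \<and> u = v then 1 else 0)"

definition mtr :: "nat \<Rightarrow> cmat \<Rightarrow> complex" where
  "mtr n x = (\<Sum>w\<in>words n. x w w)"

text \<open>\<open>tens n x y\<close> is \<open>x \<otimes> y\<close> where \<open>x\<close> belongs to the \<open>n\<close>-fold tensor power.\<close>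

definition tens :: "nat \<Rightarrow> cmat \<Rightarrow> cmat \<Rightarrow> cmat" where
  "tens n x y u v = x (take n u) (take n v) * y (drop n u) (drop n v)"

definition wnorm :: "nat \<Rightarrow> (3 list \<Rightarrow> complex) \<Rightarrow> real" where
  "wnorm n f = L2_set (\<lambda>w. cmod (f w)) (words n)"

definition mvec :: "nat \<Rightarrow> cmat \<Rightarrow> (3 list \<Rightarrow> complex) \<Rightarrow> 3 list \<Rightarrow> complex" where
  "mvec n x f u = (\<Sum>v\<in>words n. x u v * f v)"

definition opnorm :: "nat \<Rightarrow> cmat \<Rightarrow> real" where
  "opnorm n x = (SUP f\<in>{f. wnorm n f \<le> 1}. wnorm n (mvec n x f))"

lemma finite_words [simp, intro]: "finite (words n)"
  using finite_lists_length_eq[of "UNIV :: 3 set" n] by (simp add: words_def)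

lemma words_ne: "words n \<noteq> {}"
  using length_replicate[of n "1 :: 3"] unfolding words_def by blast

lemma wnorm_nonneg [simp]: "0 \<le> wnorm n f"
  by (simp add: wnorm_def)

lemma wnorm_triangle: "wnorm n (\<lambda>w. f w + g w) \<le> wnorm n f + wnorm n g"
proof -
  have "wnorm n (\<lambda>w. f w + g w) \<le> L2_set (\<lambda>w. cmod (f w) + cmod (g w)) (words n)"
    unfolding wnorm_def by (intro L2_set_mono norm_triangle_ineq) auto
  also have "\<dots> \<le> wnorm n f + wnorm n g"
    unfolding wnorm_def by (rule L2_set_triangle_ineq)
  finally show ?thesis .
qed

lemma wnorm_scale: "wnorm n (\<lambda>w. c * f w) = cmod c * wnorm n f"
  unfolding wnorm_def by (simp add: norm_mult L2_set_right_distrib)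

lemma wnorm_cong: "(\<And>w. w \<in> words n \<Longrightarrow> f w = g w) \<Longrightarrow> wnorm n f = wnorm n g"
  unfolding wnorm_def by (rule L2_set_cong) auto

lemma cmod_le_wnorm: "w \<in> words n \<Longrightarrow> cmod (f w) \<le> wnorm n f"
  unfolding wnorm_def by (rule member_le_L2_set) auto

lemma wnorm_sq: "(wnorm n f)\<^sup>2 = (\<Sum>w\<in>words n. (cmod (f w))\<^sup>2)"
  unfolding wnorm_def L2_set_def by (simp add: sum_nonneg)

lemma wnorm_zero_iff: "wnorm n f = 0 \<longleftrightarrow> (\<forall>w\<in>words n. f w = 0)"
  unfolding wnorm_def by (subst L2_set_eq_0_iff) auto

lemma mvec_scale: "mvec n x (\<lambda>w. c * f w) = (\<lambda>u. c * mvec n x f u)"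
  by (simp add: mvec_def fun_eq_iff sum_distrib_left mult_ac)

lemma wnorm_mvec_le: "wnorm n (mvec n x f) \<le> (\<Sum>u\<in>words n. \<Sum>v\<in>words n. cmod (x u v)) * wnorm n f"
proof -
  have "wnorm n (mvec n x f) \<le> (\<Sum>u\<in>words n. cmod (mvec n x f u))"
    unfolding wnorm_def by (rule L2_set_le_sum) auto
  also have "\<dots> \<le> (\<Sum>u\<in>words n. \<Sum>v\<in>words n. cmod (x u v) * wnorm n f)"
    unfolding mvec_def
    by (intro sum_mono order_trans[OF norm_sum]) (auto simp: norm_mult intro!: mult_left_mono cmod_le_wnorm)
  finally show ?thesis by (simp add: sum_distrib_right)
qed

lemma opnorm_bdd: "bdd_above ((\<lambda>f. wnorm n (mvec n x f)) ` {f. wnorm n f \<le> 1})"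
proof (rule bdd_aboveI2)
  fix f assume "f \<in> {f. wnorm n f \<le> 1}"
  then show "wnorm n (mvec n x f) \<le> (\<Sum>u\<in>words n. \<Sum>v\<in>words n. cmod (x u v))"
    using wnorm_mvec_le[of n x f] by (smt (verit) mem_Collect_eq mult_left_le norm_ge_zero sum_nonneg)
qed

lemma wnorm_zero [simp]: "wnorm n (\<lambda>w. 0) = 0"
  by (simp add: wnorm_zero_iff)

lemma opnorm_nonneg [simp]: "0 \<le> opnorm n x"
proof -
  have "wnorm n (mvec n x (\<lambda>w. 0)) \<le> opnorm n x"
    unfolding opnorm_def by (rule cSUP_upper[OF _ opnorm_bdd]) simp
  then show ?thesis using wnorm_nonneg order_trans by blast
qed

lemma opnorm_bound: "wnorm n (mvec n x f) \<le> opnorm n x * wnorm n f"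
proof (cases "wnorm n f = 0")
  case True
  then show ?thesis using wnorm_mvec_le[of n x f] by simp
next
  case False
  define c where "c = wnorm n f"
  have c: "c > 0" using False by (simp add: c_def less_le)
  let ?g = "\<lambda>w. complex_of_real (1 / c) * f w"
  have "wnorm n ?g \<le> 1" unfolding wnorm_scale using c by (simp add: c_def norm_divide)
  then have "wnorm n (mvec n x ?g) \<le> opnorm n x"
    unfolding opnorm_def by (intro cSUP_upper[OF _ opnorm_bdd]) simp
  then have "wnorm n (mvec n x f) / c \<le> opnorm n x"
    unfolding mvec_scale wnorm_scale using c by (simp add: norm_divide)
  then show ?thesis using c by (simp add: c_def field_simps)
qed

lemma opnorm_le:
  assumes "0 \<le> C" "\<And>f. wnorm n (mvec n x f) \<le> C * wnorm n f"
  shows "opnorm n x \<le> C"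
  unfolding opnorm_def
proof (rule cSUP_least)
  show "{f. wnorm n f \<le> 1} \<noteq> {}" using wnorm_zero[of n] by (metis (mono_tags) empty_Collect_eq zero_le_one)
  fix f assume "f \<in> {f. wnorm n f \<le> 1}"
  then show "wnorm n (mvec n x f) \<le> C"
    using assms(2)[of f] assms(1) by (smt (verit) mem_Collect_eq mult_left_le)
qed

lemma mvec_add: "mvec n (x + y) f = (\<lambda>u. mvec n x f u + mvec n y f u)"
  by (simp add: mvec_def fun_eq_iff sum.distrib algebra_simps)

lemma mvec_scaleC: "mvec n (c *\<^sub>C x) f = (\<lambda>u. c * mvec n x f u)"
  by (simp add: mvec_def fun_eq_iff sum_distrib_left algebra_simps scaleC_fun_def scaleC_complex_def)

lemma mvec_mmul: "mvec n (mmul n x y) f = mvec n x (mvec n y f)"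
proof
  fix u
  have "mvec n (mmul n x y) f u = (\<Sum>v\<in>words n. \<Sum>w\<in>words n. x u w * (y w v * f v))"
    by (simp add: mvec_def mmul_def sum_distrib_right mult.assoc)
  also have "\<dots> = (\<Sum>w\<in>words n. \<Sum>v\<in>words n. x u w * (y w v * f v))"
    by (rule sum.swap)
  finally show "mvec n (mmul n x y) f u = mvec n x (mvec n y f) u"
    by (simp add: mvec_def sum_distrib_left)
qed

lemma opnorm_add: "opnorm n (x + y) \<le> opnorm n x + opnorm n y"
proof (rule opnorm_le)
  fix f
  have "wnorm n (mvec n (x + y) f) \<le> wnorm n (mvec n x f) + wnorm n (mvec n y f)"
    unfolding mvec_add by (rule wnorm_triangle)
  also have "\<dots> \<le> (opnorm n x + opnorm n y) * wnorm n f"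
    using opnorm_bound[of n x f] opnorm_bound[of n y f] by (simp add: algebra_simps)
  finally show "wnorm n (mvec n (x + y) f) \<le> (opnorm n x + opnorm n y) * wnorm n f" .
qed simp

lemma opnorm_scaleC_le: "opnorm n (c *\<^sub>C x) \<le> cmod c * opnorm n x"
  by (rule opnorm_le)
    (use opnorm_bound[of n x] in \<open>auto simp: mvec_scaleC wnorm_scale mult.assoc intro!: mult_left_mono\<close>)

lemma opnorm_scaleC: "opnorm n (c *\<^sub>C x) = cmod c * opnorm n x"
proof (cases "c = 0")
  case True
  then show ?thesis using opnorm_scaleC_le[of n c x] opnorm_nonneg[of n "c *\<^sub>C x"] by (simp del: opnorm_nonneg)
next
  case False
  have "opnorm n x = opnorm n (inverse c *\<^sub>C c *\<^sub>C x)"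
    using False by (simp add: scaleC_scaleC scaleC_one)
  also have "\<dots> \<le> inverse (cmod c) * opnorm n (c *\<^sub>C x)"
    using opnorm_scaleC_le[of n "inverse c" "c *\<^sub>C x"] by (simp add: norm_inverse)
  finally show ?thesis using False opnorm_scaleC_le[of n c x] by (simp add: field_simps)
qed

lemma opnorm_zero [simp]: "opnorm n 0 = 0"
  using opnorm_scaleC[of n 0 0] by simp

lemma opnorm_uminus [simp]: "opnorm n (- x) = opnorm n x"
  using opnorm_scaleC[of n "-1" x] by (simp add: scaleC_one cvec.scale_minus_left)

lemma opnorm_minus_commute: "opnorm n (x - y) = opnorm n (y - x)"
  using opnorm_uminus[of n "x - y"] by (simp only: minus_diff_eq)

lemma opnorm_mmul: "opnorm n (mmul n x y) \<le> opnorm n x * opnorm n y"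
proof (rule opnorm_le)
  fix f
  have "wnorm n (mvec n (mmul n x y) f) \<le> opnorm n x * wnorm n (mvec n y f)"
    unfolding mvec_mmul by (rule opnorm_bound)
  also have "\<dots> \<le> opnorm n x * (opnorm n y * wnorm n f)"
    by (intro mult_left_mono opnorm_bound) simp
  finally show "wnorm n (mvec n (mmul n x y) f) \<le> opnorm n x * opnorm n y * wnorm n f"
    by (simp add: mult.assoc)
qed simp

lemma opnorm_mstar_sq: "(opnorm n x)\<^sup>2 \<le> opnorm n (mmul n (mstar x) x)"
proof -
  let ?C = "opnorm n (mmul n (mstar x) x)"
  have "opnorm n x \<le> sqrt ?C"
  proof (rule opnorm_le)
    fix f
    let ?g = "mvec n x f" and ?h = "mvec n (mmul n (mstar x) x) f"
    have "complex_of_real ((wnorm n ?g)\<^sup>2) = (\<Sum>u\<in>words n. cnj (?g u) * ?g u)"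
      unfolding wnorm_sq of_real_sum by (intro sum.cong) (simp_all add: complex_norm_square mult.commute del: of_real_power)
    also have "\<dots> = (\<Sum>u\<in>words n. \<Sum>v\<in>words n. cnj (f v) * (mstar x v u * ?g u))"
    proof (intro sum.cong refl)
      fix u
      have "cnj (?g u) = (\<Sum>v\<in>words n. cnj (f v) * mstar x v u)"
        by (simp add: mvec_def mstar_def mult.commute)
      then show "cnj (?g u) * ?g u = (\<Sum>v\<in>words n. cnj (f v) * (mstar x v u * ?g u))"
        by (simp only: sum_distrib_right mult.assoc)
    qed
    also have "\<dots> = (\<Sum>v\<in>words n. \<Sum>u\<in>words n. cnj (f v) * (mstar x v u * ?g u))"
      by (rule sum.swap)
    also have "\<dots> = (\<Sum>v\<in>words n. cnj (f v) * ?h v)"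
      by (simp only: mvec_mmul mvec_def[of n "mstar x"] sum_distrib_left)
    finally have "(wnorm n ?g)\<^sup>2 = cmod (\<Sum>v\<in>words n. cnj (f v) * ?h v)"
      by (metis norm_of_real abs_of_nonneg zero_le_power2)
    also have "\<dots> \<le> (\<Sum>v\<in>words n. cmod (f v) * cmod (?h v))"
      by (rule order_trans[OF norm_sum]) (simp add: norm_mult)
    also have "\<dots> \<le> wnorm n f * wnorm n ?h"
      unfolding wnorm_def using L2_set_mult_ineq[of "\<lambda>v. cmod (f v)" "\<lambda>v. cmod (?h v)" "words n"] by simp
    also have "\<dots> \<le> wnorm n f * (?C * wnorm n f)"
      by (intro mult_left_mono opnorm_bound) simp
    finally have "(wnorm n ?g)\<^sup>2 \<le> (sqrt ?C * wnorm n f)\<^sup>2"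
      by (simp add: power_mult_distrib power2_eq_square mult_ac)
    then show "wnorm n ?g \<le> sqrt ?C * wnorm n f"
      by (rule power2_le_imp_le) simp
  qed simp
  then have "(opnorm n x)\<^sup>2 \<le> (sqrt ?C)\<^sup>2"
    by (intro power_mono) simp_all
  then show ?thesis by simp
qed

lemma mstar_mstar [simp]: "mstar (mstar x) = x"
  by (simp add: mstar_def fun_eq_iff)

lemma opnorm_mstar [simp]: "opnorm n (mstar x) = opnorm n x"
proof -
  have *: "opnorm n y \<le> opnorm n (mstar y)" for y
  proof (cases "opnorm n y = 0")
    case False
    have "(opnorm n y)\<^sup>2 \<le> opnorm n (mstar y) * opnorm n y"
      using opnorm_mstar_sq opnorm_mmul order_trans by blast
    then show ?thesis using False by (simp add: power2_eq_square mult_le_cancel_right less_le)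
  qed simp
  show ?thesis using *[of x] *[of "mstar x"] by simp
qed

lemma opnorm_cstar: "opnorm n (mmul n (mstar x) x) = (opnorm n x)\<^sup>2"
  using opnorm_mmul[of n "mstar x" x] opnorm_mstar_sq[of n x] by (simp add: power2_eq_square)

lemma mvec_mone: "u \<in> words n \<Longrightarrow> mvec n (mone n) f u = f u"
  by (simp add: mvec_def mone_def if_distrib[of "\<lambda>a. a * _"] sum.delta cong: if_cong)

lemma opnorm_mone [simp]: "opnorm n (mone n) = 1"
proof (rule antisym)
  have eq: "wnorm n (mvec n (mone n) f) = wnorm n f" for f
    by (rule wnorm_cong) (rule mvec_mone)
  show "opnorm n (mone n) \<le> 1" by (rule opnorm_le) (simp_all add: eq)
  obtain w where w: "w \<in> words n" using words_ne by blast
  have "wnorm n (\<lambda>u. 1) > 0"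
    using w by (metis wnorm_nonneg wnorm_zero_iff less_le one_neq_zero)
  then show "1 \<le> opnorm n (mone n)" using opnorm_bound[of n "mone n" "\<lambda>u. 1"] by (simp add: eq)
qed

subsection \<open>Amplification \<open>x \<mapsto> x \<otimes> 1\<close>\<close>

definition amp :: "nat \<Rightarrow> nat \<Rightarrow> cmat \<Rightarrow> cmat" where
  "amp n m x = tens n x (mone (m - n))"

lemma matsI: "(\<And>u v. u \<notin> words n \<or> v \<notin> words n \<Longrightarrow> x u v = 0) \<Longrightarrow> x \<in> mats n"
  by (auto simp: mats_def)

lemma matsD: "x \<in> mats n \<Longrightarrow> u \<notin> words n \<or> v \<notin> words n \<Longrightarrow> x u v = 0"
  by (auto simp: mats_def)

lemma mats_zero [simp, intro]: "0 \<in> mats n"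
  and mats_add: "x \<in> mats n \<Longrightarrow> y \<in> mats n \<Longrightarrow> x + y \<in> mats n"
  and mats_diff: "x \<in> mats n \<Longrightarrow> y \<in> mats n \<Longrightarrow> x - y \<in> mats n"
  and mats_uminus: "x \<in> mats n \<Longrightarrow> - x \<in> mats n"
  and mats_scaleC: "x \<in> mats n \<Longrightarrow> c *\<^sub>C x \<in> mats n"
  and mats_mmul: "x \<in> mats n \<Longrightarrow> y \<in> mats n \<Longrightarrow> mmul n x y \<in> mats n"
  and mats_mstar: "x \<in> mats n \<Longrightarrow> mstar x \<in> mats n"
  and mats_mone [simp, intro]: "mone n \<in> mats n"
  by (auto simp: mats_def mmul_def mstar_def mone_def scaleC_fun_def scaleC_complex_def)

lemma sum_words_append:
  assumes "n \<le> m"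
  shows "(\<Sum>w\<in>words m. g w) = (\<Sum>t\<in>words (m - n). \<Sum>u\<in>words n. g (u @ t))"
proof -
  have "(\<Sum>t\<in>words (m - n). \<Sum>u\<in>words n. g (u @ t)) =
        (\<Sum>p\<in>words (m - n) \<times> words n. g (snd p @ fst p))"
    by (simp add: sum.cartesian_product split_def)
  also have "\<dots> = (\<Sum>w\<in>words m. g w)"
    by (rule sum.reindex_bij_witness[where i = "\<lambda>w. (drop n w, take n w)" and j = "\<lambda>p. snd p @ fst p"])
      (use assms in \<open>auto simp: words_def\<close>)
  finally show ?thesis by simp
qed

lemma words_splitE:
  assumes "n \<le> m" "w \<in> words m"
  obtains u t where "w = u @ t" "u \<in> words n" "t \<in> words (m - n)"
  using assms by (metis (mono_tags) append_take_drop_id length_drop length_take mem_Collect_eq min.absorb2 words_def)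

lemma amp_append:
  "u \<in> words n \<Longrightarrow> v \<in> words n \<Longrightarrow> t \<in> words (m - n) \<Longrightarrow> amp n m x (u @ t) (v @ s) = (if t = s then x u v else 0)"
  by (auto simp: amp_def tens_def mone_def words_def)

lemma mats_amp:
  assumes "n \<le> m" "x \<in> mats n" shows "amp n m x \<in> mats m"
proof (rule matsI, rule ccontr)
  fix u v assume uv: "u \<notin> words m \<or> v \<notin> words m" and "amp n m x u v \<noteq> 0"
  then have "x (take n u) (take n v) \<noteq> 0" "drop n u \<in> words (m - n)" "drop n u = drop n v"
    by (auto simp: amp_def tens_def mone_def split: if_splits)
  moreover from this(1) have "take n u \<in> words n" "take n v \<in> words n"
    using matsD[OF assms(2), of "take n u" "take n v"] by argo+
  ultimately have "length (take n u @ drop n u) = m" "length (take n v @ drop n v) = m"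
    using assms(1) unfolding words_def mem_Collect_eq length_append by (metis le_add_diff_inverse)+
  then show False using uv by (simp only: append_take_drop_id words_def mem_Collect_eq simp_thms)
qed

lemma amp_add: "amp n m (x + y) = amp n m x + amp n m y"
  and amp_diff: "amp n m (x - y) = amp n m x - amp n m y"
  and amp_scaleC: "amp n m (c *\<^sub>C x) = c *\<^sub>C amp n m x"
  and amp_zero [simp]: "amp n m 0 = 0"
  by (simp_all add: amp_def tens_def fun_eq_iff algebra_simps scaleC_fun_def scaleC_complex_def)

lemma mstar_amp: "mstar (amp n m x) = amp n m (mstar x)"
  by (auto simp: amp_def tens_def mone_def mstar_def fun_eq_iff)

lemma amp_mone:
  assumes "n \<le> m" shows "amp n m (mone n) = mone m"
proof (intro ext)
  fix u v :: "3 list"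
  have "take n u = take n v \<and> drop n u = drop n v \<longleftrightarrow> u = v"
    by (metis append_take_drop_id)
  moreover have "take n u \<in> words n \<and> drop n u \<in> words (m - n) \<longleftrightarrow> u \<in> words m"
    using assms by (auto simp: words_def)
  moreover have "amp n m (mone n) u v = (if (take n u \<in> words n \<and> drop n u \<in> words (m - n)) \<and>
      (take n u = take n v \<and> drop n u = drop n v) then 1 else 0)"
  proof -
    have *: "(if P then 1 else 0) * (if Q then 1 else 0) = (if P \<and> Q then 1 else (0::complex))" for P Q
      by simp
    show ?thesis unfolding amp_def tens_def mone_def * by (rule if_cong) blast+
  qed
  ultimately show "amp n m (mone n) u v = mone m u v"
    by (simp only: mone_def)
qed

lemma amp_amp:
  assumes "k \<le> n" "n \<le> m" "x \<in> mats k" shows "amp n m (amp k n x) = amp k m x"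
proof (intro ext)
  fix u v
  show "amp n m (amp k n x) u v = amp k m x u v"
  proof (cases "u \<in> words m \<and> v \<in> words m")
    case True
    have *: "a * (if P then 1 else 0) * (if Q then 1 else 0) = a * (if P \<and> Q then 1 else (0::complex))"
      for P Q a by simp
    have iff: "drop k (take n u) = drop k (take n v) \<and> drop n u = drop n v \<longleftrightarrow> drop k u = drop k v"
      using assms(1) by (metis append_take_drop_id drop_drop drop_take le_add_diff_inverse2)
    have mem: "drop k (take n u) \<in> words (n - k)" "drop n u \<in> words (m - n)" "drop k u \<in> words (m - k)"
      using True assms(1,2) by (simp_all add: words_def)
    show ?thesis
      unfolding amp_def tens_def mone_def take_take min.absorb1[OF assms(1)] *
      by (simp only: mem simp_thms iff)
  next
    case False
    have "amp k m x \<in> mats m" "amp n m (amp k n x) \<in> mats m"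
      using assms by (auto intro!: mats_amp)
    then show ?thesis using False by (metis matsD)
  qed
qed

lemma mvec_amp:
  assumes "n \<le> m" "u \<in> words n" "t \<in> words (m - n)"
  shows "mvec m (amp n m x) f (u @ t) = mvec n x (\<lambda>v. f (v @ t)) u"
proof -
  have "mvec m (amp n m x) f (u @ t) =
     (\<Sum>s\<in>words (m - n). \<Sum>v\<in>words n. amp n m x (u @ t) (v @ s) * f (v @ s))"
    unfolding mvec_def using sum_words_append[OF assms(1)] by blast
  also have "\<dots> = (\<Sum>s\<in>words (m - n). if s = t then \<Sum>v\<in>words n. x u v * f (v @ s) else 0)"
    using assms by (intro sum.cong refl) (auto simp: amp_append)
  finally show ?thesis using assms by (simp add: mvec_def)
qed

lemma wnorm_append: "n \<le> m \<Longrightarrow> (wnorm m f)\<^sup>2 = (\<Sum>t\<in>words (m - n). (wnorm n (\<lambda>u. f (u @ t)))\<^sup>2)"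
  unfolding wnorm_sq by (rule sum_words_append)

lemma opnorm_amp [simp]:
  assumes "n \<le> m" shows "opnorm m (amp n m x) = opnorm n x"
proof (rule antisym)
  show "opnorm m (amp n m x) \<le> opnorm n x"
  proof (rule opnorm_le)
    fix f
    have "(wnorm m (mvec m (amp n m x) f))\<^sup>2 =
          (\<Sum>t\<in>words (m - n). (wnorm n (mvec n x (\<lambda>v. f (v @ t))))\<^sup>2)"
      unfolding wnorm_append[OF assms]
      by (intro sum.cong refl arg_cong[of _ _ "\<lambda>a. a\<^sup>2"] wnorm_cong mvec_amp assms)
    also have "\<dots> \<le> (\<Sum>t\<in>words (m - n). (opnorm n x * wnorm n (\<lambda>v. f (v @ t)))\<^sup>2)"
      by (intro sum_mono power_mono opnorm_bound) simp
    also have "\<dots> = (opnorm n x * wnorm m f)\<^sup>2"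
      by (simp add: power_mult_distrib wnorm_append[OF assms] sum_distrib_left)
    finally show "wnorm m (mvec m (amp n m x) f) \<le> opnorm n x * wnorm m f"
      by (rule power2_le_imp_le) simp
  qed simp
  obtain t0 where t0: "t0 \<in> words (m - n)" using words_ne by blast
  show "opnorm n x \<le> opnorm m (amp n m x)"
  proof (rule opnorm_le)
    fix f :: "3 list \<Rightarrow> complex"
    let ?g = "\<lambda>w. if drop n w = t0 then f (take n w) else 0"
    have g: "wnorm n (\<lambda>u. ?g (u @ t)) = (if t = t0 then wnorm n f else 0)" for t
    proof -
      have "wnorm n (\<lambda>u. ?g (u @ t)) = wnorm n (\<lambda>u. if t = t0 then f u else 0)"
        by (rule wnorm_cong) (auto simp: words_def)
      then show ?thesis by simp
    qed
    have "(wnorm m ?g)\<^sup>2 = (wnorm n f)\<^sup>2"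
      unfolding wnorm_append[OF assms] g using t0
      by (simp add: if_distrib[of "\<lambda>a. a\<^sup>2"] sum.delta cong: if_cong)
    then have 1: "wnorm m ?g = wnorm n f" by (simp add: power2_eq_iff_nonneg)
    have "wnorm n (mvec n x f) = wnorm n (\<lambda>u. mvec m (amp n m x) ?g (u @ t0))"
    proof (rule wnorm_cong)
      fix u assume u: "u \<in> words n"
      show "mvec n x f u = mvec m (amp n m x) ?g (u @ t0)"
        unfolding mvec_amp[OF assms u t0] unfolding mvec_def
        by (intro sum.cong) (auto simp: words_def)
    qed
    also have "\<dots> \<le> wnorm m (mvec m (amp n m x) ?g)"
    proof (rule power2_le_imp_le)
      show "(wnorm n (\<lambda>u. mvec m (amp n m x) ?g (u @ t0)))\<^sup>2 \<le> (wnorm m (mvec m (amp n m x) ?g))\<^sup>2"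
        unfolding wnorm_append[OF assms] by (rule member_le_sum[OF t0]) auto
    qed simp
    also have "\<dots> \<le> opnorm m (amp n m x) * wnorm m ?g" by (rule opnorm_bound)
    finally show "wnorm n (mvec n x f) \<le> opnorm m (amp n m x) * wnorm n f" by (simp only: 1)
  qed simp
qed

lemma amp_mmul:
  assumes "n \<le> m" "x \<in> mats n" "y \<in> mats n"
  shows "amp n m (mmul n x y) = mmul m (amp n m x) (amp n m y)"
proof (intro ext)
  fix u v
  show "amp n m (mmul n x y) u v = mmul m (amp n m x) (amp n m y) u v"
  proof (cases "u \<in> words m \<and> v \<in> words m")
    case True
    then obtain u1 t v1 s where uv: "u = u1 @ t" "v = v1 @ s"
      and w: "u1 \<in> words n" "v1 \<in> words n" "t \<in> words (m - n)" "s \<in> words (m - n)"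
      using assms(1) by (metis words_splitE)
    have "mmul m (amp n m x) (amp n m y) u v =
       (\<Sum>r\<in>words (m - n). \<Sum>q\<in>words n. amp n m x u (q @ r) * amp n m y (q @ r) v)"
      unfolding mmul_def by (rule sum_words_append[OF assms(1)])
    also have "\<dots> = (\<Sum>r\<in>words (m - n). if r = t then (if t = s then mmul n x y u1 v1 else 0) else 0)"
      unfolding uv by (intro sum.cong refl) (auto simp: amp_append w mmul_def)
    finally show ?thesis using w by (simp add: uv amp_append)
  next
    case False
    have "amp n m (mmul n x y) \<in> mats m" "mmul m (amp n m x) (amp n m y) \<in> mats m"
      using assms by (auto intro!: mats_amp mats_mmul)
    then show ?thesis using False by (metis matsD)
  qed
qed

lemma mmul_assoc: "mmul n (mmul n x y) z = mmul n x (mmul n y z)"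
proof (intro ext)
  fix u v
  have "mmul n (mmul n x y) z u v = (\<Sum>w\<in>words n. \<Sum>k\<in>words n. x u k * (y k w * z w v))"
    by (simp add: mmul_def sum_distrib_right mult.assoc)
  also have "\<dots> = (\<Sum>k\<in>words n. \<Sum>w\<in>words n. x u k * (y k w * z w v))"
    by (rule sum.swap)
  finally show "mmul n (mmul n x y) z u v = mmul n x (mmul n y z) u v"
    by (simp add: mmul_def sum_distrib_left)
qed

lemma mmul_add_left: "mmul n (x + y) z = mmul n x z + mmul n y z"
  and mmul_add_right: "mmul n z (x + y) = mmul n z x + mmul n z y"
  and mmul_scaleC_left: "mmul n (c *\<^sub>C x) y = c *\<^sub>C mmul n x y"
  and mmul_scaleC_right: "mmul n x (c *\<^sub>C y) = c *\<^sub>C mmul n x y"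
  by (simp_all add: mmul_def fun_eq_iff algebra_simps sum.distrib sum_distrib_left
      scaleC_fun_def scaleC_complex_def)

lemma mmul_mone_left:
  assumes "x \<in> mats n" shows "mmul n (mone n) x = x"
proof (intro ext)
  fix u v
  have "mmul n (mone n) x u v = (\<Sum>w\<in>words n. if w = u then x u v else 0)"
    unfolding mmul_def mone_def by (intro sum.cong) auto
  then show "mmul n (mone n) x u v = x u v"
    using matsD[OF assms, of u v] by auto
qed

lemma mmul_mone_right:
  assumes "x \<in> mats n" shows "mmul n x (mone n) = x"
proof (intro ext)
  fix u v
  have "mmul n x (mone n) u v = (\<Sum>w\<in>words n. if w = v then x u v else 0)"
    unfolding mmul_def mone_def by (intro sum.cong) auto
  then show "mmul n x (mone n) u v = x u v"
    using matsD[OF assms, of u v] by auto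
qed

lemma mstar_add: "mstar (x + y) = mstar x + mstar y"
  and mstar_scaleC: "mstar (c *\<^sub>C x) = cnj c *\<^sub>C mstar x"
  and mstar_mmul: "mstar (mmul n x y) = mmul n (mstar y) (mstar x)"
  by (simp_all add: mmul_def mstar_def fun_eq_iff mult.commute scaleC_fun_def scaleC_complex_def)

section \<open>The UHF algebra\<close>

text \<open>
  \<open>UHF(3\<^sup>\<infinity>)\<close> is the completion of the union of the matrix algebras along \<open>x \<mapsto> x \<otimes> 1\<close>. Since the
  union is increasing, its elements are represented by the sequences \<open>(x\<^sub>n)\<close> with \<open>x\<^sub>n\<close> in the
  \<open>n\<close>-th algebra that are Cauchy in the union, modulo null sequences.
\<close>

definition mcauchy :: "(nat \<Rightarrow> cmat) \<Rightarrow> bool" where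
  "mcauchy f \<longleftrightarrow> (\<forall>n. f n \<in> mats n) \<and>
     (\<forall>e>0. \<exists>N. \<forall>n\<ge>N. \<forall>m\<ge>n. opnorm m (f m - amp n m (f n)) < e)"

definition uhf_rel :: "(nat \<Rightarrow> cmat) \<Rightarrow> (nat \<Rightarrow> cmat) \<Rightarrow> bool" where
  "uhf_rel f g \<longleftrightarrow> mcauchy f \<and> mcauchy g \<and> (\<lambda>n. opnorm n (f n - g n)) \<longlonglongrightarrow> 0"

lemma opnorm_triangle: "opnorm n (x - z) \<le> opnorm n (x - y) + opnorm n (y - z)"
  using opnorm_add[of n "x - y" "y - z"] by simp

lemma opnorm_tri2: "\<bar>opnorm n x - opnorm n y\<bar> \<le> opnorm n (x - y)"
  using opnorm_add[of n "x - y" y] opnorm_add[of n "y - x" x] opnorm_minus_commute[of n x y] by simp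

lemma null_le:
  fixes f g :: "nat \<Rightarrow> real"
  assumes "g \<longlonglongrightarrow> 0" "\<And>n. 0 \<le> f n" "\<And>n. f n \<le> g n"
  shows "f \<longlonglongrightarrow> 0"
  by (rule tendsto_sandwich[OF _ _ tendsto_const assms(1)]) (use assms in auto)

lemma mcauchyD: "mcauchy f \<Longrightarrow> f n \<in> mats n"
  by (simp add: mcauchy_def)

lemma mcauchyE:
  assumes "mcauchy f" "e > 0"
  obtains N where "\<And>n m. N \<le> n \<Longrightarrow> n \<le> m \<Longrightarrow> opnorm m (f m - amp n m (f n)) < e"
  using assms unfolding mcauchy_def by blast

lemma mcauchy_bounded:
  assumes "mcauchy f" obtains C where "C > 0" "\<And>n. opnorm n (f n) \<le> C"
proof -
  obtain N where N: "\<And>n m. N \<le> n \<Longrightarrow> n \<le> m \<Longrightarrow> opnorm m (f m - amp n m (f n)) < 1"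
    using mcauchyE[OF assms zero_less_one] by blast
  let ?C = "1 + (\<Sum>n\<le>N. opnorm n (f n))"
  have "opnorm n (f n) \<le> ?C" for n
  proof (cases "n \<le> N")
    case True
    then have "opnorm n (f n) \<le> (\<Sum>n\<le>N. opnorm n (f n))" by (intro member_le_sum) auto
    then show ?thesis by simp
  next
    case False
    have "opnorm n (f n) \<le> opnorm n (f n - amp N n (f N)) + opnorm n (amp N n (f N))"
      using opnorm_add[of n "f n - amp N n (f N)" "amp N n (f N)"] by simp
    also have "\<dots> \<le> 1 + opnorm N (f N)" using N[of N n] False by simp
    also have "opnorm N (f N) \<le> (\<Sum>n\<le>N. opnorm n (f n))" by (intro member_le_sum) auto
    finally show ?thesis by simp
  qed
  moreover have "0 < ?C" by (simp add: add_pos_nonneg sum_nonneg)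
  ultimately show ?thesis by (rule that[rotated])
qed

lemma mcauchyI:
  assumes "\<And>n. f n \<in> mats n"
    and "\<And>e. e > 0 \<Longrightarrow> \<exists>N. \<forall>n\<ge>N. \<forall>m\<ge>n. opnorm m (f m - amp n m (f n)) \<le> e"
  shows "mcauchy f"
  unfolding mcauchy_def
proof (intro conjI allI impI)
  fix e :: real assume "e > 0"
  then obtain N where "\<forall>n\<ge>N. \<forall>m\<ge>n. opnorm m (f m - amp n m (f n)) \<le> e / 2"
    using assms(2)[of "e / 2"] by auto
  then show "\<exists>N. \<forall>n\<ge>N. \<forall>m\<ge>n. opnorm m (f m - amp n m (f n)) < e"
    using \<open>e > 0\<close> by (smt (verit) field_sum_of_halves)
qed (rule assms(1))

lemma mcauchy_add:
  assumes "mcauchy f" "mcauchy g" shows "mcauchy (\<lambda>n. f n + g n)"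
proof (rule mcauchyI)
  fix e :: real assume "e > 0"
  then obtain N M where
      N: "\<And>n m. N \<le> n \<Longrightarrow> n \<le> m \<Longrightarrow> opnorm m (f m - amp n m (f n)) < e / 2"
    and M: "\<And>n m. M \<le> n \<Longrightarrow> n \<le> m \<Longrightarrow> opnorm m (g m - amp n m (g n)) < e / 2"
    using assms by (meson half_gt_zero mcauchyE)
  have "opnorm m (f m + g m - amp n m (f n + g n)) \<le> e" if "max N M \<le> n" "n \<le> m" for n m
  proof -
    have "opnorm m ((f m - amp n m (f n)) + (g m - amp n m (g n))) \<le> e"
      using N[of n m] M[of n m] that opnorm_add[of m "f m - amp n m (f n)" "g m - amp n m (g n)"] by simp
    then show ?thesis by (simp add: amp_add algebra_simps)
  qed
  then show "\<exists>N. \<forall>n\<ge>N. \<forall>m\<ge>n. opnorm m (f m + g m - amp n m (f n + g n)) \<le> e" by blast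
qed (use assms in \<open>simp add: mats_add mcauchyD\<close>)

lemma mcauchy_scaleC:
  assumes "mcauchy f" shows "mcauchy (\<lambda>n. c *\<^sub>C f n)"
proof (rule mcauchyI)
  fix e :: real assume "e > 0"
  then have "e / (cmod c + 1) > 0" by (simp add: add_nonneg_pos)
  then obtain N where
      N: "\<And>n m. N \<le> n \<Longrightarrow> n \<le> m \<Longrightarrow> opnorm m (f m - amp n m (f n)) < e / (cmod c + 1)"
    using assms by (meson mcauchyE)
  have "opnorm m (c *\<^sub>C f m - amp n m (c *\<^sub>C f n)) \<le> e" if "N \<le> n" "n \<le> m" for n m
  proof -
    have "opnorm m (c *\<^sub>C f m - amp n m (c *\<^sub>C f n)) = cmod c * opnorm m (f m - amp n m (f n))"
      by (simp add: amp_scaleC opnorm_scaleC flip: cvec.scale_right_diff_distrib)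
    also have "\<dots> \<le> (cmod c + 1) * (e / (cmod c + 1))"
      using N[OF that] by (intro mult_mono) auto
    also have "\<dots> = e" using norm_ge_zero[of c] by (simp add: add_nonneg_eq_0_iff)
    finally show ?thesis .
  qed
  then show "\<exists>N. \<forall>n\<ge>N. \<forall>m\<ge>n. opnorm m (c *\<^sub>C f m - amp n m (c *\<^sub>C f n)) \<le> e" by blast
qed (use assms in \<open>simp add: mats_scaleC mcauchyD\<close>)

lemma mcauchy_diff: "mcauchy f \<Longrightarrow> mcauchy g \<Longrightarrow> mcauchy (\<lambda>n. f n - g n)"
  using mcauchy_add[of f "\<lambda>n. (-1) *\<^sub>C g n"] mcauchy_scaleC[of g "-1"]
  by (simp add: scaleC_one cvec.scale_minus_left)

lemma mcauchy_uminus: "mcauchy f \<Longrightarrow> mcauchy (\<lambda>n. - f n)"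
  using mcauchy_scaleC[of f "-1"] by (simp add: scaleC_one cvec.scale_minus_left)

lemma mmul_diff_left: "mmul n (x - y) z = mmul n x z - mmul n y z"
  and mmul_diff_right: "mmul n z (x - y) = mmul n z x - mmul n z y"
  by (simp_all add: mmul_def fun_eq_iff algebra_simps sum_subtractf)

lemma mmul_diff_opnorm:
  "opnorm n (mmul n x y - mmul n x' y') \<le> opnorm n x * opnorm n (y - y') + opnorm n (x - x') * opnorm n y'"
proof -
  have "mmul n x y - mmul n x' y' = mmul n x (y - y') + mmul n (x - x') y'"
    by (simp add: mmul_diff_left mmul_diff_right)
  then show ?thesis
    using opnorm_add[of n "mmul n x (y - y')" "mmul n (x - x') y'"] opnorm_mmul[of n x "y - y'"]
      opnorm_mmul[of n "x - x'" y'] by simp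
qed

lemma mcauchy_mmul:
  assumes "mcauchy f" "mcauchy g" shows "mcauchy (\<lambda>n. mmul n (f n) (g n))"
proof (rule mcauchyI)
  fix e :: real assume e: "e > 0"
  obtain C where C: "C > 0" "\<And>n. opnorm n (f n) \<le> C" using mcauchy_bounded[OF assms(1)] by blast
  obtain K where K: "K > 0" "\<And>n. opnorm n (g n) \<le> K" using mcauchy_bounded[OF assms(2)] by blast
  have "e / (2 * K) > 0" "e / (2 * C) > 0" using e C K by simp_all
  then obtain N M where
      N: "\<And>n m. N \<le> n \<Longrightarrow> n \<le> m \<Longrightarrow> opnorm m (f m - amp n m (f n)) < e / (2 * K)"
    and M: "\<And>n m. M \<le> n \<Longrightarrow> n \<le> m \<Longrightarrow> opnorm m (g m - amp n m (g n)) < e / (2 * C)"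
    using assms by (meson mcauchyE)
  have "opnorm m (mmul m (f m) (g m) - amp n m (mmul n (f n) (g n))) \<le> e"
    if "max N M \<le> n" "n \<le> m" for n m
  proof -
    have "opnorm m (mmul m (f m) (g m) - amp n m (mmul n (f n) (g n))) \<le>
      opnorm m (f m) * opnorm m (g m - amp n m (g n)) + opnorm m (f m - amp n m (f n)) * opnorm m (amp n m (g n))"
      using amp_mmul[OF that(2), of "f n" "g n"] assms by (simp only: mcauchyD mmul_diff_opnorm)
    also have "\<dots> \<le> C * (e / (2 * C)) + (e / (2 * K)) * K"
      using N[of n m] M[of n m] that C K e by (intro add_mono mult_mono) (auto simp: less_imp_le)
    also have "\<dots> = e" using C K by simp
    finally show ?thesis .
  qed
  then show "\<exists>N. \<forall>n\<ge>N. \<forall>m\<ge>n. opnorm m (mmul m (f m) (g m) - amp n m (mmul n (f n) (g n))) \<le> e"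
    by blast
qed (use assms in \<open>simp add: mats_mmul mcauchyD\<close>)

lemma mstar_diff: "mstar (x - y) = mstar x - mstar y"
  by (simp add: mstar_def fun_eq_iff)

lemma mcauchy_mstar:
  assumes "mcauchy f" shows "mcauchy (\<lambda>n. mstar (f n))"
  using assms unfolding mcauchy_def by (simp add: mats_mstar opnorm_mstar flip: mstar_amp mstar_diff)

lemma mcauchy_ev:
  assumes "\<And>n. f n \<in> mats n" "\<And>m. k \<le> m \<Longrightarrow> f m = amp k m x" "x \<in> mats k"
  shows "mcauchy f"
proof (rule mcauchyI)
  fix e :: real assume "e > 0"
  have "opnorm m (f m - amp n m (f n)) \<le> e" if "k \<le> n" "n \<le> m" for m n
  proof -
    have "f m = amp n m (f n)"
      using that assms(2)[of m] assms(2)[of n] amp_amp[OF that assms(3)] by (metis order_trans)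
    then show ?thesis using \<open>e > 0\<close> by (metis diff_self less_imp_le opnorm_zero)
  qed
  then show "\<exists>N. \<forall>n\<ge>N. \<forall>m\<ge>n. opnorm m (f m - amp n m (f n)) \<le> e" by blast
qed (rule assms(1))

lemma mcauchy_zero: "mcauchy (\<lambda>n. 0)"
  by (rule mcauchy_ev[where k = 0 and x = 0]) simp_all

lemma mcauchy_mone: "mcauchy mone"
  by (rule mcauchy_ev[where k = 0 and x = "mone 0"]) (simp_all add: amp_mone)

lemma uhf_rel_refl: "mcauchy f \<Longrightarrow> uhf_rel f f"
  by (simp add: uhf_rel_def)

lemma uhf_rel_sym:
  assumes "uhf_rel f g" shows "uhf_rel g f"
proof -
  have "(\<lambda>n. opnorm n (g n - f n)) = (\<lambda>n. opnorm n (f n - g n))"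
    by (rule ext) (rule opnorm_minus_commute)
  then show ?thesis using assms unfolding uhf_rel_def by (simp only: simp_thms)
qed

lemma uhf_rel_trans:
  assumes "uhf_rel f g" "uhf_rel g h" shows "uhf_rel f h"
proof -
  have "(\<lambda>n. opnorm n (f n - g n) + opnorm n (g n - h n)) \<longlonglongrightarrow> 0"
    using assms unfolding uhf_rel_def by (intro tendsto_add_zero) auto
  then have "(\<lambda>n. opnorm n (f n - h n)) \<longlonglongrightarrow> 0"
    by (rule null_le) (rule opnorm_nonneg, rule opnorm_triangle)
  then show "uhf_rel f h" using assms unfolding uhf_rel_def by blast
qed

lemma part_equivp_uhf_rel: "part_equivp uhf_rel"
proof (rule part_equivpI)
  show "\<exists>f. uhf_rel f f" by (rule exI, rule uhf_rel_refl, rule mcauchy_zero)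
  show "symp uhf_rel" by (rule sympI) (rule uhf_rel_sym)
  show "transp uhf_rel" by (rule transpI) (rule uhf_rel_trans)
qed

quotient_type uhf = "nat \<Rightarrow> cmat" / partial: uhf_rel
  by (rule part_equivp_uhf_rel)

lemma mcauchy_norm_convergent:
  assumes "mcauchy f" shows "convergent (\<lambda>n. opnorm n (f n))"
  unfolding Cauchy_convergent_iff[symmetric]
proof (rule metric_CauchyI)
  fix e :: real assume "e > 0"
  then obtain N where N: "\<And>n m. N \<le> n \<Longrightarrow> n \<le> m \<Longrightarrow> opnorm m (f m - amp n m (f n)) < e"
    using assms by (meson mcauchyE)
  have *: "\<bar>opnorm m (f m) - opnorm n (f n)\<bar> < e" if "N \<le> n" "n \<le> m" for m n
    using N[OF that] opnorm_tri2[of m "f m" "amp n m (f n)"] that by simp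
  have "dist (opnorm m (f m)) (opnorm n (f n)) < e" if "N \<le> m" "N \<le> n" for m n
    using *[of n m] *[of m n] that by (cases "n \<le> m") (auto simp: dist_real_def abs_minus_commute)
  then show "\<exists>M. \<forall>m\<ge>M. \<forall>n\<ge>M. dist (opnorm m (f m)) (opnorm n (f n)) < e" by blast
qed

lemma uhf_rel_lim:
  assumes "uhf_rel f g" shows "lim (\<lambda>n. opnorm n (f n)) = lim (\<lambda>n. opnorm n (g n))"
proof -
  have "(\<lambda>n. opnorm n (f n) - opnorm n (g n)) \<longlonglongrightarrow> 0"
    by (rule tendsto_rabs_zero_cancel, rule null_le[where g = "\<lambda>n. opnorm n (f n - g n)"])
      (use assms in \<open>auto simp: uhf_rel_def opnorm_tri2\<close>)
  moreover have "(\<lambda>n. opnorm n (g n)) \<longlonglongrightarrow> lim (\<lambda>n. opnorm n (g n))"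
    using assms mcauchy_norm_convergent convergent_LIMSEQ_iff by (auto simp: uhf_rel_def)
  ultimately have "(\<lambda>n. opnorm n (f n)) \<longlonglongrightarrow> lim (\<lambda>n. opnorm n (g n))"
    using tendsto_add by fastforce
  then show ?thesis by (rule limI)
qed

lemma uhf_rel_mcauchy: "uhf_rel f g \<Longrightarrow> mcauchy f" "uhf_rel f g \<Longrightarrow> mcauchy g"
  by (simp_all add: uhf_rel_def)

instantiation uhf :: complex_vector
begin

lift_definition zero_uhf :: uhf is "\<lambda>n. 0"
  by (intro uhf_rel_refl mcauchy_zero)

lift_definition plus_uhf :: "uhf \<Rightarrow> uhf \<Rightarrow> uhf" is "\<lambda>f g n. f n + g n"
proof -
  fix f f' g g' assume *: "uhf_rel f f'" "uhf_rel g g'"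
  then have "(\<lambda>n. opnorm n (f n - f' n) + opnorm n (g n - g' n)) \<longlonglongrightarrow> 0"
    unfolding uhf_rel_def by (intro tendsto_add_zero) auto
  then have "(\<lambda>n. opnorm n ((f n + g n) - (f' n + g' n))) \<longlonglongrightarrow> 0"
  proof (rule null_le)
    fix n show "opnorm n ((f n + g n) - (f' n + g' n)) \<le> opnorm n (f n - f' n) + opnorm n (g n - g' n)"
      using opnorm_add[of n "f n - f' n" "g n - g' n"] by (simp add: algebra_simps)
  qed simp
  then show "uhf_rel (\<lambda>n. f n + g n) (\<lambda>n. f' n + g' n)"
    using * by (auto simp: uhf_rel_def intro!: mcauchy_add)
qed

lift_definition scaleC_uhf :: "complex \<Rightarrow> uhf \<Rightarrow> uhf" is "\<lambda>c f n. c *\<^sub>C f n"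
proof -
  fix c f g assume *: "uhf_rel f g"
  then have "(\<lambda>n. cmod c * opnorm n (f n - g n)) \<longlonglongrightarrow> 0"
    unfolding uhf_rel_def by (intro tendsto_mult_right_zero) auto
  then have "(\<lambda>n. opnorm n (c *\<^sub>C f n - c *\<^sub>C g n)) \<longlonglongrightarrow> 0"
    by (simp add: opnorm_scaleC flip: cvec.scale_right_diff_distrib)
  then show "uhf_rel (\<lambda>n. c *\<^sub>C f n) (\<lambda>n. c *\<^sub>C g n)"
    using * by (auto simp: uhf_rel_def intro!: mcauchy_scaleC)
qed

lift_definition uminus_uhf :: "uhf \<Rightarrow> uhf" is "\<lambda>f n. - f n"
proof -
  fix f g assume "uhf_rel f g"
  moreover have "opnorm n (- f n - - g n) = opnorm n (f n - g n)" for n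
    using opnorm_minus_commute[of n "g n" "f n"] by simp
  ultimately show "uhf_rel (\<lambda>n. - f n) (\<lambda>n. - g n)"
    by (auto simp: uhf_rel_def intro!: mcauchy_uminus)
qed

lift_definition minus_uhf :: "uhf \<Rightarrow> uhf \<Rightarrow> uhf" is "\<lambda>f g n. f n - g n"
proof -
  fix f f' g g' assume *: "uhf_rel f f'" "uhf_rel g g'"
  then have "(\<lambda>n. opnorm n (f n - f' n) + opnorm n (g n - g' n)) \<longlonglongrightarrow> 0"
    unfolding uhf_rel_def by (intro tendsto_add_zero) auto
  then have "(\<lambda>n. opnorm n ((f n - g n) - (f' n - g' n))) \<longlonglongrightarrow> 0"
  proof (rule null_le)
    fix n show "opnorm n ((f n - g n) - (f' n - g' n)) \<le> opnorm n (f n - f' n) + opnorm n (g n - g' n)"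
      using opnorm_add[of n "f n - f' n" "g' n - g n"] opnorm_minus_commute[of n "g n" "g' n"]
      by (simp add: algebra_simps)
  qed simp
  then show "uhf_rel (\<lambda>n. f n - g n) (\<lambda>n. f' n - g' n)"
    using * by (auto simp: uhf_rel_def intro!: mcauchy_diff)
qed

instance
proof
  fix a b c :: uhf and r t :: complex
  show "a + b + c = a + (b + c)"
    by transfer (auto simp: add.assoc intro!: uhf_rel_refl mcauchy_add dest: uhf_rel_mcauchy)
  show "a + b = b + a"
    by transfer (auto simp: add.commute intro!: uhf_rel_refl mcauchy_add dest: uhf_rel_mcauchy)
  show "0 + a = a" "- a + a = 0" "a - b = a + - b"
    by (transfer; auto intro!: uhf_rel_refl mcauchy_diff mcauchy_zero dest: uhf_rel_mcauchy)+
  show "r *\<^sub>C (a + b) = r *\<^sub>C a + r *\<^sub>C b"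
    by transfer (auto simp: scaleC_add_right intro!: uhf_rel_refl mcauchy_add mcauchy_scaleC dest: uhf_rel_mcauchy)
  show "(r + t) *\<^sub>C a = r *\<^sub>C a + t *\<^sub>C a"
    by transfer (auto simp: scaleC_add_left intro!: uhf_rel_refl mcauchy_add mcauchy_scaleC dest: uhf_rel_mcauchy)
  show "r *\<^sub>C t *\<^sub>C a = (r * t) *\<^sub>C a"
    by transfer (auto simp: scaleC_scaleC intro!: uhf_rel_refl mcauchy_scaleC dest: uhf_rel_mcauchy)
  show "1 *\<^sub>C a = a"
    by transfer (auto simp: scaleC_one intro!: uhf_rel_refl dest: uhf_rel_mcauchy)
qed

end

lemma mcauchy_lim: "mcauchy f \<Longrightarrow> (\<lambda>n. opnorm n (f n)) \<longlonglongrightarrow> lim (\<lambda>n. opnorm n (f n))"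
  using mcauchy_norm_convergent convergent_LIMSEQ_iff by blast

instantiation uhf :: real_normed_algebra_1
begin

lift_definition one_uhf :: uhf is mone
  by (intro uhf_rel_refl mcauchy_mone)

lift_definition times_uhf :: "uhf \<Rightarrow> uhf \<Rightarrow> uhf" is "\<lambda>f g n. mmul n (f n) (g n)"
proof -
  fix f f' g g' assume *: "uhf_rel f f'" "uhf_rel g g'"
  obtain C where C: "C > 0" "\<And>n. opnorm n (f n) \<le> C"
    using mcauchy_bounded * by (metis uhf_rel_mcauchy(1))
  obtain K where K: "K > 0" "\<And>n. opnorm n (g' n) \<le> K"
    using mcauchy_bounded * by (metis uhf_rel_mcauchy(2))
  have "(\<lambda>n. C * opnorm n (g n - g' n) + opnorm n (f n - f' n) * K) \<longlonglongrightarrow> 0"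
    using * unfolding uhf_rel_def
    by (intro tendsto_add_zero tendsto_mult_right_zero tendsto_mult_left_zero) auto
  then have "(\<lambda>n. opnorm n (mmul n (f n) (g n) - mmul n (f' n) (g' n))) \<longlonglongrightarrow> 0"
  proof (rule null_le)
    fix n
    have "opnorm n (mmul n (f n) (g n) - mmul n (f' n) (g' n)) \<le>
      opnorm n (f n) * opnorm n (g n - g' n) + opnorm n (f n - f' n) * opnorm n (g' n)"
      by (rule mmul_diff_opnorm)
    also have "\<dots> \<le> C * opnorm n (g n - g' n) + opnorm n (f n - f' n) * K"
      using C K by (intro add_mono mult_mono) (auto simp: less_imp_le)
    finally show "opnorm n (mmul n (f n) (g n) - mmul n (f' n) (g' n)) \<le>
      C * opnorm n (g n - g' n) + opnorm n (f n - f' n) * K" .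
  qed simp
  then show "uhf_rel (\<lambda>n. mmul n (f n) (g n)) (\<lambda>n. mmul n (f' n) (g' n))"
    using * by (auto simp: uhf_rel_def intro!: mcauchy_mmul)
qed

lift_definition norm_uhf :: "uhf \<Rightarrow> real" is "\<lambda>f. lim (\<lambda>n. opnorm n (f n))"
  by (rule uhf_rel_lim)

definition scaleR_uhf :: "real \<Rightarrow> uhf \<Rightarrow> uhf" where
  "scaleR_uhf r x = complex_of_real r *\<^sub>C x"

definition dist_uhf :: "uhf \<Rightarrow> uhf \<Rightarrow> real" where "dist_uhf x y = norm (x - y)"

definition sgn_uhf :: "uhf \<Rightarrow> uhf" where "sgn_uhf x = scaleR (inverse (norm x)) x"

definition uniformity_uhf :: "(uhf \<times> uhf) filter" where
  "uniformity_uhf = (INF e\<in>{0 <..}. principal {(x, y). dist x y < e})"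

definition open_uhf :: "uhf set \<Rightarrow> bool" where
  "open_uhf U = (\<forall>x\<in>U. eventually (\<lambda>(x', y). x' = x \<longrightarrow> y \<in> U) uniformity)"

instance
proof
  fix a b c :: uhf and r t :: real
  show "dist a b = norm (a - b)" by (simp add: dist_uhf_def)
  show "sgn a = scaleR (inverse (norm a)) a" by (simp add: sgn_uhf_def)
  show "uniformity = (INF e\<in>{0 <..}. principal {(x::uhf, y). dist x y < e})"
    by (simp add: uniformity_uhf_def)
  show "open U = (\<forall>x\<in>U. eventually (\<lambda>(x', y). x' = x \<longrightarrow> y \<in> U) uniformity)" for U :: "uhf set"
    by (simp add: open_uhf_def)
  show "r *\<^sub>R (a + b) = r *\<^sub>R a + r *\<^sub>R b" "(r + t) *\<^sub>R a = r *\<^sub>R a + t *\<^sub>R a"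
    "r *\<^sub>R t *\<^sub>R a = (r * t) *\<^sub>R a" "1 *\<^sub>R a = a"
    by (simp_all add: scaleR_uhf_def scaleC_add_right scaleC_add_left scaleC_scaleC scaleC_one)
  show "a * b * c = a * (b * c)"
    by transfer (auto simp: mmul_assoc intro!: uhf_rel_refl mcauchy_mmul dest: uhf_rel_mcauchy)
  show "(a + b) * c = a * c + b * c" "a * (b + c) = a * b + a * c"
    by (transfer; auto simp: mmul_add_left mmul_add_right
        intro!: uhf_rel_refl mcauchy_mmul mcauchy_add dest: uhf_rel_mcauchy)+
  show "r *\<^sub>R a * b = r *\<^sub>R (a * b)" "a * r *\<^sub>R b = r *\<^sub>R (a * b)"
    unfolding scaleR_uhf_def
    by (transfer; auto simp: mmul_scaleC_left mmul_scaleC_right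
        intro!: uhf_rel_refl mcauchy_mmul mcauchy_scaleC dest: uhf_rel_mcauchy)+
  show "1 * a = a" "a * 1 = a"
    by (transfer; auto simp: mmul_mone_left mmul_mone_right mcauchyD
        intro!: uhf_rel_refl dest: uhf_rel_mcauchy)+
  show "norm (1::uhf) = 1"
    by transfer simp
  have *: "norm (z *\<^sub>C a) = cmod z * norm a" for z and a :: uhf
  proof transfer
    fix z f assume "uhf_rel f f"
    then have "(\<lambda>n. cmod z * opnorm n (f n)) \<longlonglongrightarrow> cmod z * lim (\<lambda>n. opnorm n (f n))"
      by (intro tendsto_mult_left mcauchy_lim) (auto dest: uhf_rel_mcauchy)
    then show "lim (\<lambda>n. opnorm n (z *\<^sub>C f n)) = cmod z * lim (\<lambda>n. opnorm n (f n))"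
      by (simp add: opnorm_scaleC limI)
  qed
  show "norm (r *\<^sub>R a) = \<bar>r\<bar> * norm a"
    unfolding scaleR_uhf_def using *[of "complex_of_real r" a] by simp
  show "norm (a + b) \<le> norm a + norm b"
  proof transfer
    fix f g assume "uhf_rel f f" "uhf_rel g g"
    then have *: "mcauchy f" "mcauchy g" by (auto dest: uhf_rel_mcauchy)
    show "lim (\<lambda>n. opnorm n (f n + g n)) \<le> lim (\<lambda>n. opnorm n (f n)) + lim (\<lambda>n. opnorm n (g n))"
      by (rule LIMSEQ_le[OF mcauchy_lim[OF mcauchy_add[OF *]] tendsto_add[OF mcauchy_lim[OF *(1)] mcauchy_lim[OF *(2)]]])
        (auto simp: opnorm_add)
  qed
  show "norm (a * b) \<le> norm a * norm b"
  proof transfer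
    fix f g assume "uhf_rel f f" "uhf_rel g g"
    then have *: "mcauchy f" "mcauchy g" by (auto dest: uhf_rel_mcauchy)
    show "lim (\<lambda>n. opnorm n (mmul n (f n) (g n))) \<le> lim (\<lambda>n. opnorm n (f n)) * lim (\<lambda>n. opnorm n (g n))"
      by (rule LIMSEQ_le[OF mcauchy_lim[OF mcauchy_mmul[OF *]] tendsto_mult[OF mcauchy_lim[OF *(1)] mcauchy_lim[OF *(2)]]])
        (auto simp: opnorm_mmul)
  qed
  show "norm a = 0 \<longleftrightarrow> a = 0"
  proof transfer
    fix f assume "uhf_rel f f"
    then have *: "mcauchy f" by (auto dest: uhf_rel_mcauchy)
    show "lim (\<lambda>n. opnorm n (f n)) = 0 \<longleftrightarrow> uhf_rel f (\<lambda>n. 0)"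
    proof -
      have "uhf_rel f (\<lambda>n. 0) \<longleftrightarrow> (\<lambda>n. opnorm n (f n)) \<longlonglongrightarrow> 0"
        unfolding uhf_rel_def by (simp add: * mcauchy_zero)
      then show ?thesis using mcauchy_lim[OF *] limI by metis
    qed
  qed
  show "(0::uhf) \<noteq> 1"
    by transfer (simp add: uhf_rel_def opnorm_uminus LIMSEQ_const_iff)
qed

end

text \<open>
  The canonical embedding of the \<open>n\<close>-th matrix algebra. Outside that algebra its value is the
  junk value \<open>0\<close>.
\<close>

lift_definition iota :: "nat \<Rightarrow> cmat \<Rightarrow> uhf" is
  "\<lambda>n x m. if x \<in> mats n \<and> n \<le> m then amp n m x else 0"
proof -
  fix n x
  show "uhf_rel (\<lambda>m. if x \<in> mats n \<and> n \<le> m then amp n m x else 0)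
    (\<lambda>m. if x \<in> mats n \<and> n \<le> m then amp n m x else 0)"
  proof (rule uhf_rel_refl, cases "x \<in> mats n")
    case True
    then show "mcauchy (\<lambda>m. if x \<in> mats n \<and> n \<le> m then amp n m x else 0)"
      by (intro mcauchy_ev[where k = n and x = x]) (auto simp: mats_amp)
  next
    case False
    then show "mcauchy (\<lambda>m. if x \<in> mats n \<and> n \<le> m then amp n m x else 0)"
      by (simp add: mcauchy_zero)
  qed
qed

lemma uhf_cases:
  obtains f where "mcauchy f" "a = abs_uhf f"
proof -
  have "uhf_rel (rep_uhf a) (rep_uhf a)" by (rule Quotient_rep_reflp[OF Quotient_uhf])
  moreover have "a = abs_uhf (rep_uhf a)" by (simp add: Quotient_abs_rep[OF Quotient_uhf])
  ultimately show ?thesis using that uhf_rel_mcauchy(1) by blast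
qed

lemma iota_eq:
  assumes "x \<in> mats n"
  shows "iota n x = abs_uhf (\<lambda>m. if n \<le> m then amp n m x else 0)"
    and "mcauchy (\<lambda>m. if n \<le> m then amp n m x else 0)"
proof -
  show "iota n x = abs_uhf (\<lambda>m. if n \<le> m then amp n m x else 0)"
    using assms by (simp add: iota.abs_eq)
  show "mcauchy (\<lambda>m. if n \<le> m then amp n m x else 0)"
    using assms by (intro mcauchy_ev[where k = n and x = x]) (auto simp: mats_amp)
qed

lemma norm_abs_diff:
  assumes "mcauchy f" "mcauchy g"
  shows "(\<lambda>m. opnorm m (f m - g m)) \<longlonglongrightarrow> norm (abs_uhf f - abs_uhf g)"
proof -
  have "norm (abs_uhf f - abs_uhf g) = lim (\<lambda>m. opnorm m (f m - g m))"
    using assms by (simp add: minus_uhf.abs_eq norm_uhf.abs_eq uhf_rel_refl mcauchy_diff)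
  then show ?thesis using mcauchy_lim[OF mcauchy_diff[OF assms]] by simp
qed

lemma norm_iota_approx:
  assumes "mcauchy f" "x \<in> mats n" "\<And>m. N \<le> m \<Longrightarrow> n \<le> m \<Longrightarrow> opnorm m (f m - amp n m x) \<le> e"
  shows "norm (abs_uhf f - iota n x) \<le> e"
proof -
  let ?g = "\<lambda>m. if n \<le> m then amp n m x else 0"
  have "(\<lambda>m. opnorm m (f m - ?g m)) \<longlonglongrightarrow> norm (abs_uhf f - iota n x)"
    unfolding iota_eq(1)[OF assms(2)] by (rule norm_abs_diff[OF assms(1) iota_eq(2)[OF assms(2)]])
  then show ?thesis
  proof (rule tendsto_upperbound)
    show "\<forall>\<^sub>F m in sequentially. opnorm m (f m - ?g m) \<le> e"
      using assms(3) by (intro eventually_sequentiallyI[of "max n N"]) simp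
  qed simp
qed

lemma norm_iota_diff:
  assumes "x \<in> mats n" "y \<in> mats m" "n \<le> m"
  shows "norm (iota m y - iota n x) = opnorm m (y - amp n m x)"
proof -
  let ?g = "\<lambda>k. if n \<le> k then amp n k x else 0" and ?f = "\<lambda>k. if m \<le> k then amp m k y else 0"
  have "(\<lambda>k. opnorm k (?f k - ?g k)) \<longlonglongrightarrow> norm (iota m y - iota n x)"
    unfolding iota_eq(1)[OF assms(1)] iota_eq(1)[OF assms(2)]
    by (rule norm_abs_diff[OF iota_eq(2)[OF assms(2)] iota_eq(2)[OF assms(1)]])
  moreover have "\<forall>\<^sub>F k in sequentially. opnorm k (?f k - ?g k) = opnorm m (y - amp n m x)"
  proof (rule eventually_sequentiallyI[of m])
    fix k assume k: "m \<le> k"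
    have "?f k - ?g k = amp m k y - amp m k (amp n m x)"
      using k assms(3) amp_amp[OF assms(3) k assms(1)] by simp
    also have "\<dots> = amp m k (y - amp n m x)" by (rule amp_diff[symmetric])
    finally show "opnorm k (?f k - ?g k) = opnorm m (y - amp n m x)" using k by simp
  qed
  ultimately have "(\<lambda>k. opnorm m (y - amp n m x)) \<longlonglongrightarrow> norm (iota m y - iota n x)"
    by (rule Lim_transform_eventually)
  then show ?thesis by (simp add: LIMSEQ_const_iff)
qed

lemma uhf_dense:
  assumes "e > 0" shows "\<exists>N. \<forall>n\<ge>N. \<exists>x\<in>mats n. norm (a - iota n x) < e"
proof -
  obtain f where f: "mcauchy f" "a = abs_uhf f" by (rule uhf_cases)
  obtain N where N: "\<And>n m. N \<le> n \<Longrightarrow> n \<le> m \<Longrightarrow> opnorm m (f m - amp n m (f n)) < e / 2"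
    using mcauchyE[OF f(1), of "e / 2"] assms by (metis half_gt_zero)
  have "norm (a - iota n (f n)) < e" if n: "N \<le> n" for n
  proof -
    have "norm (a - iota n (f n)) \<le> e / 2"
      unfolding f(2) using N[OF n] by (intro norm_iota_approx[OF f(1) mcauchyD[OF f(1)], where N = n]) (simp add: less_imp_le)
    then show ?thesis using assms by simp
  qed
  then show ?thesis using mcauchyD[OF f(1)] by blast
qed

instance uhf :: banach
proof
  fix X :: "nat \<Rightarrow> uhf" assume X: "Cauchy X"
  have "\<exists>N. \<forall>n\<ge>N. \<exists>x\<in>mats n. norm (X k - iota n x) < 1 / real (Suc k)" for k
    by (rule uhf_dense) simp
  then obtain N where N: "\<And>k n. N k \<le> n \<Longrightarrow> \<exists>x\<in>mats n. norm (X k - iota n x) < 1 / real (Suc k)"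
    by metis
  define K where "K n = (if \<exists>k\<le>n. N k \<le> n then Max {k. k \<le> n \<and> N k \<le> n} else 0)" for n
  have K_ge: "k \<le> K n \<and> N (K n) \<le> n" if "k \<le> n" "N k \<le> n" for k n
  proof -
    have "K n = Max {k. k \<le> n \<and> N k \<le> n}" using that unfolding K_def by auto
    moreover have "Max {k. k \<le> n \<and> N k \<le> n} \<in> {k. k \<le> n \<and> N k \<le> n}"
      using that by (intro Max_in) auto
    moreover have "k \<le> Max {k. k \<le> n \<and> N k \<le> n}"
      using that by (intro Max_ge) auto
    ultimately show ?thesis by simp
  qed
  have "\<exists>x. x \<in> mats n \<and> (N (K n) \<le> n \<longrightarrow> norm (X (K n) - iota n x) < 1 / real (Suc (K n)))" for n
    using N[of "K n" n] mats_zero by blast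
  then obtain y where
    y: "\<And>n. y n \<in> mats n \<and> (N (K n) \<le> n \<longrightarrow> norm (X (K n) - iota n (y n)) < 1 / real (Suc (K n)))"
    by metis
  have lim: "\<exists>M. \<forall>n\<ge>M. \<forall>k\<ge>M. norm (X k - iota n (y n)) < e" if e: "e > 0" for e
  proof -
    obtain L where L: "\<And>k l. L \<le> k \<Longrightarrow> L \<le> l \<Longrightarrow> norm (X k - X l) < e / 2"
      using CauchyD[OF X, of "e / 2"] e by auto
    obtain p where p: "1 / real (Suc p) < e / 2"
      using e nat_approx_posE[of "e / 2"] by auto
    let ?q = "max L p"
    have "norm (X k - iota n (y n)) < e" if "max ?q (N ?q) \<le> n" "L \<le> k" for n k
    proof -
      have K: "?q \<le> K n" "N (K n) \<le> n" using K_ge[of ?q n] that by auto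
      have "1 / real (Suc (K n)) \<le> 1 / real (Suc p)" using K by (intro frac_le) auto
      then have "norm (X (K n) - iota n (y n)) < e / 2" using y[of n] K p by linarith
      moreover have "norm (X k - X (K n)) < e / 2" using L that K by simp
      ultimately show ?thesis
        using norm_triangle_ineq[of "X k - X (K n)" "X (K n) - iota n (y n)"] by simp
    qed
    then show ?thesis by (meson max.boundedE max.cobounded1 order_trans)
  qed
  have my: "mcauchy y"
  proof (rule mcauchyI)
    show "y n \<in> mats n" for n using y by blast
    fix e :: real assume "e > 0"
    then obtain M where M: "\<And>n k. M \<le> n \<Longrightarrow> M \<le> k \<Longrightarrow> norm (X k - iota n (y n)) < e / 2"
      using lim[of "e / 2"] by auto
    have "opnorm m (y m - amp n m (y n)) \<le> e" if "M \<le> n" "n \<le> m" for n m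
    proof -
      have "norm (iota m (y m) - iota n (y n)) \<le> e"
        using M[of n M] M[of m M] that norm_triangle_ineq4[of "X M - iota n (y n)" "X M - iota m (y m)"] by simp
      then show ?thesis using norm_iota_diff[of "y n" n "y m" m] y that by simp
    qed
    then show "\<exists>N. \<forall>n\<ge>N. \<forall>m\<ge>n. opnorm m (y m - amp n m (y n)) \<le> e" by blast
  qed
  have "X \<longlonglongrightarrow> abs_uhf y"
  proof (rule LIMSEQ_I)
    fix e :: real assume e: "e > 0"
    then obtain M where M: "\<And>n k. M \<le> n \<Longrightarrow> M \<le> k \<Longrightarrow> norm (X k - iota n (y n)) < e / 2"
      using lim[of "e / 2"] by auto
    obtain L where L: "\<And>n m. L \<le> n \<Longrightarrow> n \<le> m \<Longrightarrow> opnorm m (y m - amp n m (y n)) < e / 2"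
      using mcauchyE[OF my, of "e / 2"] e by (metis half_gt_zero)
    let ?n = "max M L"
    have "norm (abs_uhf y - iota ?n (y ?n)) \<le> e / 2"
      using L y by (intro norm_iota_approx[OF my, where N = ?n]) (auto simp: less_imp_le)
    moreover have "norm (X k - iota ?n (y ?n)) < e / 2" if "M \<le> k" for k
      using M that by simp
    ultimately have "norm (X k - abs_uhf y) < e" if "M \<le> k" for k
      using norm_triangle_ineq4[of "X k - iota ?n (y ?n)" "abs_uhf y - iota ?n (y ?n)"] that by fastforce
    then show "\<exists>no. \<forall>n\<ge>no. norm (X n - abs_uhf y) < e" by blast
  qed
  then show "convergent X" by (auto simp: convergent_def)
qed

instantiation uhf :: cstar_algebra
begin

lift_definition star_uhf :: "uhf \<Rightarrow> uhf" is "\<lambda>f n. mstar (f n)"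
  unfolding uhf_rel_def by (simp add: mcauchy_mstar flip: mstar_diff)

instance
proof
  fix a b :: uhf and r :: real and c :: complex
  show "r *\<^sub>R a = complex_of_real r *\<^sub>C a" by (simp add: scaleR_uhf_def)
  show "c *\<^sub>C a * b = c *\<^sub>C (a * b)" "a * c *\<^sub>C b = c *\<^sub>C (a * b)"
    by (transfer; auto simp: mmul_scaleC_left mmul_scaleC_right
        intro!: uhf_rel_refl mcauchy_mmul mcauchy_scaleC dest: uhf_rel_mcauchy)+
  show "norm (c *\<^sub>C a) = cmod c * norm a"
  proof transfer
    fix z f assume "uhf_rel f f"
    then have "(\<lambda>n. cmod z * opnorm n (f n)) \<longlonglongrightarrow> cmod z * lim (\<lambda>n. opnorm n (f n))"
      by (intro tendsto_mult_left mcauchy_lim) (auto dest: uhf_rel_mcauchy)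
    then show "lim (\<lambda>n. opnorm n (z *\<^sub>C f n)) = cmod z * lim (\<lambda>n. opnorm n (f n))"
      by (simp add: opnorm_scaleC limI)
  qed
  show "star (a + b) = star a + star b"
    by transfer (auto simp: mstar_add intro!: uhf_rel_refl mcauchy_add mcauchy_mstar dest: uhf_rel_mcauchy)
  show "star (c *\<^sub>C a) = cnj c *\<^sub>C star a"
    by transfer (auto simp: mstar_scaleC intro!: uhf_rel_refl mcauchy_scaleC mcauchy_mstar dest: uhf_rel_mcauchy)
  show "star (a * b) = star b * star a"
    by transfer (auto simp: mstar_mmul intro!: uhf_rel_refl mcauchy_mmul mcauchy_mstar dest: uhf_rel_mcauchy)
  show "star (star a) = a"
    by transfer (auto intro!: uhf_rel_refl dest: uhf_rel_mcauchy)
  show "norm (star a * a) = (norm a)\<^sup>2"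
  proof transfer
    fix f assume "uhf_rel f f"
    then have "(\<lambda>n. (opnorm n (f n))\<^sup>2) \<longlonglongrightarrow> (lim (\<lambda>n. opnorm n (f n)))\<^sup>2"
      by (intro tendsto_power mcauchy_lim) (auto dest: uhf_rel_mcauchy)
    then show "lim (\<lambda>n. opnorm n (mmul n (mstar (f n)) (f n))) = (lim (\<lambda>n. opnorm n (f n)))\<^sup>2"
      by (simp add: opnorm_cstar limI)
  qed
qed

end

definition approximates :: "(nat \<Rightarrow> cmat) \<Rightarrow> uhf \<Rightarrow> bool" where
  "approximates x a \<longleftrightarrow> (\<forall>n. x n \<in> mats n) \<and> (\<lambda>n. iota n (x n)) \<longlonglongrightarrow> a"

text \<open>The normalized trace, extended by continuity from the matrix algebras.\<close>

definition uhf_trace :: "uhf \<Rightarrow> complex" where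
  "uhf_trace a = (THE t. \<forall>x. approximates x a \<longrightarrow> (\<lambda>n. mtr n (x n) / 3 ^ n) \<longlonglongrightarrow> t)"

text \<open>
  The slice map \<open>\<rho>\<^sub>n\<close>: on the \<open>m\<close>-th matrix algebra, \<open>m > n\<close>, it takes the entry indexed by
  \<open>(2, 2)\<close> in each of the last \<open>m - (n + 1)\<close> tensor factors; it is then extended by continuity.
  The values of \<open>slice n m\<close> for \<open>m \<le> n\<close> do not affect the limit.
\<close>

definition slice :: "nat \<Rightarrow> nat \<Rightarrow> cmat \<Rightarrow> cmat" where
  "slice n m x u v = (if u \<in> words (n + 1) \<and> v \<in> words (n + 1)
     then x (u @ replicate (m - (n + 1)) 2) (v @ replicate (m - (n + 1)) 2) else 0)"

definition rho :: "nat \<Rightarrow> uhf \<Rightarrow> cmat" where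
  "rho n a = (THE y. \<forall>x. approximates x a \<longrightarrow> (\<forall>u v. (\<lambda>m. slice n m (x m) u v) \<longlonglongrightarrow> y u v))"

section \<open>The noncommutative gasket\<close>

definition munit :: "3 \<Rightarrow> 3 \<Rightarrow> cmat" where
  "munit i j u v = (if u = [i] \<and> v = [j] then 1 else 0)"

primrec tpow :: "cmat \<Rightarrow> nat \<Rightarrow> cmat" where
  "tpow x 0 = mone 0"
| "tpow x (Suc n) = tens 1 x (tpow x n)"

definition alpha :: "nat \<Rightarrow> 3 \<Rightarrow> cmat" where
  "alpha n j = tens 1 (munit j j) (tpow (munit 2 2) n)"

definition beta :: "nat \<Rightarrow> 3 \<Rightarrow> cmat" where
  "beta k j = tens 2 (tens 1 (munit j j) (munit 1 1) + tens 1 (munit (j + 2) (j + 2)) (munit 3 3))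
     (tpow (munit 2 2) (k - 1))"

definition gasket :: "nat \<Rightarrow> cmat set" where
  "gasket n = cvec.span (range (alpha n) \<union>
     {tens (n - k) x (beta k j) | x k j. 1 \<le> k \<and> k \<le> n \<and> x \<in> mats (n - k)})"

definition gasket_inf :: "uhf set" where
  "gasket_inf = {a. \<exists>x. (\<forall>n. x n \<in> gasket n) \<and> (\<lambda>n. iota (n + 1) (x n)) \<longlonglongrightarrow> a}"

text \<open>
  \<open>vcomp b i\<close> is the component \<open>b(v\<^sub>i)\<close>. The sum in \<open>energy\<close> is over ordered pairs \<open>i \<noteq> j\<close>.
\<close>

definition vcomp :: "cmat \<Rightarrow> 3 \<Rightarrow> cmat" where
  "vcomp b i u v = b (u @ [i]) (v @ [i])"

definition energy :: "nat \<Rightarrow> cmat \<Rightarrow> real" where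
  "energy n b = (\<Sum>i\<in>UNIV. \<Sum>j\<in>UNIV - {i}.
     Re (mtr n (mmul n (mstar (vcomp b i - vcomp b j)) (vcomp b i - vcomp b j))))"

definition energy_inf :: "uhf \<Rightarrow> ennreal" where
  "energy_inf a = lim (\<lambda>m. ennreal ((5 / 3) ^ m * energy m (rho m a)))"

definition energy_dom :: "uhf set" where
  "energy_dom = {a \<in> gasket_inf. energy_inf a < \<infinity>}"

section \<open>The triple\<close>

text \<open>
  An element of \<open>(\<complex>\<^sup>3)\<^sup>\<otimes>\<^sup>n \<otimes> E\<close> is a function from words to \<open>E\<close> that vanishes on the words of length
  other than \<open>n\<close>; \<open>x \<otimes> m\<close> corresponds to \<open>\<lambda>w. x\<^sub>w m\<close>. The Hilbert direct sum over \<open>n\<close> is formed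
  inside the space of functions on all words, the component in degree \<open>n\<close> being \<open>level n \<xi>\<close>;
  \<open>op_sum T\<close> applies \<open>T n\<close> to the component in degree \<open>n\<close>.
\<close>

type_synonym hvec = "3 list \<Rightarrow> complex^3^3"

definition offdiag :: "(complex^3^3) set" where
  "offdiag = {x. \<forall>j. x $ j $ j = 0}"

definition hs_inner :: "complex^3^3 \<Rightarrow> complex^3^3 \<Rightarrow> complex" where
  "hs_inner x y = trace ((\<chi> i j. cnj (x $ j $ i)) ** y)"

definition inner_H :: "hvec \<Rightarrow> hvec \<Rightarrow> complex" where
  "inner_H \<xi> \<eta> = (\<Sum>\<^sub>\<infinity>w. hs_inner (\<xi> w) (\<eta> w))"

definition H_level :: "nat \<Rightarrow> hvec set" where
  "H_level n = {\<xi>. \<forall>w. \<xi> w \<in> offdiag \<and> (w \<notin> words n \<longrightarrow> \<xi> w = 0)}"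

definition level :: "nat \<Rightarrow> hvec \<Rightarrow> hvec" where
  "level n \<xi> w = (if w \<in> words n then \<xi> w else 0)"

definition H_sum :: "hvec set" where
  "H_sum = {\<xi>. (\<forall>n. level n \<xi> \<in> H_level n) \<and> summable (\<lambda>n. (hnorm inner_H (level n \<xi>))\<^sup>2)}"

definition op_sum :: "(nat \<Rightarrow> hvec \<Rightarrow> hvec) \<Rightarrow> hvec \<Rightarrow> hvec" where
  "op_sum T \<xi> w = T (length w) (level (length w) \<xi>) w"

definition F_level :: "nat \<Rightarrow> hvec \<Rightarrow> hvec" where
  "F_level n z w = transpose (z w)"

definition D_level :: "nat \<Rightarrow> hvec \<Rightarrow> hvec" where
  "D_level n z = (2 ^ n) *\<^sub>C F_level n z"

definition D_sum :: "hvec \<Rightarrow> hvec" where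
  "D_sum = op_sum D_level"

definition D_dom :: "hvec set" where
  "D_dom = {\<xi> \<in> H_sum. D_sum \<xi> \<in> H_sum}"

text \<open>
  The action \<open>(a \<otimes> b)(x \<otimes> m) = a x \<otimes> b m\<close> of the \<open>(n + 1)\<close>-fold tensor power of \<open>M\<^sub>3(\<complex>)\<close> on
  vectors of level \<open>n\<close>; only elements whose last factor is diagonal preserve \<open>H_level n\<close>.
\<close>

definition act :: "nat \<Rightarrow> cmat \<Rightarrow> hvec \<Rightarrow> hvec" where
  "act n c z w = (if w \<in> words n
     then \<chi> i j. \<Sum>w'\<in>words n. \<Sum>k\<in>UNIV. c (w @ [i]) (w' @ [k]) * z w' $ k $ j else 0)"

definition pi_level :: "nat \<Rightarrow> uhf \<Rightarrow> hvec \<Rightarrow> hvec" where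
  "pi_level n a z = act n (rho n a) z"

definition pi_sum :: "uhf \<Rightarrow> hvec \<Rightarrow> hvec" where
  "pi_sum a = op_sum (\<lambda>n. pi_level n a)"

definition comm_level :: "nat \<Rightarrow> uhf \<Rightarrow> hvec \<Rightarrow> hvec" where
  "comm_level n a z = D_level n (pi_level n a z) - pi_level n a (D_level n z)"

definition D_power :: "real \<Rightarrow> hvec \<Rightarrow> hvec" where
  "D_power p = abs_power H_sum inner_H D_dom D_sum p"

text \<open>
  \<open>tr(|[D, a]|\<^sup>2 |D|\<^sup>-\<^sup>s)\<close> is by convention the sum over \<open>n\<close> of the terms
  \<open>2\<^sup>-\<^sup>s\<^sup>n tr(|[D\<^sub>n, \<pi>\<^sub>n(a)]|\<^sup>2)\<close> below, where \<open>|T|\<^sup>2 = T\<^sup>* T\<close> on the \<open>n\<close>-th summand.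
\<close>

definition comm_zeta_term :: "uhf \<Rightarrow> real \<Rightarrow> nat \<Rightarrow> complex" where
  "comm_zeta_term a s n = complex_of_real (2 powr (- s * real n)) *
     op_trace (H_level n) inner_H (op_adjoint (H_level n) inner_H (comm_level n a) \<circ> comm_level n a)"

end

theory Submission
  imports Defs "HOL-Complex_Analysis.Great_Picard"
begin

text \<open>
  An element of \<open>\<A>\<^sub>n\<close> is a function \<open>b(v\<^sub>1), b(v\<^sub>2), b(v\<^sub>3)\<close> on the corners of a noncommutative cell, and
  passing from level \<open>n\<close> to level \<open>n + 1\<close> keeps the corners and adds three new vertices. Affine
  interpolation at the new vertices halves the differences \<open>b(v\<^sub>i) - b(v\<^sub>j)\<close>, so it produces elements of
  \<open>\<A>\<^sub>\<infinity>\<close> whose level \<open>n\<close> differences are \<open>O(2\<^sup>-\<^sup>n)\<close>. These elements are dense, and they have bounded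
  commutators because \<open>[D\<^sub>n, \<pi>\<^sub>n(a)]\<close> acts on the \<open>(i, j)\<close> entry by \<open>2\<^sup>n (b(v\<^sub>j) - b(v\<^sub>i))\<close>, followed by a
  transposition, with \<open>b = \<rho>\<^sub>n(a)\<close>. Moreover
  \<open>tr(\<pi>\<^sub>n(a)) = 2 Tr(\<rho>\<^sub>n(a))\<close> and \<open>tr(|[D\<^sub>n, \<pi>\<^sub>n(a)]|\<^sup>2) = 4\<^sup>n \<E>\<^sub>n[\<rho>\<^sub>n(a)]\<close>. Hence, with \<open>r = 2 powr (s\<^sub>0 - s)\<close>
  and \<open>s\<^sub>0 = d\<close> or \<open>s\<^sub>0 = \<delta>\<close>, both zeta functions have the form \<open>\<Sum>\<^sub>n r\<^sup>n x\<^sub>n\<close> for a convergent sequence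
  \<open>x\<^sub>n\<close>, and by an Abelian theorem the residue is \<open>lim x\<^sub>n / ln 2\<close>.
\<close>

text \<open>The span that defines \<open>gasket n\<close> is a poor handle on products and limits.
  It is replaced by \<open>gasket_rec\<close>, whose conditions are equations between matrix blocks,
  so they survive products, adjoints and entrywise limits. The state x_22 in the slice map selects
  the old corners; hence \<open>rho n a\<close> is \<open>rho (Suc n) a\<close> restricted to them.
  Compression to an index is not multiplicative on all matrices, but it is on those with diagonal
  last factor, and so \<rho>_n is multiplicative on the gasket algebra.

  \<open>has_op_trace\<close> quantifies over all orthonormal bases, whereas D, \<pi>(a) and the
  commutators are explicit only in the basis e_w \<otimes> e_ij. The bridge: if the norms of T e are
  summable over one basis, the diagonal sums agree in all bases.

  The exponents are growth rates. Level n has dimension 6 * 3^n, so 2^d = 3. A finite limit of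
  (5/3)^n \<E>_n gives 4^n \<E>_n the rate 12/5, so 2^\<delta> = 12/5. The ratio 3/5 is the energy
  factor of harmonic interpolation; affine interpolation has factor 3/4 and serves only for the
  commutator bounds.\<close>

lemma mod3_simps: "(1::3) + 2 = 3" "(2::3) + 2 = 1" "(3::3) + 2 = 2" "(4::3) = 1" "(5::3) = 2" "(1::3) \<noteq> 2" "(1::3) \<noteq> 3" "(2::3) \<noteq> 3" "(2::3) \<noteq> 1" "(3::3) \<noteq> 1" "(3::3) \<noteq> 2"
  by simp_all

lemma UNIV3: "(UNIV :: 3 set) = {1, 2, 3}"
  using exhaust_3 by auto

section \<open>Matrices with diagonal last tensor factor\<close>

text \<open>The algebra M_3^n \<otimes> C^3 inside the (n + 1)-fold tensor power: diagonal in the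
  last letter, hence a triple of matrices indexed by the corners.\<close>

definition dmats :: "nat \<Rightarrow> cmat set" where
  "dmats n = {c \<in> mats (Suc n). \<forall>u v i k. i \<noteq> k \<longrightarrow> c (u @ [i]) (v @ [k]) = 0}"

text \<open>The inverse of \<open>vcomp\<close>, that is the sum of f(i) \<otimes> e_ii; the last
  letter of a word carries the corner.\<close>

definition glue :: "(3 \<Rightarrow> cmat) \<Rightarrow> cmat" where
  "glue f u v = (if u \<noteq> [] \<and> v \<noteq> [] \<and> last u = last v then f (last u) (butlast u) (butlast v) else 0)"

lemma words_snoc [simp]: "u @ [i] \<in> words (Suc n) \<longleftrightarrow> u \<in> words n"
  by (simp add: words_def)

lemma words_Nil [simp]: "[] \<in> words n \<longleftrightarrow> n = 0"
  by (auto simp: words_def)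

lemma words_0 [simp]: "words 0 = {[]}"
  by (auto simp: words_def)

lemma card_words: "card (words n) = 3 ^ n"
  using card_lists_length_eq[of "UNIV :: 3 set" n] by (simp add: words_def)

lemma sum_words_Suc: "(\<Sum>w\<in>words (Suc n). g w) = (\<Sum>i\<in>UNIV. \<Sum>u\<in>words n. g (u @ [i]))"
proof -
  have "(\<Sum>t\<in>words 1. F t) = (\<Sum>i\<in>UNIV. F [i])" for F :: "3 list \<Rightarrow> 'a"
    by (rule sum.reindex_bij_witness[where i = "\<lambda>i. [i]" and j = hd])
      (auto simp: words_def length_Suc_conv)
  then show ?thesis using sum_words_append[of n "Suc n" g] by simp
qed

lemma vcomp_glue [simp]: "vcomp (glue f) i = f i"
  by (simp add: vcomp_def glue_def fun_eq_iff)

lemma vcomp_add [simp]: "vcomp (c + d) i = vcomp c i + vcomp d i"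
  and vcomp_diff [simp]: "vcomp (c - d) i = vcomp c i - vcomp d i"
  and vcomp_scaleC [simp]: "vcomp (a *\<^sub>C c) i = a *\<^sub>C vcomp c i"
  and vcomp_zero [simp]: "vcomp (0::cmat) i = (0::cmat)"
  and vcomp_mstar [simp]: "vcomp (mstar c) i = mstar (vcomp c i)"
  by (simp_all add: vcomp_def fun_eq_iff scaleC_fun_def mstar_def)

lemma mats_vcomp: "c \<in> mats (Suc n) \<Longrightarrow> vcomp c i \<in> mats n"
  by (auto simp: mats_def vcomp_def)

lemma dmats_mats: "c \<in> dmats n \<Longrightarrow> c \<in> mats (Suc n)"
  by (auto simp: dmats_def)

lemma mats_vcomp_dmats: "c \<in> dmats n \<Longrightarrow> vcomp c i \<in> mats n"
  by (intro mats_vcomp dmats_mats)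

lemma glue_dmats: "(\<And>i. f i \<in> mats n) \<Longrightarrow> glue f \<in> dmats n"
  unfolding dmats_def
proof (intro CollectI conjI matsI allI impI)
  fix u v :: "3 list" assume f: "\<And>i. f i \<in> mats n" and uv: "u \<notin> words (Suc n) \<or> v \<notin> words (Suc n)"
  show "glue f u v = 0"
  proof (cases "u = [] \<or> v = []")
    case False
    then have "butlast u \<notin> words n \<or> butlast v \<notin> words n"
      using uv by (auto simp: words_def) (metis Suc_pred length_greater_0_conv)+
    then show ?thesis using matsD[OF f] by (auto simp: glue_def)
  qed (auto simp: glue_def)
qed (simp add: glue_def)

lemma glue_vcomp: "c \<in> dmats n \<Longrightarrow> glue (vcomp c) = c"
proof (intro ext)
  fix u v assume c: "c \<in> dmats n"
  show "glue (vcomp c) u v = c u v"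
  proof (cases "u = [] \<or> v = []")
    case True
    then show ?thesis using c by (auto simp: glue_def dmats_def mats_def)
  next
    case False
    then obtain u' i v' k where uv: "u = u' @ [i]" "v = v' @ [k]" by (metis rev_exhaust)
    show ?thesis using c unfolding uv by (cases "i = k") (auto simp: glue_def vcomp_def dmats_def)
  qed
qed

lemma dmats_eqI: "c \<in> dmats n \<Longrightarrow> d \<in> dmats n \<Longrightarrow> (\<And>i. vcomp c i = vcomp d i) \<Longrightarrow> c = d"
  using glue_vcomp[of c n] glue_vcomp[of d n] by (metis ext)

lemma dmats_zero [simp, intro]: "(0::cmat) \<in> dmats n"
  and dmats_add: "c \<in> dmats n \<Longrightarrow> d \<in> dmats n \<Longrightarrow> c + d \<in> dmats n"
  and dmats_diff: "c \<in> dmats n \<Longrightarrow> d \<in> dmats n \<Longrightarrow> c - d \<in> dmats n"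
  and dmats_scaleC: "c \<in> dmats n \<Longrightarrow> a *\<^sub>C c \<in> dmats n"
  and dmats_mstar: "c \<in> dmats n \<Longrightarrow> mstar c \<in> dmats n"
  by (auto simp: dmats_def mats_add mats_diff mats_scaleC mats_mstar)
    (auto simp: mstar_def scaleC_fun_def)

lemma dmats_off: "c \<in> dmats n \<Longrightarrow> i \<noteq> k \<Longrightarrow> c (u @ [i]) (v @ [k]) = 0"
  by (auto simp: dmats_def)

lemma mmul_snoc:
  "c \<in> dmats n \<Longrightarrow> mmul (Suc n) c d (u @ [i]) v = (\<Sum>w\<in>words n. vcomp c i u w * d (w @ [i]) v)"
proof -
  assume c: "c \<in> dmats n"
  have "mmul (Suc n) c d (u @ [i]) v = (\<Sum>k\<in>UNIV. \<Sum>w\<in>words n. c (u @ [i]) (w @ [k]) * d (w @ [k]) v)"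
    unfolding mmul_def by (rule sum_words_Suc)
  also have "\<dots> = (\<Sum>k\<in>UNIV. if k = i then \<Sum>w\<in>words n. vcomp c i u w * d (w @ [i]) v else 0)"
    by (intro sum.cong refl) (auto simp: vcomp_def dmats_off[OF c])
  finally show ?thesis by simp
qed

lemma vcomp_mmul:
  "c \<in> dmats n \<Longrightarrow> vcomp (mmul (Suc n) c d) i = mmul n (vcomp c i) (vcomp d i)"
  by (intro ext) (simp add: vcomp_def[of "mmul _ _ _"] mmul_snoc, simp add: mmul_def vcomp_def)

lemma dmats_mmul: "c \<in> dmats n \<Longrightarrow> d \<in> dmats n \<Longrightarrow> mmul (Suc n) c d \<in> dmats n"
  by (subst dmats_def) (auto simp: mats_mmul dmats_mats mmul_snoc dmats_off)

lemma mvec_snoc: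
  "c \<in> dmats n \<Longrightarrow> mvec (Suc n) c f (u @ [i]) = mvec n (vcomp c i) (\<lambda>w. f (w @ [i])) u"
proof -
  assume c: "c \<in> dmats n"
  have "mvec (Suc n) c f (u @ [i]) = (\<Sum>k\<in>UNIV. \<Sum>w\<in>words n. c (u @ [i]) (w @ [k]) * f (w @ [k]))"
    unfolding mvec_def by (rule sum_words_Suc)
  also have "\<dots> = (\<Sum>k\<in>UNIV. if k = i then \<Sum>w\<in>words n. vcomp c i u w * f (w @ [i]) else 0)"
    by (intro sum.cong refl) (auto simp: vcomp_def dmats_off[OF c])
  finally show ?thesis by (simp add: mvec_def)
qed

lemma wnorm_Suc: "(wnorm (Suc n) f)\<^sup>2 = (\<Sum>i\<in>UNIV. (wnorm n (\<lambda>u. f (u @ [i])))\<^sup>2)"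
  unfolding wnorm_sq by (rule sum_words_Suc)

text \<open>A block-diagonal matrix respects the orthogonal splitting of vectors by their last
  letter, so its norm is governed by the blocks one at a time.\<close>

lemma opnorm_dmats_le:
  assumes c: "c \<in> dmats n" and C: "\<And>i. opnorm n (vcomp c i) \<le> C"
  shows "opnorm (Suc n) c \<le> C"
proof (rule opnorm_le)
  show C0: "0 \<le> C" using C opnorm_nonneg order_trans by blast
  fix f
  have "(wnorm (Suc n) (mvec (Suc n) c f))\<^sup>2 = (\<Sum>i\<in>UNIV. (wnorm n (mvec n (vcomp c i) (\<lambda>w. f (w @ [i]))))\<^sup>2)"
    unfolding wnorm_Suc mvec_snoc[OF c] ..
  also have "\<dots> \<le> (\<Sum>i\<in>UNIV. (C * wnorm n (\<lambda>w. f (w @ [i])))\<^sup>2)"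
    by (intro sum_mono power_mono order_trans[OF opnorm_bound] mult_right_mono C) auto
  also have "\<dots> = (C * wnorm (Suc n) f)\<^sup>2"
    by (simp only: power_mult_distrib wnorm_Suc sum_distrib_left)
  finally show "wnorm (Suc n) (mvec (Suc n) c f) \<le> C * wnorm (Suc n) f"
    by (rule power2_le_imp_le) (use C0 in simp)
qed

text \<open>The component is a compression of \<open>c\<close> to the vectors supported on words
  ending in \<open>i\<close>, and compressions do not increase the norm.\<close>

lemma opnorm_vcomp: "opnorm n (vcomp c i) \<le> opnorm (Suc n) c"
proof (rule opnorm_le)
  fix f :: "3 list \<Rightarrow> complex"
  \<comment> \<open>The vector f \<otimes> e_i, of the same norm as \<open>f\<close>.\<close>
  let ?g = "\<lambda>w. if last w = i then f (butlast w) else 0"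
  have "(wnorm (Suc n) ?g)\<^sup>2 = (\<Sum>k\<in>UNIV. if k = i then (wnorm n f)\<^sup>2 else 0)"
    unfolding wnorm_Suc by (intro sum.cong) auto
  then have g: "wnorm (Suc n) ?g = wnorm n f" by (simp add: power2_eq_iff_nonneg)
  have *: "mvec n (vcomp c i) f u = mvec (Suc n) c ?g (u @ [i])" for u
  proof -
    have "mvec (Suc n) c ?g (u @ [i]) = (\<Sum>k\<in>UNIV. if k = i then mvec n (vcomp c i) f u else 0)"
      unfolding mvec_def sum_words_Suc by (intro sum.cong) (auto simp: vcomp_def)
    then show ?thesis by simp
  qed
  have "wnorm n (mvec n (vcomp c i) f) \<le> wnorm (Suc n) (mvec (Suc n) c ?g)"
  proof (rule power2_le_imp_le)
    show "(wnorm n (mvec n (vcomp c i) f))\<^sup>2 \<le> (wnorm (Suc n) (mvec (Suc n) c ?g))\<^sup>2"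
      unfolding wnorm_Suc * by (rule member_le_sum[where i = i]) auto
  qed simp
  then show "wnorm n (mvec n (vcomp c i) f) \<le> opnorm (Suc n) c * wnorm n f"
    using opnorm_bound[of "Suc n" c ?g] g by simp
qed simp

lemma cmod_le_opnorm:
  assumes "u \<in> words n" "v \<in> words n" shows "cmod (x u v) \<le> opnorm n x"
proof -
  let ?e = "\<lambda>w. if w = v then 1 else (0::complex)"
  have "(wnorm n ?e)\<^sup>2 = (\<Sum>w\<in>words n. if w = v then 1 else 0)"
    unfolding wnorm_sq by (intro sum.cong) auto
  then have "wnorm n ?e = 1" using assms by (simp add: power2_eq_1_iff) (smt (verit) wnorm_nonneg)
  moreover have "mvec n x ?e u = x u v"
    using assms by (simp add: mvec_def if_distrib[of "\<lambda>a. _ * a"] sum.delta cong: if_cong)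
  ultimately show ?thesis
    using cmod_le_wnorm[OF assms(1), of "mvec n x ?e"] opnorm_bound[of n x ?e] by simp
qed

lemma cmod_mtr_le: "cmod (mtr n x) \<le> 3 ^ n * opnorm n x"
proof -
  have "cmod (mtr n x) \<le> (\<Sum>w\<in>words n. opnorm n x)"
    unfolding mtr_def by (intro order_trans[OF norm_sum] sum_mono cmod_le_opnorm)
  then show ?thesis by (simp add: card_words)
qed

section \<open>Recursive description of the gasket algebras\<close>

text \<open>In the cell with corners \<open>p\<^sub>1, p\<^sub>2, p\<^sub>3\<close>, the vertices 2, 1, 3 of the \<open>j\<close>-th subcell are \<open>p\<^sub>j\<close>, \<open>x\<^sub>j\<close> and
  \<open>x\<^sub>j\<^sub>+\<^sub>1\<close>, where \<open>x\<^sub>j\<close> is the new vertex between \<open>p\<^sub>j\<close> and \<open>p\<^sub>j\<^sub>+\<^sub>2\<close>.\<close>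

primrec gasket_rec :: "nat \<Rightarrow> cmat set" where
  "gasket_rec 0 = dmats 0"
| "gasket_rec (Suc n) = {c \<in> dmats (Suc n). vcomp c 2 \<in> gasket_rec n \<and> vcomp c 1 \<in> dmats n \<and> vcomp c 3 \<in> dmats n \<and>
     (\<forall>j. vcomp (vcomp c 1) j = vcomp (vcomp c 3) (j + 2))}"

lemma gasket_rec_dmats: "c \<in> gasket_rec n \<Longrightarrow> c \<in> dmats n"
  by (cases n) auto

lemma gasket_rec_zero [simp, intro]: "(0::cmat) \<in> gasket_rec n"
proof (induction n)
  case 0
  show ?case by (simp only: gasket_rec.simps dmats_zero)
next
  case (Suc n)
  then show ?case by (simp only: gasket_rec.simps dmats_zero mem_Collect_eq vcomp_zero simp_thms)
qed

lemma gasket_rec_add: "c \<in> gasket_rec n \<Longrightarrow> d \<in> gasket_rec n \<Longrightarrow> c + d \<in> gasket_rec n"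
  by (induction n arbitrary: c d) (auto simp: dmats_add)

lemma gasket_rec_scaleC: "c \<in> gasket_rec n \<Longrightarrow> a *\<^sub>C c \<in> gasket_rec n"
  by (induction n arbitrary: c) (auto simp: dmats_scaleC)

lemma gasket_rec_mstar: "c \<in> gasket_rec n \<Longrightarrow> mstar c \<in> gasket_rec n"
  by (induction n arbitrary: c) (auto simp: dmats_mstar)

lemma gasket_rec_mmul: "c \<in> gasket_rec n \<Longrightarrow> d \<in> gasket_rec n \<Longrightarrow> mmul (Suc n) c d \<in> gasket_rec n"
  by (induction n arbitrary: c d) (auto simp: dmats_mmul vcomp_mmul)

text \<open>The identification of vertex 1 of subcell j with vertex 3 of subcell j + 2 makes the
  component at 3 redundant: an element is determined by its old corners and the three new
  vertices.\<close>

lemma gasket_rec_eqI: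
  assumes c: "c \<in> gasket_rec (Suc n)" and d: "d \<in> gasket_rec (Suc n)"
    and 2: "vcomp c 2 = vcomp d 2" and 1: "\<And>j. vcomp (vcomp c 1) j = vcomp (vcomp d 1) j"
  shows "c = d"
proof (rule dmats_eqI[OF gasket_rec_dmats[OF c] gasket_rec_dmats[OF d]])
  \<comment> \<open>Every index has the form j + 2, so the identification reaches all blocks of the
    component at 3.\<close>
  have l: "l + 1 + 2 = l" for l :: 3 using exhaust_3[of l] by (auto simp: mod3_simps)
  have "vcomp (vcomp c 3) l = vcomp (vcomp d 3) l" for l
    using 1[of "l + 1"] c d unfolding gasket_rec.simps mem_Collect_eq by (metis l)
  then have "vcomp c 3 = vcomp d 3" "vcomp c 1 = vcomp d 1"
    using c d 1 by (auto intro: dmats_eqI)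
  then show "vcomp c i = vcomp d i" for i
    using 2 exhaust_3[of i] by blast
qed

lemma subspace_gasket_rec: "cvec.subspace (gasket_rec n)"
  by (rule cvec.subspaceI) (auto simp: gasket_rec_add gasket_rec_scaleC)

section \<open>The generators as functions on vertices\<close>

lemma tpow_munit: "tpow (munit i i) n u v = (if u = replicate n i \<and> v = replicate n i then 1 else 0)"
proof (induction n arbitrary: u v)
  case (Suc n)
  have *: "tpow (munit i i) (Suc n) u v = munit i i (take 1 u) (take 1 v) *
      (if drop 1 u = replicate n i \<and> drop 1 v = replicate n i then 1 else 0)"
    by (simp only: tpow.simps tens_def Suc)
  show ?case
    unfolding * by (cases u; cases v) (auto simp: munit_def)
qed (auto simp: mone_def)

lemma alpha_eq: "alpha n j u v = (if u = j # replicate n 2 \<and> v = j # replicate n 2 then 1 else 0)"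
  unfolding alpha_def tens_def tpow_munit by (cases u; cases v) (auto simp: munit_def)

lemma take2_iff: "take 2 u = [a, b] \<and> drop 2 u = r \<longleftrightarrow> u = a # b # r"
  by (metis append_Cons append_Nil append_take_drop_id drop_Suc_Cons drop0 numeral_2_eq_2 take0 take_Suc_Cons)

lemma tens1_munit: "tens 1 (munit a a) (munit b b) u v = (if u = [a, b] \<and> v = [a, b] then 1 else 0)"
  unfolding tens_def by (cases u; cases v) (auto simp: munit_def)

lemma beta_eq: "beta k j u v =
    (if u = j # 1 # replicate (k - 1) 2 \<and> v = j # 1 # replicate (k - 1) 2 then 1 else 0) +
    (if u = (j + 2) # 3 # replicate (k - 1) 2 \<and> v = (j + 2) # 3 # replicate (k - 1) 2 then 1 else 0)"
proof -
  have *: "(if P then 1 else 0) * (if Q then 1 else 0) = (if P \<and> Q then 1 else (0::complex))" for P Q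
    by simp
  show ?thesis
    unfolding beta_def tens_def[of 2] plus_fun_def tens1_munit tpow_munit distrib_right *
    by (intro arg_cong2[where f = "(+)"] if_cong refl)
      (use take2_iff[of u _ _ "replicate (k - 1) 2"] take2_iff[of v _ _ "replicate (k - 1) 2"] in blast)+
qed

text \<open>The simplifier uses \<open>zero_fun_apply\<close> to turn \<open>0 :: cmat\<close> into the abstraction below.\<close>

lemma cmat_zero_lambda [simp]:
  "(\<lambda>a b. 0) \<in> mats n" "(\<lambda>a b. 0) \<in> dmats n" "(\<lambda>a b. 0) \<in> gasket_rec n" "vcomp (\<lambda>a b. 0) i = (\<lambda>a b. 0)"
  using mats_zero[of n] dmats_zero[of n] gasket_rec_zero[of n] vcomp_zero[of i]
  unfolding zero_fun_def by blast+

lemma glue_eqI: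
  assumes "\<And>u. c [] u = 0" "\<And>u. c u [] = 0"
    and "\<And>u v i k. c (u @ [i]) (v @ [k]) = (if i = k then f i u v else 0)"
  shows "c = glue f"
proof (intro ext)
  fix u v
  show "c u v = glue f u v"
    using assms(1)[of v] assms(2)[of u] assms(3) by (cases u rule: rev_cases; cases v rule: rev_cases) (auto simp: glue_def)
qed

text \<open>The embedding d \<mapsto> d \<otimes> e_22: keep the values at the old corners and put 0
  at the new vertices.\<close>

definition shift2 :: "cmat \<Rightarrow> cmat" where
  "shift2 d = glue (\<lambda>i. if i = 2 then d else 0)"

lemma Cons_replicate_snoc: "u @ [i] = j # replicate (Suc n) a \<longleftrightarrow> u = j # replicate n a \<and> i = a"
  by (metis append_Cons append1_eq_conv replicate_Suc replicate_append_same)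

lemma alpha_Suc: "alpha (Suc n) j = shift2 (alpha n j)"
  unfolding shift2_def by (rule glue_eqI) (unfold alpha_eq Cons_replicate_snoc, auto simp: alpha_eq)

lemma beta_Nil: "beta k j [] v = 0" "beta k j v [] = 0"
  by (simp_all add: beta_eq)

text \<open>Appending the factor e_22 to \<beta>^k_j gives \<beta>^(k+1)_j. This fails at k = 0,
  where truncated subtraction makes \<open>beta 0\<close> equal to \<open>beta 1\<close>.\<close>

lemma beta_Suc:
  assumes "1 \<le> k"
  shows "beta (Suc k) j (u @ [i]) (v @ [l]) = (if i = 2 \<and> l = 2 then beta k j u v else 0)"
proof -
  have *: "w @ [i] = a # b # replicate k 2 \<longleftrightarrow> w = a # b # replicate (k - 1) 2 \<and> i = 2" for w a b and i :: 3
    using assms by (cases k; cases w) (auto simp: Cons_replicate_snoc simp del: replicate.simps)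
  show ?thesis unfolding beta_eq diff_Suc_1 * by auto
qed

lemma tens_beta_snoc:
  "tens m x (beta (Suc k) j) (u @ [i]) (v @ [l]) =
    (if m \<le> length u \<and> m \<le> length v then x (take m u) (take m v) * beta (Suc k) j (drop m u @ [i]) (drop m v @ [l]) else 0)"
  by (auto simp: tens_def beta_Nil)

lemma tens_beta_Suc:
  assumes "1 \<le> k" shows "tens m x (beta (Suc k) j) = shift2 (tens m x (beta k j))"
  unfolding shift2_def
proof (rule glue_eqI)
  fix u v and i l :: 3
  show "tens m x (beta (Suc k) j) (u @ [i]) (v @ [l]) =
    (if i = l then (if i = 2 then tens m x (beta k j) else 0) u v else 0)"
    unfolding tens_beta_snoc beta_Suc[OF assms] by (auto simp: tens_def beta_Nil)
qed (simp_all add: tens_def beta_Nil)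

text \<open>x \<otimes> \<beta>^1_j is the function with value x at the single new vertex x_j and 0
  elsewhere. That vertex occurs twice: as vertex 1 of subcell j and as vertex 3 of subcell j +
  2.\<close>

lemma tens_beta_1:
  assumes "x \<in> mats m"
  shows "tens m x (beta 1 j) = glue (\<lambda>i. if i = 1 then glue (\<lambda>l. if l = j then x else 0)
      else if i = 3 then glue (\<lambda>l. if l = j + 2 then x else 0) else 0)" (is "_ = glue ?f")
proof (rule glue_eqI)
  fix u v and i l :: 3
  have b: "beta (Suc 0) j (a @ [i]) (b @ [l]) =
    (if i = 1 \<and> l = 1 \<and> a = [j] \<and> b = [j] then 1 else 0) +
    (if i = 3 \<and> l = 3 \<and> a = [j + 2] \<and> b = [j + 2] then 1 else 0)" for a b
    by (cases a; cases b) (auto simp: beta_eq)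
  \<comment> \<open>Cutting a word after m letters agrees with cutting off its last letter, because
    x vanishes outside the words of length m.\<close>
  have g: "(if m \<le> length u \<and> m \<le> length v then x (take m u) (take m v) * (if drop m u = [r] \<and> drop m v = [r] then 1 else 0) else 0)
      = glue (\<lambda>l. if l = r then x else 0) u v" for r
  proof (cases "drop m u = [r] \<and> drop m v = [r]")
    case True
    have "u = take m u @ [r]" "v = take m v @ [r]" using True by (metis append_take_drop_id)+
    moreover have "m \<le> length u" "m \<le> length v" using True by (metis drop_all list.distinct(1) nle_le)+
    ultimately show ?thesis using True
      by (simp add: glue_def) (metis butlast_snoc last_snoc snoc_eq_iff_butlast)
  next
    case False
    have "glue (\<lambda>l. if l = r then x else 0) u v = 0"
    proof (rule ccontr)
      assume *: "\<not> ?thesis"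
      then have ne: "u \<noteq> []" "v \<noteq> []" "last u = r" "last v = r" and "x (butlast u) (butlast v) \<noteq> 0"
        by (auto simp: glue_def split: if_splits)
      then have "butlast u \<in> words m" "butlast v \<in> words m"
        using matsD[OF assms, of "butlast u" "butlast v"] by argo+
      then have "drop m (butlast u @ [last u]) = [r]" "drop m (butlast v @ [last v]) = [r]"
        using ne by (auto simp: words_def simp del: append_butlast_last_id)
      then show False using False append_butlast_last_id[OF ne(1)] append_butlast_last_id[OF ne(2)] by metis
    qed
    then show ?thesis using False by auto
  qed
  show "tens m x (beta 1 j) (u @ [i]) (v @ [l]) = (if i = l then ?f i u v else 0)"
    unfolding One_nat_def tens_beta_snoc b
    using g[of j] g[of "j + 2"] by (cases "i = 1"; cases "l = 1"; cases "i = 3"; cases "l = 3") auto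
qed (simp_all add: tens_def beta_Nil)

lemma shift2_gasket_rec: "c \<in> gasket_rec n \<Longrightarrow> shift2 c \<in> gasket_rec (Suc n)"
  using dmats_mats[OF gasket_rec_dmats, of c n] by (auto simp: shift2_def intro!: glue_dmats)

lemma alpha_0: "alpha 0 j = glue (\<lambda>i. if i = j then mone 0 else 0)"
  by (rule glue_eqI) (auto simp: alpha_eq mone_def)

lemma alpha_gasket_rec: "alpha n j \<in> gasket_rec n"
  by (induction n) (auto simp: alpha_0 alpha_Suc glue_dmats shift2_gasket_rec simp del: gasket_rec.simps(2))

text \<open>The case k = 1 is a single new vertex; each further k appends a factor e_22, which is
  \<open>shift2\<close>.\<close>

lemma tens_beta_gasket_rec:
  assumes x: "x \<in> mats m" and "1 \<le> k" shows "tens m x (beta k j) \<in> gasket_rec (m + k)"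
  using assms(2)
proof (induction k rule: dec_induct)
  case base
  have *: "glue (\<lambda>l. if l = r then x else 0) \<in> dmats m" for r
    using x by (intro glue_dmats) simp
  then show ?case unfolding tens_beta_1[OF x] by (auto intro!: glue_dmats dmats_mats)
next
  case (step k)
  then show ?case using shift2_gasket_rec[OF step.IH] by (simp only: tens_beta_Suc add_Suc_right)
qed

section \<open>The span of the generators is the recursive algebra\<close>

lemma gasket_alpha: "alpha n j \<in> gasket n"
  and gasket_beta: "1 \<le> k \<Longrightarrow> k \<le> n \<Longrightarrow> x \<in> mats (n - k) \<Longrightarrow> tens (n - k) x (beta k j) \<in> gasket n"
  unfolding gasket_def by (rule cvec.span_base; blast)+

lemma subspace_gasket: "cvec.subspace (gasket n)"
  unfolding gasket_def by (rule cvec.subspace_span)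

lemma shift2_add: "shift2 (c + d) = shift2 c + shift2 d"
  and shift2_scaleC: "shift2 (a *\<^sub>C c) = a *\<^sub>C shift2 c"
  by (auto simp: shift2_def glue_def fun_eq_iff scaleC_fun_def)

lemma shift2_zero: "shift2 0 = 0"
  using shift2_scaleC[of 0 0] by (simp only: cvec.scale_zero_left)

text \<open>Linearity reduces this to generators, which \<open>shift2\<close> maps to generators:
  \<alpha>^n_j to \<alpha>^(n+1)_j and x \<otimes> \<beta>^k_j to x \<otimes>
  \<beta>^(k+1)_j.\<close>

lemma shift2_gasket: "c \<in> gasket n \<Longrightarrow> shift2 c \<in> gasket (Suc n)"
proof -
  let ?S = "{c. shift2 c \<in> gasket (Suc n)}"
  have "gasket n \<subseteq> ?S"
    unfolding gasket_def[of n]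
  proof (rule cvec.span_minimal)
    have 1: "shift2 (alpha n j) \<in> gasket (Suc n)" for j
      unfolding alpha_Suc[symmetric] by (rule gasket_alpha)
    have 2: "shift2 (tens (n - k) x (beta k j)) \<in> gasket (Suc n)"
      if "1 \<le> k" "k \<le> n" "x \<in> mats (n - k)" for k j x
      using gasket_beta[of "Suc k" "Suc n" x j] that by (simp only: tens_beta_Suc) simp
    show "range (alpha n) \<union> {tens (n - k) x (beta k j) |x k j. 1 \<le> k \<and> k \<le> n \<and> x \<in> mats (n - k)} \<subseteq> ?S"
      using 1 2 by blast
    show "cvec.subspace ?S"
      using subspace_gasket[of "Suc n"]
      by (auto simp only: cvec.subspace_def mem_Collect_eq shift2_add shift2_scaleC shift2_zero)
  qed
  then show "c \<in> gasket n \<Longrightarrow> shift2 c \<in> gasket (Suc n)" by blast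
qed

text \<open>At level n + 1 an element is the sum of its part on the old corners, handled by
  induction and \<open>shift2\<close>, and of one term y_j \<otimes> \<beta>^1_j for each new
  vertex. At level 0 the three \<alpha>^0_j span all diagonal matrices.\<close>

lemma gasket_rec_imp_gasket: "c \<in> gasket_rec n \<Longrightarrow> c \<in> gasket n"
proof (induction n arbitrary: c)
  case 0
  let ?a = "\<lambda>j. vcomp c j [] []"
  have c: "c \<in> dmats 0" using 0 by simp
  have a: "alpha 0 j \<in> dmats 0" for j using alpha_gasket_rec[of 0 j] by simp
  have "c = ?a 1 *\<^sub>C alpha 0 1 + ?a 2 *\<^sub>C alpha 0 2 + ?a 3 *\<^sub>C alpha 0 3"
  proof (rule dmats_eqI[of _ 0])
    fix i
    have "vcomp c i u v = vcomp (?a 1 *\<^sub>C alpha 0 1 + ?a 2 *\<^sub>C alpha 0 2 + ?a 3 *\<^sub>C alpha 0 3) i u v" for u v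
      using matsD[OF mats_vcomp_dmats[OF c], of u v i] exhaust_3[of i]
      unfolding vcomp_add vcomp_scaleC alpha_0 vcomp_glue
      by (cases "u = [] \<and> v = []") (auto simp: mone_def scaleC_fun_def scaleC_complex_def mod3_simps)
    then show "vcomp c i = vcomp (?a 1 *\<^sub>C alpha 0 1 + ?a 2 *\<^sub>C alpha 0 2 + ?a 3 *\<^sub>C alpha 0 3) i"
      by blast
  qed (intro dmats_add dmats_scaleC a c)+
  then show ?case
    using cvec.subspace_add[OF subspace_gasket] cvec.subspace_scale[OF subspace_gasket] gasket_alpha by metis
next
  case (Suc n)
  define y where "y = vcomp (vcomp c 1)"
  have c: "c \<in> dmats (Suc n)" "vcomp c 2 \<in> gasket_rec n" "vcomp c 1 \<in> dmats n"
    using Suc.prems by auto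
  have y: "y j \<in> mats n" for j unfolding y_def by (rule mats_vcomp_dmats[OF c(3)])
  let ?t = "\<lambda>j. tens n (y j) (beta 1 j)"
  have t: "?t j \<in> gasket_rec (Suc n)" for j using tens_beta_gasket_rec[OF y, of 1 j j] by simp
  have "c = shift2 (vcomp c 2) + (?t 1 + ?t 2 + ?t 3)"
  proof (rule gasket_rec_eqI[OF Suc.prems])
    show "shift2 (vcomp c 2) + (?t 1 + ?t 2 + ?t 3) \<in> gasket_rec (Suc n)"
      by (intro gasket_rec_add shift2_gasket_rec c t)
    have t2: "vcomp (?t j) 2 = 0" and t1: "vcomp (?t j) 1 = glue (\<lambda>l. if l = j then y j else 0)" for j
      unfolding tens_beta_1[OF y] vcomp_glue by (simp_all only: mod3_simps if_False if_True simp_thms)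
    have s: "vcomp (shift2 d) 2 = d" "vcomp (shift2 d) 1 = 0" for d
      unfolding shift2_def vcomp_glue by (simp_all only: mod3_simps if_False if_True simp_thms)
    show "vcomp c 2 = vcomp (shift2 (vcomp c 2) + (?t 1 + ?t 2 + ?t 3)) 2"
      unfolding vcomp_add s t2 by simp
    show "vcomp (vcomp c 1) l = vcomp (vcomp (shift2 (vcomp c 2) + (?t 1 + ?t 2 + ?t 3)) 1) l" for l
      unfolding vcomp_add s t1 vcomp_glue vcomp_zero using exhaust_3[of l]
      by (elim disjE) (simp_all only: y_def mod3_simps if_False if_True simp_thms add_0_left add_0_right)
  qed
  moreover have "?t j \<in> gasket (Suc n)" for j
    using gasket_beta[of 1 "Suc n" "y j" j] y by simp
  ultimately show ?case
    using cvec.subspace_add[OF subspace_gasket] shift2_gasket[OF Suc.IH[OF c(2)]] by metis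
qed

lemma gasket_eq_gasket_rec: "gasket n = gasket_rec n"
proof
  show "gasket n \<subseteq> gasket_rec n"
    unfolding gasket_def
  proof (rule cvec.span_minimal[OF _ subspace_gasket_rec])
    have "tens (n - k) x (beta k j) \<in> gasket_rec n" if "1 \<le> k" "k \<le> n" "x \<in> mats (n - k)" for k x j
      using tens_beta_gasket_rec[OF that(3,1), of j] that(2) by simp
    then show "range (alpha n) \<union> {tens (n - k) x (beta k j) |x k j. 1 \<le> k \<and> k \<le> n \<and> x \<in> mats (n - k)} \<subseteq> gasket_rec n"
      using alpha_gasket_rec by blast
  qed
  show "gasket_rec n \<subseteq> gasket n" using gasket_rec_imp_gasket by blast
qed

section \<open>The embeddings and the slice maps\<close>

lemma iota_add: "x \<in> mats n \<Longrightarrow> y \<in> mats n \<Longrightarrow> iota n (x + y) = iota n x + iota n y"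
proof -
  assume x: "x \<in> mats n" and y: "y \<in> mats n"
  have "(\<lambda>m. if n \<le> m then amp n m (x + y) else 0) =
     (\<lambda>m. (if n \<le> m then amp n m x else 0) + (if n \<le> m then amp n m y else 0))"
    by (rule ext) (auto simp: amp_add)
  then show ?thesis
    using x y by (simp only: iota_eq mats_add plus_uhf.abs_eq uhf_rel_refl)
qed

lemma iota_scaleC: "x \<in> mats n \<Longrightarrow> iota n (c *\<^sub>C x) = c *\<^sub>C iota n x"
proof -
  assume x: "x \<in> mats n"
  have "(\<lambda>m. if n \<le> m then amp n m (c *\<^sub>C x) else 0) =
     (\<lambda>m. c *\<^sub>C (if n \<le> m then amp n m x else 0))"
    by (rule ext) (simp only: amp_scaleC cvec.scale_zero_right if_distrib[of "scaleC c"])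
  then show ?thesis
    using x by (simp only: iota_eq mats_scaleC scaleC_uhf.abs_eq uhf_rel_refl)
qed

lemma iota_star: "x \<in> mats n \<Longrightarrow> iota n (mstar x) = star (iota n x)"
proof -
  assume x: "x \<in> mats n"
  have "(\<lambda>m. if n \<le> m then amp n m (mstar x) else 0) =
     (\<lambda>m. mstar (if n \<le> m then amp n m x else 0))"
    by (rule ext) (auto simp: mstar_amp fun_eq_iff mstar_def[of 0])
  then show ?thesis
    using x by (simp only: iota_eq mats_mstar star_uhf.abs_eq uhf_rel_refl)
qed

lemma iota_mmul: "x \<in> mats n \<Longrightarrow> y \<in> mats n \<Longrightarrow> iota n (mmul n x y) = iota n x * iota n y"
proof -
  assume x: "x \<in> mats n" and y: "y \<in> mats n"
  have "(\<lambda>m. if n \<le> m then amp n m (mmul n x y) else 0) =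
     (\<lambda>m. mmul m (if n \<le> m then amp n m x else 0) (if n \<le> m then amp n m y else 0))"
    by (rule ext) (use x y in \<open>auto simp: amp_mmul fun_eq_iff mmul_def[of _ 0 0]\<close>)
  then show ?thesis
    using x y by (simp only: iota_eq mats_mmul times_uhf.abs_eq uhf_rel_refl)
qed

lemma iota_zero: "iota n 0 = 0"
  using iota_scaleC[of 0 n 0] by (simp only: cvec.scale_zero_left mats_zero)

lemma iota_diff: "x \<in> mats n \<Longrightarrow> y \<in> mats n \<Longrightarrow> iota n (x - y) = iota n x - iota n y"
  using iota_add[of x n "(-1) *\<^sub>C y"] iota_scaleC[of y n "-1"]
  by (simp add: mats_uminus cvec.scale_minus_left scaleC_one)

lemma norm_iota: "x \<in> mats n \<Longrightarrow> norm (iota n x) = opnorm n x"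
  using norm_iota_diff[of 0 n x n] by (simp only: iota_zero amp_zero mats_zero order_refl diff_zero)

lemma norm_iota_diff_same: "x \<in> mats n \<Longrightarrow> y \<in> mats n \<Longrightarrow> norm (iota n x - iota n y) = opnorm n (x - y)"
  by (simp only: iota_diff[symmetric] norm_iota mats_diff)

lemma iota_amp: "x \<in> mats n \<Longrightarrow> n \<le> m \<Longrightarrow> iota m (amp n m x) = iota n x"
  using norm_iota_diff[of x n "amp n m x" m] mats_amp[of n m x]
  by (simp only: diff_self opnorm_zero norm_eq_zero right_minus_eq)

text \<open>Tensoring with 1 gives all three corners the same value. This is how consecutive levels
  are compared below.\<close>

lemma amp_Suc: "x \<in> mats n \<Longrightarrow> amp n (Suc n) x = glue (\<lambda>i. x)"
proof (intro ext)
  fix u v assume x: "x \<in> mats n"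
  show "amp n (Suc n) x u v = glue (\<lambda>i. x) u v"
  proof (cases "u \<in> words (Suc n) \<and> v \<in> words (Suc n)")
    case True
    then obtain u' i v' k where uv: "u = u' @ [i]" "v = v' @ [k]"
      by (metis rev_exhaust words_Nil nat.distinct(1))
    then have "u' \<in> words n" "v' \<in> words n" using True by simp_all
    moreover have "[i] \<in> words (Suc n - n)" "[k] \<in> words (Suc n - n)" by (simp_all add: words_def)
    ultimately show ?thesis unfolding uv by (simp only: amp_append) (simp add: glue_def)
  next
    case False
    then show ?thesis
      using matsD[OF mats_amp[of n "Suc n" x]] matsD[OF dmats_mats[OF glue_dmats[of "\<lambda>i. x" n]]] x
      by (metis le_Suc_eq order_refl)
  qed
qed

text \<open>Any Cauchy sequence representing \<open>a\<close> approximates it.\<close>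

lemma approximates_exists: obtains x where "approximates x a"
proof -
  obtain f where f: "mcauchy f" "a = abs_uhf f" by (rule uhf_cases)
  have "(\<lambda>n. iota n (f n)) \<longlonglongrightarrow> a"
  proof (rule LIMSEQ_I)
    fix e :: real assume e: "e > 0"
    then obtain N where N: "\<And>n m. N \<le> n \<Longrightarrow> n \<le> m \<Longrightarrow> opnorm m (f m - amp n m (f n)) < e / 2"
      using mcauchyE[OF f(1), of "e / 2"] by (metis half_gt_zero)
    have "norm (a - iota n (f n)) \<le> e / 2" if "N \<le> n" for n
      unfolding f(2) using N[OF that] mcauchyD[OF f(1)]
      by (intro norm_iota_approx[OF f(1), where N = n]) (auto simp: less_imp_le)
    then show "\<exists>no. \<forall>n\<ge>no. norm (iota n (f n) - a) < e"
      using e by (metis field_sum_of_halves half_gt_zero less_add_same_cancel1 norm_minus_commute order_le_less_trans)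
  qed
  then show ?thesis using that mcauchyD[OF f(1)] unfolding approximates_def by blast
qed

lemma approximatesD: "approximates x a \<Longrightarrow> x n \<in> mats n" "approximates x a \<Longrightarrow> (\<lambda>n. iota n (x n)) \<longlonglongrightarrow> a"
  by (auto simp: approximates_def)

lemma approximates_norm: "approximates x a \<Longrightarrow> (\<lambda>n. opnorm n (x n)) \<longlonglongrightarrow> norm a"
  using tendsto_norm[OF approximatesD(2)] by (simp only: norm_iota approximatesD(1))

lemma approximates_add: "approximates x a \<Longrightarrow> approximates y b \<Longrightarrow> approximates (\<lambda>n. x n + y n) (a + b)"
  unfolding approximates_def by (simp add: iota_add mats_add tendsto_add)

lemma bounded_linear_scaleC: "bounded_linear (\<lambda>x::'a::cstar_algebra. c *\<^sub>C x)"
  by (rule bounded_linear_intro[where K = "cmod c"])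
    (simp_all add: scaleC_add_right norm_scaleC scaleR_scaleC scaleC_scaleC mult.commute)

lemma approximates_scaleC: "approximates x a \<Longrightarrow> approximates (\<lambda>n. c *\<^sub>C x n) (c *\<^sub>C a)"
  unfolding approximates_def
  by (simp add: iota_scaleC mats_scaleC bounded_linear.tendsto[OF bounded_linear_scaleC])

lemma norm_star: "norm (star a) = norm (a :: 'a::cstar_algebra)"
proof -
  have *: "norm b \<le> norm (star b)" for b :: 'a
  proof (cases "norm b = 0")
    case False
    have "(norm b)\<^sup>2 \<le> norm (star b) * norm b"
      unfolding cstar_identity[symmetric] by (rule norm_mult_ineq)
    then show ?thesis using False by (simp add: power2_eq_square mult_le_cancel_right less_le)
  qed simp
  show ?thesis using *[of a] *[of "star a"] by (simp add: star_star)
qed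

lemma star_diff: "star (a - b) = star a - star (b :: 'a::cstar_algebra)"
  by (metis add_diff_cancel_right' diff_add_cancel star_add)

lemma tendsto_star: "(X \<longlonglongrightarrow> a) \<Longrightarrow> (\<lambda>n. star (X n)) \<longlonglongrightarrow> star (a :: 'a::cstar_algebra)"
  using LIM_zero_cancel[of "\<lambda>n. star (X n)" "star a" sequentially] tendsto_norm_zero[OF LIM_zero[of X a sequentially]]
  by (metis (mono_tags, lifting) norm_star star_diff tendsto_cong tendsto_norm_zero_cancel eventually_sequentiallyI)

text \<open>Slicing is iterated compression to the index 2 of the last factor, one factor at a time;
  this makes induction on m possible.\<close>

lemma slice_Suc: "Suc n \<le> m \<Longrightarrow> slice n (Suc m) x = slice n m (vcomp x 2)"
proof -
  assume "Suc n \<le> m"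
  then have "Suc m - (n + 1) = Suc (m - (n + 1))" by simp
  then have r: "replicate (Suc m - (n + 1)) (2::3) = replicate (m - (n + 1)) 2 @ [2]"
    by (metis replicate_Suc replicate_append_same)
  show ?thesis
    by (intro ext) (simp only: slice_def r vcomp_def append_assoc)
qed

lemma slice_self: "x \<in> mats (Suc n) \<Longrightarrow> slice n (Suc n) x = x"
  by (auto simp: slice_def fun_eq_iff matsD)

lemma slice_mats: "slice n m x \<in> mats (Suc n)"
  by (auto simp: slice_def mats_def)

lemma slice_diff: "slice n m (x - y) u v = slice n m x u v - slice n m y u v"
  and slice_add: "slice n m (x + y) u v = slice n m x u v + slice n m y u v"
  and slice_scaleC: "slice n m (c *\<^sub>C x) u v = c * slice n m x u v"
  and slice_mstar: "slice n m (mstar x) u v = cnj (slice n m x v u)"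
  by (auto simp: slice_def scaleC_fun_def scaleC_complex_def mstar_def)

text \<open>Each of the compressions that make up the slice is contractive.\<close>

lemma opnorm_slice:
  assumes "Suc n \<le> m" "x \<in> mats m" shows "opnorm (Suc n) (slice n m x) \<le> opnorm m x"
  using assms
proof (induction m arbitrary: x rule: dec_induct)
  case base
  then show ?case by (simp add: slice_self)
next
  case (step m)
  have "opnorm (Suc n) (slice n m (vcomp x 2)) \<le> opnorm m (vcomp x 2)"
    using step.IH[of "vcomp x 2"] step.prems mats_vcomp by blast
  also have "\<dots> \<le> opnorm (Suc m) x" by (rule opnorm_vcomp)
  finally show ?case using step.hyps by (simp add: slice_Suc)
qed

lemma cmod_slice_le:
  assumes "Suc n \<le> m" "x \<in> mats m" shows "cmod (slice n m x u v) \<le> opnorm m x"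
proof (cases "u \<in> words (Suc n) \<and> v \<in> words (Suc n)")
  case True
  then show ?thesis using cmod_le_opnorm[of u "Suc n" v "slice n m x"] opnorm_slice[OF assms] by linarith
next
  case False
  then show ?thesis using matsD[OF slice_mats, of u n v m x] by auto
qed

lemma slice_amp:
  assumes "Suc n \<le> m" "m \<le> k" "x \<in> mats m" shows "slice n k (amp m k x) = slice n m x"
  using assms(2)
proof (induction k rule: dec_induct)
  case base
  have "amp m m x = x"
  proof (intro ext)
    fix u v show "amp m m x u v = x u v"
      using matsD[OF assms(3), of u v] matsD[OF mats_amp[OF order_refl assms(3)], of u v]
      by (cases "u \<in> words m \<and> v \<in> words m") (auto simp: amp_def tens_def mone_def words_def)
  qed
  then show ?case by simp
next
  case (step k)
  have "amp m (Suc k) x = amp k (Suc k) (amp m k x)" using step assms by (simp add: amp_amp)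
  also have "\<dots> = glue (\<lambda>i. amp m k x)" using step assms by (intro amp_Suc mats_amp)
  finally show ?case using step assms by (simp only: slice_Suc vcomp_glue)
qed

text \<open>A family of additive contractive functionals compatible with x \<mapsto> x \<otimes> 1
  extends by continuity to the UHF algebra. Both the slice entries and the normalized trace are
  instances. The threshold k is there because \<open>slice n m\<close> is meaningful only for m >
  n.\<close>

lemma approximates_functional:
  fixes \<phi> :: "nat \<Rightarrow> cmat \<Rightarrow> complex"
  assumes diff: "\<And>m x y. \<phi> m (x - y) = \<phi> m x - \<phi> m y"
    and bound: "\<And>m x. k \<le> m \<Longrightarrow> x \<in> mats m \<Longrightarrow> cmod (\<phi> m x) \<le> opnorm m x"
    and amp: "\<And>m l x. k \<le> m \<Longrightarrow> m \<le> l \<Longrightarrow> x \<in> mats m \<Longrightarrow> \<phi> l (amp m l x) = \<phi> m x"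
  shows "\<exists>t. \<forall>x. approximates x a \<longrightarrow> (\<lambda>m. \<phi> m (x m)) \<longlonglongrightarrow> t"
proof -
  obtain x where x: "approximates x a" by (rule approximates_exists)
  have "Cauchy (\<lambda>m. \<phi> m (x m))"
  proof (rule metric_CauchyI)
    fix e :: real assume "e > 0"
    then obtain N where N: "\<And>m l. N \<le> m \<Longrightarrow> N \<le> l \<Longrightarrow> norm (iota m (x m) - iota l (x l)) < e"
      using CauchyD[OF LIMSEQ_imp_Cauchy[OF approximatesD(2)[OF x]]] by meson
    have *: "cmod (\<phi> l (x l) - \<phi> m (x m)) < e" if "max N k \<le> m" "m \<le> l" for m l
    proof -
      have "\<phi> l (x l) - \<phi> m (x m) = \<phi> l (x l - amp m l (x m))"
        using that by (simp add: diff amp approximatesD[OF x])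
      also have "cmod \<dots> \<le> opnorm l (x l - amp m l (x m))"
        using that by (intro bound mats_diff mats_amp approximatesD[OF x]) auto
      also have "\<dots> = norm (iota l (x l) - iota m (x m))"
        using that by (intro norm_iota_diff[symmetric] approximatesD[OF x])
      also have "\<dots> < e" using that by (intro N) auto
      finally show ?thesis .
    qed
    have "dist (\<phi> m (x m)) (\<phi> l (x l)) < e" if "max N k \<le> m" "max N k \<le> l" for m l
      using *[of m l] *[of l m] that unfolding dist_norm by (metis nat_le_linear norm_minus_commute)
    then show "\<exists>M. \<forall>m\<ge>M. \<forall>l\<ge>M. dist (\<phi> m (x m)) (\<phi> l (x l)) < e" by blast
  qed
  then obtain t where t: "(\<lambda>m. \<phi> m (x m)) \<longlonglongrightarrow> t"
    using Cauchy_convergent convergent_def by blast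
  have "(\<lambda>m. \<phi> m (y m)) \<longlonglongrightarrow> t" if y: "approximates y a" for y
  proof -
    have "(\<lambda>m. \<phi> m (y m) - \<phi> m (x m)) \<longlonglongrightarrow> 0"
    proof (rule tendsto_norm_zero_cancel, rule tendsto_sandwich[OF _ _ tendsto_const])
      have "(\<lambda>m. norm (iota m (y m) - iota m (x m))) \<longlonglongrightarrow> norm (a - a)"
        by (intro tendsto_norm tendsto_diff approximatesD x y)
      then show "(\<lambda>m. opnorm m (y m - x m)) \<longlonglongrightarrow> 0"
        by (simp add: norm_iota_diff_same approximatesD[OF x] approximatesD[OF y])
      show "\<forall>\<^sub>F m in sequentially. cmod (\<phi> m (y m) - \<phi> m (x m)) \<le> opnorm m (y m - x m)"
        unfolding diff[symmetric]
        by (intro eventually_sequentiallyI[of k] bound mats_diff approximatesD[OF x] approximatesD[OF y])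
    qed simp
    then show ?thesis using tendsto_add[OF _ t] by fastforce
  qed
  then show ?thesis by blast
qed

section \<open>The slice maps on the UHF algebra\<close>

lemma rho_tendsto:
  assumes "approximates x a" shows "(\<lambda>m. slice n m (x m) u v) \<longlonglongrightarrow> rho n a u v"
proof -
  have "\<exists>t. \<forall>x. approximates x a \<longrightarrow> (\<lambda>m. slice n m (x m) u v) \<longlonglongrightarrow> t" for u v
    by (rule approximates_functional[where k = "Suc n"]) (rule slice_diff, erule (1) cmod_slice_le, simp only: slice_amp)
  then obtain y where y: "\<And>x u v. approximates x a \<Longrightarrow> (\<lambda>m. slice n m (x m) u v) \<longlonglongrightarrow> y u v"
    by metis
  have "rho n a = y"
    unfolding rho_def
    by (rule the_equality) (use y assms LIMSEQ_unique in \<open>blast, intro ext, blast\<close>)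
  then show ?thesis using y assms by simp
qed

lemma rho_mats: "rho n a \<in> mats (Suc n)"
proof (rule matsI)
  fix u v assume uv: "u \<notin> words (Suc n) \<or> v \<notin> words (Suc n)"
  obtain x where x: "approximates x a" by (rule approximates_exists)
  have "(\<lambda>m. slice n m (x m) u v) = (\<lambda>m. 0)"
    using matsD[OF slice_mats uv] by blast
  then show "rho n a u v = 0" using rho_tendsto[OF x, of n u v] by (simp add: LIMSEQ_const_iff)
qed

lemma rho_add: "rho n (a + b) = rho n a + rho n b"
proof (intro ext)
  fix u v
  obtain x y where xy: "approximates x a" "approximates y b" using approximates_exists by metis
  have "(\<lambda>m. slice n m (x m + y m) u v) \<longlonglongrightarrow> rho n a u v + rho n b u v"
    unfolding slice_add by (intro tendsto_add rho_tendsto xy)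
  then show "rho n (a + b) u v = (rho n a + rho n b) u v"
    using rho_tendsto[OF approximates_add[OF xy]] LIMSEQ_unique unfolding plus_fun_apply by blast
qed

lemma rho_scaleC: "rho n (c *\<^sub>C a) = c *\<^sub>C rho n a"
proof (intro ext)
  fix u v
  obtain x where x: "approximates x a" using approximates_exists by metis
  have "(\<lambda>m. slice n m (c *\<^sub>C x m) u v) \<longlonglongrightarrow> c * rho n a u v"
    unfolding slice_scaleC by (intro tendsto_mult tendsto_const rho_tendsto x)
  then show "rho n (c *\<^sub>C a) u v = (c *\<^sub>C rho n a) u v"
    using rho_tendsto[OF approximates_scaleC[OF x]] LIMSEQ_unique
    unfolding scaleC_fun_def scaleC_complex_def by blast
qed

lemma rho_star: "rho n (star a) = mstar (rho n a)"
proof (intro ext)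
  fix u v
  obtain x where x: "approximates x a" using approximates_exists by metis
  have "(\<lambda>m. slice n m (mstar (x m)) u v) \<longlonglongrightarrow> cnj (rho n a v u)"
    unfolding slice_mstar by (intro tendsto_cnj rho_tendsto x)
  moreover have "approximates (\<lambda>m. mstar (x m)) (star a)"
    using x unfolding approximates_def by (simp add: iota_star mats_mstar tendsto_star)
  ultimately show "rho n (star a) u v = mstar (rho n a) u v"
    using rho_tendsto LIMSEQ_unique unfolding mstar_def by blast
qed

lemma rho_diff: "rho n (a - b) = rho n a - rho n b"
  using rho_add[of n "a - b" b] by (simp add: eq_diff_eq)

text \<open>\<open>rho\<close> is only an entrywise limit, so the bound is passed to the limit for
  each fixed vector \<open>f\<close>, where finitely many entries are involved.\<close>

lemma opnorm_rho: "opnorm (Suc n) (rho n a) \<le> norm a"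
proof (rule opnorm_le)
  fix f
  obtain x where x: "approximates x a" using approximates_exists by metis
  have "(\<lambda>m. wnorm (Suc n) (mvec (Suc n) (slice n m (x m)) f)) \<longlonglongrightarrow> wnorm (Suc n) (mvec (Suc n) (rho n a) f)"
    unfolding wnorm_def L2_set_def mvec_def by (intro tendsto_intros rho_tendsto x)
  moreover have "(\<lambda>m. opnorm m (x m) * wnorm (Suc n) f) \<longlonglongrightarrow> norm a * wnorm (Suc n) f"
    by (intro tendsto_intros approximates_norm x)
  ultimately show "wnorm (Suc n) (mvec (Suc n) (rho n a) f) \<le> norm a * wnorm (Suc n) f"
  proof (rule LIMSEQ_le)
    have "wnorm (Suc n) (mvec (Suc n) (slice n m (x m)) f) \<le> opnorm m (x m) * wnorm (Suc n) f" if "Suc n \<le> m" for m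
      using opnorm_bound[of "Suc n" "slice n m (x m)" f] opnorm_slice[OF that approximatesD(1)[OF x]]
        mult_right_mono[OF _ wnorm_nonneg] order_trans by blast
    then show "\<exists>N. \<forall>m\<ge>N. wnorm (Suc n) (mvec (Suc n) (slice n m (x m)) f) \<le> opnorm m (x m) * wnorm (Suc n) f"
      by blast
  qed
qed simp

text \<open>The link between levels: \<rho>_n(a) is the restriction of \<rho>_(n+1)(a) to the old
  corners. The downward inductions below rest on it.\<close>

lemma vcomp_rho: "vcomp (rho (Suc n) a) 2 = rho n a"
proof (intro ext)
  fix u v
  obtain x where x: "approximates x a" using approximates_exists by metis
  have "slice (Suc n) m y (u @ [2]) (v @ [2]) = slice n m y u v" if "Suc (Suc n) \<le> m" for m y
  proof -
    have "m - (n + 1) = Suc (m - (Suc n + 1))" using that by simp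
    then have "replicate (m - (n + 1)) (2::3) = [2] @ replicate (m - (Suc n + 1)) 2" by simp
    then show ?thesis by (simp only: slice_def append_assoc Suc_eq_plus1[symmetric] words_snoc)
  qed
  then have "\<forall>\<^sub>F m in sequentially. slice (Suc n) m (x m) (u @ [2]) (v @ [2]) = slice n m (x m) u v"
    by (intro eventually_sequentiallyI)
  moreover have "(\<lambda>m. slice (Suc n) m (x m) (u @ [2]) (v @ [2])) \<longlonglongrightarrow> rho (Suc n) a (u @ [2]) (v @ [2])"
    by (rule rho_tendsto[OF x])
  ultimately have "(\<lambda>m. slice n m (x m) u v) \<longlonglongrightarrow> rho (Suc n) a (u @ [2]) (v @ [2])"
    by (rule Lim_transform_eventually[rotated])
  then show "vcomp (rho (Suc n) a) 2 u v = rho n a u v"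
    unfolding vcomp_def using rho_tendsto[OF x] LIMSEQ_unique by blast
qed

text \<open>The amplifications of y approximate \<open>iota (Suc n) y\<close>, and from level n + 1
  on all their slices equal y.\<close>

lemma rho_iota: assumes y: "y \<in> mats (Suc n)" shows "rho n (iota (Suc n) y) = y"
proof (intro ext)
  fix u v
  define x where "x m = (if Suc n \<le> m then amp (Suc n) m y else 0)" for m
  have x: "approximates x (iota (Suc n) y)"
    unfolding approximates_def
  proof (intro conjI allI)
    show "x m \<in> mats m" for m using mats_amp[OF _ y] mats_zero unfolding x_def by (metis (full_types))
    have "\<forall>\<^sub>F m in sequentially. iota (Suc n) y = iota m (x m)"
      by (intro eventually_sequentiallyI[of "Suc n"]) (simp add: x_def iota_amp[OF y])
    then show "(\<lambda>m. iota m (x m)) \<longlonglongrightarrow> iota (Suc n) y"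
      by (rule Lim_transform_eventually[OF tendsto_const])
  qed
  have "\<forall>\<^sub>F m in sequentially. y u v = slice n m (x m) u v"
    by (intro eventually_sequentiallyI[of "Suc n"]) (simp add: x_def slice_amp y slice_self)
  then have "(\<lambda>m. slice n m (x m) u v) \<longlonglongrightarrow> y u v"
    by (rule Lim_transform_eventually[OF tendsto_const])
  then show "rho n (iota (Suc n) y) u v = y u v" using rho_tendsto[OF x] LIMSEQ_unique by blast
qed

lemma cmod_rho_diff: "cmod (rho n a u v - rho n b u v) \<le> norm (a - b)"
proof (cases "u \<in> words (Suc n) \<and> v \<in> words (Suc n)")
  case True
  then have "cmod (rho n (a - b) u v) \<le> norm (a - b)"
    using cmod_le_opnorm opnorm_rho order_trans by blast
  then show ?thesis by (simp add: rho_diff)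
next
  case False
  then show ?thesis using matsD[OF rho_mats] by (metis diff_self norm_ge_zero norm_zero)
qed

lemma tendsto_rho:
  assumes "X \<longlonglongrightarrow> a" shows "(\<lambda>k. rho n (X k) u v) \<longlonglongrightarrow> rho n a u v"
proof (rule LIM_zero_cancel, rule tendsto_norm_zero_cancel, rule tendsto_sandwich[OF _ _ tendsto_const])
  show "(\<lambda>k. norm (X k - a)) \<longlonglongrightarrow> 0" using tendsto_norm_zero[OF LIM_zero[OF assms]] .
qed (auto simp: cmod_rho_diff)

section \<open>The algebra \<open>gasket_inf\<close>\<close>

lemma dmats_closed:
  assumes "\<And>k. c k \<in> dmats n" "\<And>u v. (\<lambda>k. c k u v) \<longlonglongrightarrow> d u v" shows "d \<in> dmats n"
proof -
  have 0: "d u v = 0" if "\<And>k. c k u v = 0" for u v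
    using assms(2)[of u v] that by (simp add: LIMSEQ_const_iff)
  show ?thesis
    unfolding dmats_def mem_Collect_eq
  proof (intro conjI allI impI)
    show "d \<in> mats (Suc n)" by (rule matsI, rule 0) (use dmats_mats[OF assms(1)] matsD in blast)
    show "d (u @ [i]) (v @ [k]) = 0" if "i \<noteq> k" for u v i k
      by (rule 0) (rule dmats_off[OF assms(1) that])
  qed
qed

text \<open>Each condition in \<open>gasket_rec\<close> says that an entry vanishes or that two
  entries agree, and this survives entrywise limits.\<close>

lemma gasket_rec_closed:
  "(\<And>k. c k \<in> gasket_rec n) \<Longrightarrow> (\<And>u v. (\<lambda>k. c k u v) \<longlonglongrightarrow> d u v) \<Longrightarrow> d \<in> gasket_rec n"
proof (induction n arbitrary: c d)
  case 0
  then show ?case using dmats_closed by (metis gasket_rec.simps(1))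
next
  case (Suc n)
  have lim: "(\<lambda>k. vcomp (c k) i u v) \<longlonglongrightarrow> vcomp d i u v" for i u v
    using Suc.prems(2) by (simp add: vcomp_def)
  have lim2: "(\<lambda>k. vcomp (vcomp (c k) i) j u v) \<longlonglongrightarrow> vcomp (vcomp d i) j u v" for i j u v
    using Suc.prems(2) by (simp add: vcomp_def)
  have c: "c k \<in> dmats (Suc n)" "vcomp (c k) 2 \<in> gasket_rec n" "vcomp (c k) 1 \<in> dmats n" "vcomp (c k) 3 \<in> dmats n"
    "vcomp (vcomp (c k) 1) j = vcomp (vcomp (c k) 3) (j + 2)" for k j
    using Suc.prems(1)[of k] by auto
  have "vcomp (vcomp d 1) j = vcomp (vcomp d 3) (j + 2)" for j
    using lim2[of 1 j] lim2[of 3 "j + 2"] unfolding c(5) by (intro ext LIMSEQ_unique)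
  then show ?case
    using dmats_closed[OF c(1) Suc.prems(2)] Suc.IH[OF c(2) lim] dmats_closed[OF c(3) lim] dmats_closed[OF c(4) lim]
    by simp
qed

text \<open>Downward induction from m: the component at 2 of a recursive element is recursive by
  definition, and by \<open>vcomp_rho\<close> it is the next slice.\<close>

lemma rho_iota_gasket_rec:
  assumes "n \<le> m" "c \<in> gasket_rec m" shows "rho n (iota (Suc m) c) \<in> gasket_rec n"
  using assms(1)
proof (induction n rule: inc_induct)
  case base
  then show ?case using assms(2) gasket_rec_dmats dmats_mats by (simp add: rho_iota)
next
  case (step n)
  then have "vcomp (rho (Suc n) (iota (Suc m) c)) 2 \<in> gasket_rec n" by auto
  then show ?case by (simp only: vcomp_rho)
qed

text \<open>Compression to the index 2 is multiplicative at every stage of the descent, because the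
  slices stay diagonal in their last factor.\<close>

lemma rho_iota_mmul:
  assumes "n \<le> m" "c \<in> gasket_rec m" "d \<in> gasket_rec m"
  shows "rho n (iota (Suc m) (mmul (Suc m) c d)) = mmul (Suc n) (rho n (iota (Suc m) c)) (rho n (iota (Suc m) d))"
  using assms(1)
proof (induction n rule: inc_induct)
  case base
  then show ?case using assms(2,3) gasket_rec_dmats dmats_mats by (simp add: rho_iota mats_mmul)
next
  case (step n)
  have "rho (Suc n) (iota (Suc m) c) \<in> dmats (Suc n)"
    by (rule gasket_rec_dmats, rule rho_iota_gasket_rec) (use step.hyps assms(2) in auto)
  then show ?case
    using arg_cong[OF step.IH, of "\<lambda>c. vcomp c 2"] by (simp only: vcomp_rho vcomp_mmul)
qed

lemma gasket_rec_mats: "c \<in> gasket_rec n \<Longrightarrow> c \<in> mats (Suc n)"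
  using gasket_rec_dmats dmats_mats by blast

text \<open>The unspecified approximants in the definition of \<open>gasket_inf\<close> can be
  replaced by the canonical ones \<open>rho n a\<close>.\<close>

lemma gasket_infD:
  assumes "a \<in> gasket_inf"
  shows "rho n a \<in> gasket_rec n" "(\<lambda>n. iota (Suc n) (rho n a)) \<longlonglongrightarrow> a"
proof -
  obtain x where x: "\<And>n. x n \<in> gasket_rec n" and lim: "(\<lambda>n. iota (Suc n) (x n)) \<longlonglongrightarrow> a"
    using assms by (auto simp: gasket_inf_def gasket_eq_gasket_rec)
  \<comment> \<open>Only approximants of level at least n are used, since only their slices are
    known to lie in \<open>gasket_rec n\<close>.\<close>
  have "(\<lambda>k. rho n (iota (Suc (n + k)) (x (n + k))) u v) \<longlonglongrightarrow> rho n a u v" for u v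
    using LIMSEQ_ignore_initial_segment[OF lim, of n] by (intro tendsto_rho) (simp add: add.commute)
  then show "rho n a \<in> gasket_rec n"
    by (rule gasket_rec_closed[rotated]) (intro rho_iota_gasket_rec x, simp)
  have "(\<lambda>n. iota (Suc n) (rho n a) - iota (Suc n) (x n)) \<longlonglongrightarrow> 0"
  proof (rule tendsto_norm_zero_cancel, rule tendsto_sandwich[OF _ _ tendsto_const])
    show "(\<lambda>n. norm (a - iota (Suc n) (x n))) \<longlonglongrightarrow> 0"
      using tendsto_norm_zero[OF LIM_zero[OF lim]] by (simp add: norm_minus_commute)
    \<comment> \<open>\<rho>_n is contractive and fixes \<open>x n\<close>, so applying it to a -
      x_n does not increase the distance.\<close>
    have "norm (iota (Suc n) (rho n a) - iota (Suc n) (x n)) \<le> norm (a - iota (Suc n) (x n))" for n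
      using opnorm_rho[of n "a - iota (Suc n) (x n)"]
      by (simp add: norm_iota_diff_same rho_mats gasket_rec_mats x rho_diff rho_iota)
    then show "\<forall>\<^sub>F n in sequentially. norm (iota (Suc n) (rho n a) - iota (Suc n) (x n)) \<le> norm (a - iota (Suc n) (x n))"
      by simp
  qed simp
  then show "(\<lambda>n. iota (Suc n) (rho n a)) \<longlonglongrightarrow> a"
    using tendsto_add[OF _ lim] by fastforce
qed

lemma gasket_infI: "(\<And>n. x n \<in> gasket_rec n) \<Longrightarrow> (\<lambda>n. iota (Suc n) (x n)) \<longlonglongrightarrow> a \<Longrightarrow> a \<in> gasket_inf"
  by (auto simp: gasket_inf_def gasket_eq_gasket_rec)

lemma rho_dmats: "a \<in> gasket_inf \<Longrightarrow> rho n a \<in> dmats n"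
  using gasket_infD(1) gasket_rec_dmats by blast

lemma gasket_inf_mult: "a \<in> gasket_inf \<Longrightarrow> b \<in> gasket_inf \<Longrightarrow> a * b \<in> gasket_inf"
  by (rule gasket_infI[where x = "\<lambda>n. mmul (Suc n) (rho n a) (rho n b)"])
    (auto intro!: gasket_rec_mmul gasket_infD tendsto_mult simp: iota_mmul rho_mats)

lemma star_subalgebra_gasket_inf: "star_subalgebra gasket_inf"
  unfolding star_subalgebra_def
proof (intro conjI ballI cvec.subspaceI gasket_inf_mult)
  have "(\<lambda>n. iota (Suc n) 0) \<longlonglongrightarrow> 0" unfolding iota_zero by (rule tendsto_const)
  then show "0 \<in> gasket_inf" by (rule gasket_infI[OF gasket_rec_zero])
  show "a + b \<in> gasket_inf" if "a \<in> gasket_inf" "b \<in> gasket_inf" for a b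
  proof (rule gasket_infI[OF gasket_rec_add[OF gasket_infD(1)[OF that(1)] gasket_infD(1)[OF that(2)]]])
    show "(\<lambda>n. iota (Suc n) (rho n a + rho n b)) \<longlonglongrightarrow> a + b"
      unfolding iota_add[OF rho_mats rho_mats] by (intro tendsto_add gasket_infD that)
  qed
  show "c *\<^sub>C a \<in> gasket_inf" if "a \<in> gasket_inf" for a c
  proof (rule gasket_infI[OF gasket_rec_scaleC[OF gasket_infD(1)[OF that]]])
    show "(\<lambda>n. iota (Suc n) (c *\<^sub>C rho n a)) \<longlonglongrightarrow> c *\<^sub>C a"
      unfolding iota_scaleC[OF rho_mats]
      by (intro bounded_linear.tendsto[OF bounded_linear_scaleC] gasket_infD that)
  qed
  show "star a \<in> gasket_inf" if "a \<in> gasket_inf" for a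
  proof (rule gasket_infI[OF gasket_rec_mstar[OF gasket_infD(1)[OF that]]])
    show "(\<lambda>n. iota (Suc n) (mstar (rho n a))) \<longlonglongrightarrow> star a"
      unfolding iota_star[OF rho_mats] by (intro tendsto_star gasket_infD that)
  qed
qed

text \<open>The maps a \<mapsto> \<open>iota (Suc n) (rho n a)\<close> are contractive uniformly in
  n, so their convergence to the identity on the X k carries over to the limit of the X k, with an
  error of three times e / 3.\<close>

lemma closed_gasket_inf: "closed gasket_inf"
  unfolding closed_sequential_limits
proof (intro allI impI)
  fix X a assume "(\<forall>k. X k \<in> gasket_inf) \<and> X \<longlonglongrightarrow> a"
  then have X: "\<And>k. X k \<in> gasket_inf" and lim: "X \<longlonglongrightarrow> a" by auto
  have g: "rho n a \<in> gasket_rec n" for n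
    by (rule gasket_rec_closed[OF gasket_infD(1)[OF X] tendsto_rho[OF lim]])
  have "(\<lambda>n. iota (Suc n) (rho n a)) \<longlonglongrightarrow> a"
  proof (rule LIMSEQ_I)
    fix e :: real assume e: "e > 0"
    then obtain k where k: "norm (X k - a) < e / 3"
      using LIMSEQ_D[OF lim, of "e / 3"] by auto
    obtain N where N: "\<And>n. N \<le> n \<Longrightarrow> norm (iota (Suc n) (rho n (X k)) - X k) < e / 3"
      using LIMSEQ_D[OF gasket_infD(2)[OF X[of k]], of "e / 3"] e by auto
    have "norm (iota (Suc n) (rho n a) - a) < e" if "N \<le> n" for n
    proof -
      have "norm (iota (Suc n) (rho n (a - X k))) \<le> norm (X k - a)"
        using opnorm_rho[of n "a - X k"] by (simp add: norm_iota rho_mats norm_minus_commute)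
      then have "norm (iota (Suc n) (rho n a) - iota (Suc n) (rho n (X k))) \<le> norm (X k - a)"
        by (simp add: rho_diff iota_diff rho_mats)
      then show ?thesis
        using N[OF that] k norm_triangle_ineq[of "iota (Suc n) (rho n a) - iota (Suc n) (rho n (X k))"
            "iota (Suc n) (rho n (X k)) - X k"]
          norm_triangle_ineq[of "iota (Suc n) (rho n a) - X k" "X k - a"] by simp
    qed
    then show "\<exists>no. \<forall>n\<ge>no. norm (iota (Suc n) (rho n a) - a) < e" by blast
  qed
  then show "a \<in> gasket_inf" using g by (intro gasket_infI)
qed

text \<open>Multiplicativity holds at finite level by \<open>rho_iota_mmul\<close>, and both sides
  are entrywise continuous in the approximants \<open>?a k\<close> and \<open>?b k\<close>.\<close>

lemma rho_mult:
  assumes "a \<in> gasket_inf" "b \<in> gasket_inf"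
  shows "rho n (a * b) = mmul (Suc n) (rho n a) (rho n b)"
proof (intro ext)
  fix u v
  let ?a = "\<lambda>k. iota (Suc (n + k)) (rho (n + k) a)" and ?b = "\<lambda>k. iota (Suc (n + k)) (rho (n + k) b)"
  have a: "?a \<longlonglongrightarrow> a" and b: "?b \<longlonglongrightarrow> b"
    using LIMSEQ_ignore_initial_segment[OF gasket_infD(2)[OF assms(1)], of n]
      LIMSEQ_ignore_initial_segment[OF gasket_infD(2)[OF assms(2)], of n] by (simp_all add: add.commute)
  have "(\<lambda>k. rho n (?a k * ?b k) u v) \<longlonglongrightarrow> rho n (a * b) u v"
    by (intro tendsto_rho tendsto_mult a b)
  moreover have "rho n (?a k * ?b k) = mmul (Suc n) (rho n (?a k)) (rho n (?b k))" for k
    using rho_iota_mmul[of n "n + k" "rho (n + k) a" "rho (n + k) b"] assms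
    by (simp add: iota_mmul rho_mats gasket_infD)
  moreover have "(\<lambda>k. mmul (Suc n) (rho n (?a k)) (rho n (?b k)) u v) \<longlonglongrightarrow> mmul (Suc n) (rho n a) (rho n b) u v"
    unfolding mmul_def by (intro tendsto_intros tendsto_rho a b)
  ultimately show "rho n (a * b) u v = mmul (Suc n) (rho n a) (rho n b) u v"
    by (simp add: LIMSEQ_unique)
qed

section \<open>The trace\<close>

lemma mtr_diff: "mtr n (x - y) = mtr n x - mtr n y"
  by (simp add: mtr_def sum_subtractf)

lemma mtr_amp:
  assumes "n \<le> m" shows "mtr m (amp n m x) = 3 ^ (m - n) * mtr n x"
proof -
  have "mtr m (amp n m x) = (\<Sum>t\<in>words (m - n). \<Sum>u\<in>words n. amp n m x (u @ t) (u @ t))"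
    unfolding mtr_def by (rule sum_words_append[OF assms])
  also have "\<dots> = (\<Sum>t\<in>words (m - n). mtr n x)"
    unfolding mtr_def by (intro sum.cong refl) (simp add: amp_append)
  finally show ?thesis by (simp add: card_words)
qed

lemma cmod_mtr_normalized_le: "cmod (mtr n x / 3 ^ n) \<le> opnorm n x"
  using cmod_mtr_le[of n x] by (simp add: norm_divide norm_power field_simps)

lemma uhf_trace_tendsto:
  assumes "approximates x a" shows "(\<lambda>n. mtr n (x n) / 3 ^ n) \<longlonglongrightarrow> uhf_trace a"
proof -
  obtain t where t: "\<And>x. approximates x a \<Longrightarrow> (\<lambda>n. mtr n (x n) / 3 ^ n) \<longlonglongrightarrow> t"
  proof -
    have "mtr l (amp m l x) / 3 ^ l = mtr m x / 3 ^ m" if "m \<le> l" for m l x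
      using that by (simp add: mtr_amp power_diff)
    then have "\<exists>t. \<forall>x. approximates x a \<longrightarrow> (\<lambda>n. mtr n (x n) / 3 ^ n) \<longlonglongrightarrow> t"
      by (intro approximates_functional[where k = 0])
        (simp_all only: mtr_diff diff_divide_distrib cmod_mtr_normalized_le)
    then show ?thesis using that by blast
  qed
  then have "uhf_trace a = t"
    unfolding uhf_trace_def using assms LIMSEQ_unique by blast
  then show ?thesis using t assms by simp
qed

lemma gasket_inf_trace:
  assumes "a \<in> gasket_inf"
  shows "(\<lambda>n. mtr (Suc n) (rho n a) / 3 ^ Suc n) \<longlonglongrightarrow> uhf_trace a"
proof -
  \<comment> \<open>Index shift: \<open>rho k a\<close> lies in the (k + 1)-fold tensor power. The
    value at 0 is a filler.\<close>
  define x where "x n = (case n of 0 \<Rightarrow> 0 | Suc k \<Rightarrow> rho k a)" for n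
  have "approximates x a"
    unfolding approximates_def
  proof (intro conjI allI)
    show "x n \<in> mats n" for n
      using rho_mats mats_zero unfolding x_def by (cases n) (simp_all only: nat.case)
    have "(\<lambda>n. iota (Suc n) (x (Suc n))) \<longlonglongrightarrow> a"
      unfolding x_def using gasket_infD(2)[OF assms] by simp
    then show "(\<lambda>n. iota n (x n)) \<longlonglongrightarrow> a" by (simp only: filterlim_sequentially_Suc[of "\<lambda>n. iota n (x n)"])
  qed
  from LIMSEQ_Suc[OF uhf_trace_tendsto[OF this]] show ?thesis by (simp add: x_def)
qed

section \<open>Density of the Lipschitz elements\<close>

text \<open>Affine interpolation: the new vertex between two old ones gets the average of their values,
  since \<open>l\<close> and \<open>l + i + 1\<close> are the old vertices next to or equal to the vertex \<open>i\<close> of the subcell \<open>l\<close>.\<close>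

definition affine_ext :: "cmat \<Rightarrow> cmat" where
  "affine_ext b = glue (\<lambda>i. glue (\<lambda>l. (1 / 2) *\<^sub>C (vcomp b l + vcomp b (l + i + 1))))"

lemma vcomp_affine_ext:
  "vcomp (vcomp (affine_ext b) i) l = (1 / 2) *\<^sub>C (vcomp b l + vcomp b (l + i + 1))"
  by (simp only: affine_ext_def vcomp_glue)

lemma scaleC_half: "(1 / 2) *\<^sub>C (x + x) = (x :: cmat)"
  by (simp add: scaleC_fun_def scaleC_complex_def fun_eq_iff)

lemma mod3_add3: "(l::3) + 2 + 1 = l" "(l::3) + 2 + 3 + 1 = l" "(l::3) + 1 + 1 = l + 2"
  using exhaust_3[of l] by (auto simp: mod3_simps)

lemma dmats_vcomp_affine_ext: "b \<in> dmats n \<Longrightarrow> vcomp (affine_ext b) i \<in> dmats n"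
  unfolding affine_ext_def vcomp_glue
  by (intro glue_dmats mats_scaleC mats_add mats_vcomp_dmats)

text \<open>Vertex 2 of subcell l is the old corner p_l, and l + 2 + 1 = l, so p_l is averaged with
  itself.\<close>

lemma vcomp_affine_ext_2: "b \<in> dmats n \<Longrightarrow> vcomp (affine_ext b) 2 = b"
  by (rule dmats_eqI[OF dmats_vcomp_affine_ext]) (simp_all only: vcomp_affine_ext mod3_add3 scaleC_half)

lemma dmats_affine_ext: "b \<in> dmats n \<Longrightarrow> affine_ext b \<in> dmats (Suc n)"
proof -
  assume b: "b \<in> dmats n"
  have "vcomp (affine_ext b) = (\<lambda>i. glue (\<lambda>l. (1 / 2) *\<^sub>C (vcomp b l + vcomp b (l + i + 1))))"
    by (rule ext) (simp only: affine_ext_def vcomp_glue)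
  then have "affine_ext b = glue (vcomp (affine_ext b))"
    by (simp only: affine_ext_def)
  then show ?thesis
    using glue_dmats[of "vcomp (affine_ext b)" "Suc n"] dmats_mats[OF dmats_vcomp_affine_ext[OF b]] by metis
qed

text \<open>Vertex 1 of subcell j gets the average of p_j and p_(j+2); vertex 3 of subcell j + 2
  gets the same average with the summands exchanged.\<close>

lemma gasket_rec_affine_ext: assumes b: "b \<in> gasket_rec n" shows "affine_ext b \<in> gasket_rec (Suc n)"
proof -
  have "vcomp (vcomp (affine_ext b) 1) j = vcomp (vcomp (affine_ext b) 3) (j + 2)" for j
    unfolding vcomp_affine_ext mod3_add3 by (simp only: add.commute)
  then show ?thesis
    using b dmats_affine_ext[OF gasket_rec_dmats[OF b]] dmats_vcomp_affine_ext[OF gasket_rec_dmats[OF b]]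
      vcomp_affine_ext_2[OF gasket_rec_dmats[OF b]]
    by (simp only: gasket_rec.simps mem_Collect_eq simp_thms)
qed

section \<open>Oscillation over the corners and the Lipschitz algebra\<close>

definition osc_le :: "nat \<Rightarrow> cmat \<Rightarrow> real \<Rightarrow> bool" where
  "osc_le n b C \<longleftrightarrow> (\<forall>i j. opnorm n (vcomp b i - vcomp b j) \<le> C)"

lemma half_diff: "(1 / 2) *\<^sub>C (x + y) - (1 / 2) *\<^sub>C (x + z) = (1 / 2) *\<^sub>C (y - z :: cmat)"
  by (simp add: scaleC_fun_def scaleC_complex_def fun_eq_iff field_simps)

text \<open>All vertices of subcell l are averages with the same p_l. It cancels in differences,
  which leaves half of a difference of old corners; the blocks over l are then estimated
  separately.\<close>

lemma osc_affine_ext: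
  assumes "b \<in> dmats n" "osc_le n b C" shows "osc_le (Suc n) (affine_ext b) (C / 2)"
  unfolding osc_le_def
proof (intro allI opnorm_dmats_le dmats_diff dmats_vcomp_affine_ext assms)
  fix i j l
  show "opnorm n (vcomp (vcomp (affine_ext b) i - vcomp (affine_ext b) j) l) \<le> C / 2"
    using assms(2) unfolding vcomp_diff vcomp_affine_ext half_diff opnorm_scaleC osc_le_def by simp
qed

text \<open>At vertex i of subcell l the interpolation has the value (p_l + p_(l+i+1)) / 2, whereas
  b \<otimes> 1 has p_l there.\<close>

lemma affine_ext_close:
  assumes "b \<in> dmats n" "osc_le n b C"
  shows "opnorm (Suc (Suc n)) (affine_ext b - amp (Suc n) (Suc (Suc n)) b) \<le> C / 2"
proof -
  have a: "amp (Suc n) (Suc (Suc n)) b = glue (\<lambda>i. b)"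
    by (intro amp_Suc dmats_mats assms)
  have "opnorm (Suc n) (vcomp (affine_ext b) i - b) \<le> C / 2" for i
  proof (rule opnorm_dmats_le)
    show "vcomp (affine_ext b) i - b \<in> dmats n"
      by (intro dmats_diff dmats_vcomp_affine_ext assms)
    fix l
    have "vcomp (vcomp (affine_ext b) i - b) l = (1 / 2) *\<^sub>C (vcomp b (l + i + 1) - vcomp b l)"
      unfolding vcomp_diff vcomp_affine_ext by (simp add: scaleC_fun_def scaleC_complex_def fun_eq_iff field_simps)
    then show "opnorm n (vcomp (vcomp (affine_ext b) i - b) l) \<le> C / 2"
      using assms(2) by (simp only: opnorm_scaleC osc_le_def) simp
  qed
  moreover have "affine_ext b - glue (\<lambda>i. b) \<in> dmats (Suc n)"
    by (intro dmats_diff dmats_affine_ext glue_dmats dmats_mats assms)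
  ultimately show ?thesis
    unfolding a using opnorm_dmats_le[of "affine_ext b - glue (\<lambda>i. b)" "Suc n" "C / 2"]
    by (simp only: vcomp_diff vcomp_glue)
qed

lemma opnorm_diff_le: "opnorm n (x - y) \<le> opnorm n x + opnorm n y"
  using opnorm_add[of n x "- y"] by simp

lemma osc_le_rho: "osc_le n (rho n a) (2 * norm a)"
  unfolding osc_le_def
proof (intro allI)
  fix i j
  show "opnorm n (vcomp (rho n a) i - vcomp (rho n a) j) \<le> 2 * norm a"
    using opnorm_diff_le[of n "vcomp (rho n a) i" "vcomp (rho n a) j"] opnorm_vcomp[of n "rho n a" i] opnorm_vcomp[of n "rho n a" j] opnorm_rho[of n a] by linarith
qed

lemma osc_le_mono: "osc_le n b C \<Longrightarrow> C \<le> D \<Longrightarrow> osc_le n b D"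
  unfolding osc_le_def using order_trans by blast

text \<open>The dense star-subalgebra required of a spectral triple. The rate 2^-n cancels the
  factor 2^n of D_n, so these elements have commutators bounded uniformly in n.\<close>

definition lipschitz_elements :: "uhf set" where
  "lipschitz_elements = {a \<in> gasket_inf. \<exists>C. \<forall>n. osc_le n (rho n a) (C / 2 ^ n)}"

lemma star_subalgebra_lipschitz: "star_subalgebra lipschitz_elements"
  unfolding star_subalgebra_def
proof (intro conjI ballI cvec.subspaceI)
  have G: "cvec.subspace gasket_inf" "\<And>a. a \<in> gasket_inf \<Longrightarrow> star a \<in> gasket_inf"
    using star_subalgebra_gasket_inf unfolding star_subalgebra_def by blast+
  show "0 \<in> lipschitz_elements"
  proof -
    have "osc_le n (rho n 0) (0 / 2 ^ n)" for n
      using osc_le_rho[of n 0] by simp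
    then show ?thesis using cvec.subspace_0[OF G(1)] unfolding lipschitz_elements_def by blast
  qed
  show "a + b \<in> lipschitz_elements" if L: "a \<in> lipschitz_elements" "b \<in> lipschitz_elements" for a b
  proof -
    obtain C D where CD: "\<And>n. osc_le n (rho n a) (C / 2 ^ n)" "\<And>n. osc_le n (rho n b) (D / 2 ^ n)"
      using L unfolding lipschitz_elements_def by auto
    have "osc_le n (rho n (a + b)) ((C + D) / 2 ^ n)" for n
      unfolding osc_le_def
    proof (intro allI)
      fix i j
      have "vcomp (rho n (a + b)) i - vcomp (rho n (a + b)) j =
        (vcomp (rho n a) i - vcomp (rho n a) j) + (vcomp (rho n b) i - vcomp (rho n b) j)"
        unfolding rho_add vcomp_add by (simp only: add_diff_add)
      then show "opnorm n (vcomp (rho n (a + b)) i - vcomp (rho n (a + b)) j) \<le> (C + D) / 2 ^ n"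
        using opnorm_add[of n "vcomp (rho n a) i - vcomp (rho n a) j" "vcomp (rho n b) i - vcomp (rho n b) j"]
          CD[of n] unfolding osc_le_def add_divide_distrib by (smt (verit))
    qed
    then show ?thesis
      using L cvec.subspace_add[OF G(1)] unfolding lipschitz_elements_def by blast
  qed
  show "c *\<^sub>C a \<in> lipschitz_elements" if L: "a \<in> lipschitz_elements" for a c
  proof -
    obtain C where C: "\<And>n. osc_le n (rho n a) (C / 2 ^ n)"
      using L unfolding lipschitz_elements_def by auto
    have "osc_le n (rho n (c *\<^sub>C a)) (cmod c * C / 2 ^ n)" for n
      using C[of n] unfolding osc_le_def rho_scaleC vcomp_scaleC cvec.scale_right_diff_distrib[symmetric] opnorm_scaleC
      by (metis mult_left_mono norm_ge_zero times_divide_eq_right)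
    then show ?thesis
      using L cvec.subspace_scale[OF G(1)] unfolding lipschitz_elements_def by blast
  qed
  show "star a \<in> lipschitz_elements" if L: "a \<in> lipschitz_elements" for a
  proof -
    obtain C where C: "\<And>n. osc_le n (rho n a) (C / 2 ^ n)"
      using L unfolding lipschitz_elements_def by auto
    have "osc_le n (rho n (star a)) (C / 2 ^ n)" for n
      using C[of n] unfolding osc_le_def rho_star vcomp_mstar mstar_diff[symmetric] opnorm_mstar .
    then show ?thesis using L G(2) unfolding lipschitz_elements_def by blast
  qed
  show "a * b \<in> lipschitz_elements" if L: "a \<in> lipschitz_elements" "b \<in> lipschitz_elements" for a b
  proof -
    obtain C D where CD: "\<And>n. osc_le n (rho n a) (C / 2 ^ n)" "\<And>n. osc_le n (rho n b) (D / 2 ^ n)"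
      using L unfolding lipschitz_elements_def by auto
    have ab: "a \<in> gasket_inf" "b \<in> gasket_inf" using L unfolding lipschitz_elements_def by auto
    have "osc_le n (rho n (a * b)) ((norm a * D + C * norm b) / 2 ^ n)" for n
      unfolding osc_le_def
    proof (intro allI)
      fix i j
      \<comment> \<open>The Leibniz rule for the difference of two corner values of a
        product.\<close>
      have "opnorm n (vcomp (rho n (a * b)) i - vcomp (rho n (a * b)) j) \<le>
        opnorm n (vcomp (rho n a) i) * opnorm n (vcomp (rho n b) i - vcomp (rho n b) j) +
        opnorm n (vcomp (rho n a) i - vcomp (rho n a) j) * opnorm n (vcomp (rho n b) j)"
        unfolding rho_mult[OF ab] vcomp_mmul[OF rho_dmats[OF ab(1)]] by (rule mmul_diff_opnorm)
      also have "\<dots> \<le> norm a * (D / 2 ^ n) + (C / 2 ^ n) * norm b"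
        using CD[of n] unfolding osc_le_def
        by (intro add_mono mult_mono order_trans[OF opnorm_vcomp opnorm_rho])
          (auto intro: order_trans[OF opnorm_nonneg])
      also have "\<dots> = (norm a * D + C * norm b) / 2 ^ n" by (simp add: add_divide_distrib)
      finally show "opnorm n (vcomp (rho n (a * b)) i - vcomp (rho n (a * b)) j) \<le> (norm a * D + C * norm b) / 2 ^ n" .
    qed
    then show ?thesis using gasket_inf_mult[OF ab] unfolding lipschitz_elements_def by blast
  qed
qed

text \<open>The limit of the iterated affine interpolations of b. Interpolation never changes old
  corners, so the slices of the limit are the iterates themselves and their oscillation is
  known.\<close>

lemma lipschitz_extension:
  assumes b: "b \<in> gasket_rec n" and C: "osc_le n b C"
  obtains a where "a \<in> lipschitz_elements" "norm (a - iota (Suc n) b) \<le> C"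
proof -
  define y where "y k = (affine_ext ^^ k) b" for k
  have y_Suc: "y (Suc k) = affine_ext (y k)" for k by (simp add: y_def)
  have y: "y k \<in> gasket_rec (n + k)" for k
  proof (induction k)
    case (Suc k)
    then show ?case using gasket_rec_affine_ext[of "y k" "n + k"] by (simp only: y_Suc add_Suc_right)
  qed (use b in \<open>simp add: y_def\<close>)
  have osc: "osc_le (n + k) (y k) (C / 2 ^ k)" for k
  proof (induction k)
    case (Suc k)
    then show ?case using osc_affine_ext[OF gasket_rec_dmats[OF y], of k "C / 2 ^ k"] by (simp add: y_Suc mult.commute)
  qed (use C in \<open>simp add: y_def\<close>)
  define X where "X k = iota (Suc (n + k)) (y k)" for k
  have step: "norm (X (Suc k) - X k) \<le> C / 2 * (1 / 2) ^ k" for k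
  proof -
    have "norm (X (Suc k) - X k) = opnorm (Suc (Suc (n + k))) (y (Suc k) - amp (Suc (n + k)) (Suc (Suc (n + k))) (y k))"
      unfolding X_def add_Suc_right
      using gasket_rec_mats[OF y[of k]] gasket_rec_mats[OF y[of "Suc k"]] by (intro norm_iota_diff) simp_all
    also have "\<dots> \<le> C / 2 ^ k / 2"
      unfolding y_Suc by (intro affine_ext_close gasket_rec_dmats y osc)
    finally show ?thesis by (simp add: power_one_over field_simps)
  qed
  \<comment> \<open>The k-th interpolation moves the element by at most C / 2^(k+1); these sum to
    the bound C of the statement.\<close>
  have g: "(\<lambda>k. C / 2 * (1 / 2) ^ k) sums C"
    using sums_mult[OF geometric_sums[of "1 / 2 :: real"], of "C / 2"] by simp
  let ?D = "\<lambda>k. X (Suc k) - X k"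
  have sD: "summable ?D"
    by (rule summable_comparison_test'[OF sums_summable[OF g], of 0]) (rule step)
  define a where "a = X 0 + suminf ?D"
  have "(\<lambda>k. \<Sum>i<k. ?D i) \<longlonglongrightarrow> suminf ?D" using summable_LIMSEQ[OF sD] .
  then have "(\<lambda>k. X 0 + (\<Sum>i<k. ?D i)) \<longlonglongrightarrow> a" unfolding a_def by (intro tendsto_intros)
  then have lim: "X \<longlonglongrightarrow> a" by (simp add: sum_lessThan_telescope)
  have "norm (suminf ?D) \<le> suminf (\<lambda>k. C / 2 * (1 / 2) ^ k)"
    using step by (intro norm_suminf_le sums_summable[OF g])
  then have close: "norm (a - iota (Suc n) b) \<le> C"
    using sums_unique[OF g] by (simp add: a_def X_def y_def)
  \<comment> \<open>Going down one level drops the vertices created by the last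
    interpolation.\<close>
  have rX: "rho (n + k) (X K) = y k" if "k \<le> K" for k K
    using that
  proof (induction k rule: inc_induct)
    case base
    show ?case unfolding X_def by (intro rho_iota gasket_rec_mats y)
  next
    case (step k)
    have "rho (n + k) (X K) = vcomp (rho (n + Suc k) (X K)) 2" by (simp only: vcomp_rho add_Suc_right)
    then show ?case unfolding step.IH y_Suc using vcomp_affine_ext_2[OF gasket_rec_dmats[OF y]] by simp
  qed
  have ra: "rho (n + k) a = y k" for k
  proof (intro ext)
    fix u v
    have "(\<lambda>K. rho (n + k) (X (K + k)) u v) \<longlonglongrightarrow> rho (n + k) a u v"
      by (intro tendsto_rho LIMSEQ_ignore_initial_segment lim)
    then show "rho (n + k) a u v = y k u v" by (simp add: rX LIMSEQ_const_iff)
  qed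
  \<comment> \<open>Levels below n get the filler 0, which does not influence the limit.\<close>
  have aG: "a \<in> gasket_inf"
  proof (rule gasket_infI[where x = "\<lambda>m. if n \<le> m then y (m - n) else 0"])
    show "(if n \<le> m then y (m - n) else 0) \<in> gasket_rec m" for m
      using y[of "m - n"] gasket_rec_zero[of m] by (cases "n \<le> m") (simp_all only: le_add_diff_inverse if_True if_False)
    have "(\<lambda>k. iota (Suc (k + n)) (if n \<le> k + n then y (k + n - n) else 0)) \<longlonglongrightarrow> a"
      using lim unfolding X_def by (simp add: add.commute)
    then show "(\<lambda>m. iota (Suc m) (if n \<le> m then y (m - n) else 0)) \<longlonglongrightarrow> a"
      by (rule LIMSEQ_offset)
  qed
  have C0: "0 \<le> C" using order_trans[OF norm_ge_zero step[of 0]] by simp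
  \<comment> \<open>One constant for two ranges: C * 2^n suffices for m \<ge> n, and for m < n the
    crude bound 2 * norm a is absorbed because 2^m \<le> 2^n.\<close>
  have "osc_le m (rho m a) ((C + 2 * norm a) * 2 ^ n / 2 ^ m)" for m
  proof (cases "n \<le> m")
    case True
    then have "osc_le m (rho m a) (C / 2 ^ (m - n))"
      using osc[of "m - n"] ra[of "m - n"] by simp
    moreover have "C / 2 ^ (m - n) = C * 2 ^ n / 2 ^ m" using True by (simp add: power_diff)
    moreover have "C * 2 ^ n / 2 ^ m \<le> (C + 2 * norm a) * 2 ^ n / 2 ^ m"
      by (intro divide_right_mono mult_right_mono) auto
    ultimately show ?thesis using osc_le_mono by metis
  next
    case False
    then have "(2::real) ^ m \<le> 2 ^ n" by simp
    then have "2 * norm a * 2 ^ m \<le> (C + 2 * norm a) * 2 ^ n" using C0 by (intro mult_mono) auto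
    then have "2 * norm a \<le> (C + 2 * norm a) * 2 ^ n / 2 ^ m" by (simp add: field_simps)
    then show ?thesis using osc_le_rho osc_le_mono by blast
  qed
  then have "a \<in> lipschitz_elements" using aG unfolding lipschitz_elements_def by blast
  then show ?thesis using close that by blast
qed

text \<open>\<rho>_(n+1)(a) is eventually close to \<rho>_n(a) \<otimes> 1, and the latter has no
  oscillation at all.\<close>

lemma osc_rho_small:
  assumes "a \<in> gasket_inf" "e > 0"
  shows "\<exists>N. \<forall>n\<ge>N. osc_le n (rho n a) e"
proof -
  let ?X = "\<lambda>n. iota (Suc n) (rho n a)"
  have "Cauchy ?X" using gasket_infD(2)[OF assms(1)] by (rule LIMSEQ_imp_Cauchy)
  then obtain N where N: "\<And>k l. N \<le> k \<Longrightarrow> N \<le> l \<Longrightarrow> norm (?X k - ?X l) < e / 2"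
    using assms(2) by (meson CauchyD half_gt_zero)
  have "osc_le (Suc n) (rho (Suc n) a) e" if "N \<le> n" for n
    unfolding osc_le_def
  proof (intro allI)
    fix i j
    let ?d = "rho (Suc n) a - amp (Suc n) (Suc (Suc n)) (rho n a)"
    have "opnorm (Suc (Suc n)) ?d = norm (?X (Suc n) - ?X n)"
      by (intro norm_iota_diff[symmetric] rho_mats) simp
    then have "opnorm (Suc (Suc n)) ?d < e / 2"
      using N[of "Suc n" n] that by simp
    then have d: "opnorm (Suc n) (vcomp ?d i) \<le> e / 2" for i
      using opnorm_vcomp[of "Suc n" ?d i] by linarith
    have eq: "vcomp (rho (Suc n) a) i - vcomp (rho (Suc n) a) j = vcomp ?d i - vcomp ?d j"
      unfolding amp_Suc[OF rho_mats] vcomp_diff vcomp_glue by simp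
    show "opnorm (Suc n) (vcomp (rho (Suc n) a) i - vcomp (rho (Suc n) a) j) \<le> e"
      unfolding eq using d[of i] d[of j] opnorm_diff_le[of "Suc n" "vcomp ?d i" "vcomp ?d j"] by linarith
  qed
  then show ?thesis by (metis Suc_le_D Suc_le_mono)
qed

text \<open>At a level where a is well approximated and oscillates little,
  \<open>lipschitz_extension\<close> replaces \<rho>_n(a) by a Lipschitz element at a distance no
  larger than the oscillation.\<close>

lemma lipschitz_dense: "gasket_inf \<subseteq> closure lipschitz_elements"
proof
  fix a assume a: "a \<in> gasket_inf"
  show "a \<in> closure lipschitz_elements"
    unfolding closure_approachable
  proof (intro allI impI)
    fix e :: real assume e: "e > 0"
    obtain N where N: "\<And>n. N \<le> n \<Longrightarrow> osc_le n (rho n a) (e / 2)"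
      using osc_rho_small[OF a, of "e / 2"] e by auto
    obtain M where M: "\<And>n. M \<le> n \<Longrightarrow> norm (iota (Suc n) (rho n a) - a) < e / 2"
      using LIMSEQ_D[OF gasket_infD(2)[OF a], of "e / 2"] e by auto
    let ?n = "max N M"
    obtain a' where a': "a' \<in> lipschitz_elements" "norm (a' - iota (Suc ?n) (rho ?n a)) \<le> e / 2"
      using lipschitz_extension[OF gasket_infD(1)[OF a] N[of ?n]] by auto
    have "norm (a' - a) < e"
      using a'(2) M[of ?n] norm_triangle_ineq[of "a' - iota (Suc ?n) (rho ?n a)" "iota (Suc ?n) (rho ?n a) - a"] by simp
    then show "\<exists>y\<in>lipschitz_elements. dist y a < e" using a'(1) by (auto simp: dist_norm)
  qed
qed

section \<open>Monotonicity of the energy\<close>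

text \<open>The squared Hilbert-Schmidt norm Tr(|x|^2). Written as a sum over entries, it lets
  scalar inequalities be applied entry by entry.\<close>

definition hs2 :: "nat \<Rightarrow> cmat \<Rightarrow> real" where
  "hs2 n x = (\<Sum>u\<in>words n. \<Sum>v\<in>words n. (cmod (x u v))\<^sup>2)"

lemma hs2_nonneg: "0 \<le> hs2 n x"
  by (simp add: hs2_def sum_nonneg)

lemma Re_mtr_mstar_mmul: "Re (mtr n (mmul n (mstar x) x)) = hs2 n x"
proof -
  have "mtr n (mmul n (mstar x) x) = (\<Sum>v\<in>words n. \<Sum>u\<in>words n. complex_of_real ((cmod (x u v))\<^sup>2))"
    unfolding mtr_def mmul_def mstar_def
    by (intro sum.cong refl) (simp add: complex_norm_square mult.commute del: of_real_power)
  then have "Re (mtr n (mmul n (mstar x) x)) = (\<Sum>v\<in>words n. \<Sum>u\<in>words n. (cmod (x u v))\<^sup>2)"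
    by (simp add: Re_sum)
  also have "\<dots> = hs2 n x" unfolding hs2_def by (rule sum.swap)
  finally show ?thesis .
qed

lemma hs2_minus_commute: "hs2 n (x - y) = hs2 n (y - x)"
  by (simp add: hs2_def norm_minus_commute)

text \<open>The factor 2 appears because the energy runs over ordered pairs of corners.\<close>

lemma energy_hs2: "energy n c = 2 * (hs2 n (vcomp c 1 - vcomp c 2) + hs2 n (vcomp c 2 - vcomp c 3) + hs2 n (vcomp c 3 - vcomp c 1))"
proof -
  have *: "UNIV - {1} = {2, 3 :: 3}" "UNIV - {2} = {1, 3 :: 3}" "UNIV - {3} = {1, 2 :: 3}"
    unfolding UNIV3 by (simp_all add: insert_Diff_if mod3_simps)
  show ?thesis
    unfolding energy_def Re_mtr_mstar_mmul sum_3 *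
    using hs2_minus_commute[of n "vcomp c 2" "vcomp c 1"] hs2_minus_commute[of n "vcomp c 3" "vcomp c 2"]
      hs2_minus_commute[of n "vcomp c 1" "vcomp c 3"]
    by (simp add: mod3_simps)
qed

lemma energy_sum: "energy n c = (\<Sum>i\<in>UNIV. \<Sum>j\<in>UNIV - {i}. hs2 n (vcomp c i - vcomp c j))"
  unfolding energy_def Re_mtr_mstar_mmul ..

lemma energy_nonneg: "0 \<le> energy n c"
  by (simp add: energy_sum hs2_nonneg sum_nonneg)

lemma hs2_Suc: "c \<in> dmats n \<Longrightarrow> hs2 (Suc n) c = (\<Sum>l\<in>UNIV. hs2 n (vcomp c l))"
proof -
  assume c: "c \<in> dmats n"
  have "(\<Sum>v\<in>words (Suc n). (cmod (c (u @ [i]) v))\<^sup>2) = (\<Sum>v\<in>words n. (cmod (vcomp c i u v))\<^sup>2)" for u i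
  proof -
    have "(\<Sum>v\<in>words (Suc n). (cmod (c (u @ [i]) v))\<^sup>2) =
      (\<Sum>k\<in>UNIV. if k = i then \<Sum>v\<in>words n. (cmod (vcomp c i u v))\<^sup>2 else 0)"
      unfolding sum_words_Suc by (intro sum.cong refl) (auto simp: vcomp_def dmats_off[OF c])
    then show ?thesis by simp
  qed
  then show ?thesis unfolding hs2_def sum_words_Suc[of "\<lambda>u. \<Sum>v\<in>words (Suc n). (cmod (c u v))\<^sup>2" n] by simp
qed

text \<open>With the fine values \<open>x\<^sub>j\<close> replaced by \<open>(2 p\<^sub>j + 2 p\<^sub>j\<^sub>+\<^sub>2 + p\<^sub>j\<^sub>+\<^sub>1) / 5\<close>, the harmonic extension, equality holds.\<close>

lemma gasket_ineq_real:
  fixes p1 p2 p3 x1 x2 x3 :: real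
  shows "3 * ((p1 - p2)\<^sup>2 + (p2 - p3)\<^sup>2 + (p3 - p1)\<^sup>2) \<le>
    5 * (((x1 - p1)\<^sup>2 + (p1 - x2)\<^sup>2 + (x2 - x1)\<^sup>2) + ((x2 - p2)\<^sup>2 + (p2 - x3)\<^sup>2 + (x3 - x2)\<^sup>2)
      + ((x3 - p3)\<^sup>2 + (p3 - x1)\<^sup>2 + (x1 - x3)\<^sup>2))" (is "?L \<le> ?R")
proof -
  define z1 z2 z3 where z: "z1 = 5 * x1 - (2 * p1 + 2 * p3 + p2)" "z2 = 5 * x2 - (2 * p2 + 2 * p1 + p3)"
    "z3 = 5 * x3 - (2 * p3 + 2 * p2 + p1)"
  \<comment> \<open>Each z is 5 times the deviation of a new value from the harmonic one, and the
    defect is a sum of squares in these deviations.\<close>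
  have "5 * (?R - ?L) = 2 * (z1\<^sup>2 + z2\<^sup>2 + z3\<^sup>2) + (z1 - z2)\<^sup>2 + (z2 - z3)\<^sup>2 + (z3 - z1)\<^sup>2"
    unfolding z by algebra
  also have "\<dots> \<ge> 0" by simp
  finally show ?thesis by simp
qed

lemma gasket_ineq_complex:
  fixes p1 p2 p3 x1 x2 x3 :: complex
  shows "3 * ((cmod (p1 - p2))\<^sup>2 + (cmod (p2 - p3))\<^sup>2 + (cmod (p3 - p1))\<^sup>2) \<le>
    5 * (((cmod (x1 - p1))\<^sup>2 + (cmod (p1 - x2))\<^sup>2 + (cmod (x2 - x1))\<^sup>2) + ((cmod (x2 - p2))\<^sup>2 + (cmod (p2 - x3))\<^sup>2 + (cmod (x3 - x2))\<^sup>2)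
      + ((cmod (x3 - p3))\<^sup>2 + (cmod (p3 - x1))\<^sup>2 + (cmod (x1 - x3))\<^sup>2))"
  using add_mono[OF gasket_ineq_real[of "Re p1" "Re p2" "Re p3" "Re x1" "Re x2" "Re x3"]
    gasket_ineq_real[of "Im p1" "Im p2" "Im p3" "Im x1" "Im x2" "Im x3"]]
  unfolding cmod_power2 minus_complex.sel by (simp only: distrib_left add_ac)

text \<open>The scalar inequality is summed over the matrix entries. The left side is the energy on
  the old corners, the right side that of the three subcells.\<close>

lemma energy_mono:
  assumes c: "c \<in> gasket_rec (Suc n)"
  shows "energy n (vcomp c 2) \<le> 5 / 3 * energy (Suc n) c"
proof -
  define p x where px: "p = vcomp (vcomp c 2)" "x = vcomp (vcomp c 1)"
  have "\<And>j. vcomp (vcomp c 1) j = vcomp (vcomp c 3) (j + 2)" using c by auto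
  from this[of 1] this[of 2] this[of 3]
  have x3: "vcomp (vcomp c 3) 1 = x 2" "vcomp (vcomp c 3) 2 = x 3" "vcomp (vcomp c 3) 3 = x 1"
    by (simp_all add: px mod3_simps)
  have d: "vcomp c 1 \<in> dmats n" "vcomp c 2 \<in> dmats n" "vcomp c 3 \<in> dmats n"
    using c gasket_rec_dmats[of "vcomp c 2" n] by simp_all
  let ?h = "hs2 n"
  have "3 * (?h (p 1 - p 2) + ?h (p 2 - p 3) + ?h (p 3 - p 1)) \<le>
    5 * ((?h (x 1 - p 1) + ?h (p 1 - x 2) + ?h (x 2 - x 1)) + (?h (x 2 - p 2) + ?h (p 2 - x 3) + ?h (x 3 - x 2))
      + (?h (x 3 - p 3) + ?h (p 3 - x 1) + ?h (x 1 - x 3)))"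
    unfolding hs2_def sum.distrib[symmetric] sum_distrib_left minus_apply
    by (intro sum_mono gasket_ineq_complex)
  moreover have "energy (Suc n) c = 2 * ((?h (x 1 - p 1) + ?h (p 1 - x 2) + ?h (x 2 - x 1)) + (?h (x 2 - p 2) + ?h (p 2 - x 3) + ?h (x 3 - x 2))
      + (?h (x 3 - p 3) + ?h (p 3 - x 1) + ?h (x 1 - x 3)))"
    unfolding energy_hs2 hs2_Suc[OF dmats_diff[OF d(1) d(2)]] hs2_Suc[OF dmats_diff[OF d(2) d(3)]]
      hs2_Suc[OF dmats_diff[OF d(3) d(1)]] sum_3 vcomp_diff x3 px[symmetric] by simp
  moreover have "energy n (vcomp c 2) = 2 * (?h (p 1 - p 2) + ?h (p 2 - p 3) + ?h (p 3 - p 1))"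
    unfolding energy_hs2 px ..
  ultimately show ?thesis by simp
qed

text \<open>By \<open>energy_mono\<close> and \<open>vcomp_rho\<close> the rescaled energies
  increase, so the \<open>lim\<close> in \<open>energy_inf\<close> is a supremum. Its finiteness
  permits the passage from \<open>ennreal\<close> to the reals.\<close>

lemma energy_inf_tendsto:
  assumes a: "a \<in> energy_dom"
  shows "(\<lambda>m. (5 / 3) ^ m * energy m (rho m a)) \<longlonglongrightarrow> enn2real (energy_inf a)"
proof -
  let ?e = "\<lambda>m. (5 / 3) ^ m * energy m (rho m a)"
  have aG: "a \<in> gasket_inf" and fin: "energy_inf a < \<infinity>" using a by (auto simp: energy_dom_def)
  have mono: "?e m \<le> ?e (Suc m)" for m
    using mult_left_mono[OF energy_mono[OF gasket_infD(1)[OF aG, of "Suc m"]], of "(5 / 3) ^ m"]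
    by (simp add: vcomp_rho mult_ac)
  have "incseq (\<lambda>m. ennreal (?e m))"
    by (intro incseq_SucI ennreal_leI mono)
  then have "(\<lambda>m. ennreal (?e m)) \<longlonglongrightarrow> (SUP m. ennreal (?e m))" by (rule LIMSEQ_SUP)
  then have lim: "(\<lambda>m. ennreal (?e m)) \<longlonglongrightarrow> energy_inf a"
    unfolding energy_inf_def by (simp add: limI)
  have "(\<lambda>m. enn2real (ennreal (?e m))) \<longlonglongrightarrow> enn2real (energy_inf a)"
    by (rule tendsto_enn2real) (use lim fin in \<open>auto simp: less_top\<close>)
  then show ?thesis by (simp add: energy_nonneg)
qed

section \<open>An Abelian theorem\<close>

text \<open>The quotient is minus the reciprocal of the difference quotient of 2^-s at 0, whose
  limit is -ln 2. This is the source of 1 / ln 2 in both residues.\<close>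

lemma one_minus_powr_limit: "((\<lambda>s. s / (1 - 2 powr (- s))) \<longlongrightarrow> 1 / ln 2) (at_right (0::real))"
proof -
  have "((\<lambda>s::real. 2 powr (- s)) has_real_derivative - ln 2) (at 0)"
    by (auto intro!: derivative_eq_intros)
  then have "((\<lambda>s::real. (2 powr (- s) - 1) / s) \<longlongrightarrow> - ln 2) (at 0)"
    by (simp add: has_field_derivative_iff)
  then have "((\<lambda>s::real. (2 powr (- s) - 1) / s) \<longlongrightarrow> - ln 2) (at_right 0)"
    by (rule tendsto_mono[OF at_le[OF subset_UNIV]])
  then have "((\<lambda>s::real. - 1 / ((2 powr (- s) - 1) / s)) \<longlongrightarrow> - 1 / (- ln 2)) (at_right 0)"
    by (intro tendsto_divide tendsto_const) auto
  moreover have "- 1 / ((2 powr (- s) - 1) / s) = s / (1 - 2 powr (- s))" for s :: real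
    using minus_divide_right[of s "2 powr (- s) - 1"] by simp
  ultimately show ?thesis by simp
qed

text \<open>With r = 2^-s this is a power series in r. Both zeta functions take this form once the
  pole is moved to s = 0.\<close>

definition powr_series :: "(nat \<Rightarrow> complex) \<Rightarrow> real \<Rightarrow> complex" where
  "powr_series x s = (\<Sum>n. complex_of_real ((2 powr (- s)) ^ n) * x n)"

lemma summable_power_mult:
  fixes x :: "nat \<Rightarrow> complex"
  assumes "x \<longlonglongrightarrow> L" and r: "0 < r" "r < 1"
  shows "summable (\<lambda>n. complex_of_real (r ^ n) * x n)"
proof -
  obtain K where K: "\<And>n. cmod (x n) \<le> K"
    using convergent_imp_Bseq[OF convergentI[OF assms(1)]] by (auto simp: Bseq_def)
  have "summable (\<lambda>n. r ^ n * K)" using r by (intro summable_mult2 summable_geometric) simp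
  then show ?thesis
    by (rule summable_comparison_test'[of _ 0]) (use r K in \<open>simp add: norm_mult norm_power mult_left_mono\<close>)
qed

lemma summable_powr_series:
  "x \<longlonglongrightarrow> L \<Longrightarrow> s > 0 \<Longrightarrow> summable (\<lambda>n. complex_of_real ((2 powr (- s)) ^ n) * x n)"
  by (rule summable_power_mult) (simp_all add: powr_less_one)

text \<open>The first N terms contribute at most K each, and the tail is at most e times a geometric
  series; the factor 1 - r then makes the head small.\<close>

lemma abel_mean_bound:
  fixes y :: "nat \<Rightarrow> complex"
  assumes r: "0 < r" "r < 1" and K: "\<And>n. cmod (y n) \<le> K" and N: "\<And>n. N \<le> n \<Longrightarrow> cmod (y n) \<le> e" and e: "0 \<le> e"
  shows "(1 - r) * cmod (\<Sum>n. complex_of_real (r ^ n) * y n) \<le> e + (1 - r) * (real N * K)"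
proof -
  have K0: "0 \<le> K" using K[of 0] norm_ge_zero order_trans by blast
  have g: "(\<lambda>n. r ^ n * e + (if n \<in> {..<N} then K else 0)) sums (1 / (1 - r) * e + (\<Sum>n<N. K))"
    using r by (intro sums_add sums_mult2 geometric_sums sums_If_finite_set) simp_all
  have "cmod (\<Sum>n. complex_of_real (r ^ n) * y n) \<le> (\<Sum>n. r ^ n * e + (if n \<in> {..<N} then K else 0))"
  proof (rule norm_suminf_le[OF _ sums_summable[OF g]])
    fix n
    have "r ^ n * cmod (y n) \<le> 1 * K" using r K0 by (intro mult_mono K power_le_one) auto
    moreover have "r ^ n * cmod (y n) \<le> r ^ n * e" if "N \<le> n" using N[OF that] r by simp
    ultimately show "cmod (complex_of_real (r ^ n) * y n) \<le> r ^ n * e + (if n \<in> {..<N} then K else 0)"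
      using r e by (auto simp: norm_mult norm_power add_increasing)
  qed
  also have "\<dots> = 1 / (1 - r) * e + real N * K" using sums_unique[OF g] by simp
  finally have "(1 - r) * cmod (\<Sum>n. complex_of_real (r ^ n) * y n) \<le> (1 - r) * (1 / (1 - r) * e + real N * K)"
    using r by (intro mult_left_mono) auto
  then show ?thesis using r by (simp add: distrib_left)
qed

text \<open>Abel: (1 - r) times the series tends to L as r tends to 1, and s / (1 - r) tends to 1 /
  ln 2.\<close>

lemma powr_series_limit:
  assumes x: "x \<longlonglongrightarrow> L"
  shows "((\<lambda>s. complex_of_real s * powr_series x s) \<longlongrightarrow> L / complex_of_real (ln 2)) (at_right 0)"
proof -
  have r: "0 < 2 powr (- s)" "2 powr (- s) < 1" if "s > 0" for s :: real
    using that by (simp_all add: powr_less_one)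
  have "((\<lambda>s. complex_of_real (1 - 2 powr (- s)) * powr_series x s - L) \<longlongrightarrow> 0) (at_right 0)"
  proof (rule tendstoI)
    fix e :: real assume e: "e > 0"
    let ?y = "\<lambda>n. x n - L"
    have y0: "?y \<longlonglongrightarrow> 0" using LIM_zero[OF x] .
    obtain N where N: "\<And>n. N \<le> n \<Longrightarrow> cmod (?y n) \<le> e / 2"
      using LIMSEQ_D[OF y0, of "e / 2"] e by (auto intro: less_imp_le)
    obtain K where K: "\<And>n. cmod (?y n) \<le> K"
      using convergent_imp_Bseq[OF convergentI[OF y0]] by (auto simp: Bseq_def)
    have "((\<lambda>s::real. (1 - 2 powr (- s)) * (real N * K)) \<longlongrightarrow> (1 - 2 powr (- 0)) * (real N * K)) (at_right 0)"
      by (intro tendsto_intros) auto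
    then have "\<forall>\<^sub>F s::real in at_right 0. (1 - 2 powr (- s)) * (real N * K) < e / 2"
      using e by (intro order_tendstoD(2)) auto
    then show "\<forall>\<^sub>F s in at_right 0. dist (complex_of_real (1 - 2 powr (- s)) * powr_series x s - L) 0 < e"
      using eventually_at_right_less[of "0::real"]
    proof eventually_elim
      case (elim s)
      define r where "r = 2 powr (- s)"
      have r01: "0 < r" "r < 1" using r[OF elim(2)] by (simp_all add: r_def)
      have "(\<lambda>n. complex_of_real (r ^ n)) sums complex_of_real (1 / (1 - r))"
        using geometric_sums[of r] r01 by (simp only: sums_of_real_iff) simp
      then have gL: "(\<lambda>n. complex_of_real (r ^ n) * L) sums (complex_of_real (1 / (1 - r)) * L)"
        by (rule sums_mult2)
      have "(\<Sum>n. complex_of_real (r ^ n) * ?y n) = powr_series x s - complex_of_real (1 / (1 - r)) * L"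
        using suminf_diff[OF summable_power_mult[OF x r01] sums_summable[OF gL]] sums_unique[OF gL]
        by (simp add: right_diff_distrib powr_series_def r_def)
      then have "complex_of_real (1 - r) * powr_series x s - L = complex_of_real (1 - r) * (\<Sum>n. complex_of_real (r ^ n) * ?y n)"
        using r01 by (simp add: right_diff_distrib flip: of_real_mult)
      then have "cmod (complex_of_real (1 - r) * powr_series x s - L) = (1 - r) * cmod (\<Sum>n. complex_of_real (r ^ n) * ?y n)"
        using r01 by (simp only: norm_mult norm_of_real)
      also have "\<dots> \<le> e / 2 + (1 - r) * (real N * K)"
        by (rule abel_mean_bound[OF r01 K N]) (use e in auto)
      also have "\<dots> < e" using elim(1) by (simp add: r_def)
      finally show ?case by (simp only: dist_norm diff_zero r_def)
    qed
  qed
  then have "((\<lambda>s. complex_of_real (s / (1 - 2 powr (- s))) * (complex_of_real (1 - 2 powr (- s)) * powr_series x s))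
      \<longlongrightarrow> complex_of_real (1 / ln 2) * L) (at_right 0)"
    by (rule tendsto_mult[OF tendsto_of_real[OF one_minus_powr_limit] LIM_zero_cancel])
  moreover have "\<forall>\<^sub>F s in at_right 0. complex_of_real (s / (1 - 2 powr (- s))) * (complex_of_real (1 - 2 powr (- s)) * powr_series x s) = complex_of_real s * powr_series x s"
    using eventually_at_right_less[of "0::real"]
  proof eventually_elim
    case (elim s)
    then have "1 - 2 powr (- s) \<noteq> 0" using r[OF elim] by simp
    then have "complex_of_real (s / (1 - 2 powr (- s))) * complex_of_real (1 - 2 powr (- s)) = complex_of_real s"
      by (simp only: of_real_mult[symmetric]) simp
    then show ?case by (simp only: mult.assoc[symmetric])
  qed
  ultimately have "((\<lambda>s. complex_of_real s * powr_series x s) \<longlongrightarrow> complex_of_real (1 / ln 2) * L) (at_right 0)"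
    by (rule Lim_transform_eventually)
  then show ?thesis by simp
qed

lemma has_residue_powr_series:
  assumes x: "x \<longlonglongrightarrow> L" and f: "\<And>s. s > s0 \<Longrightarrow> f s = powr_series x (s - s0)"
  shows "has_residue f s0 (L / complex_of_real (ln 2))"
proof -
  have "\<forall>\<^sub>F s in at_right 0. complex_of_real s * powr_series x s = complex_of_real (s + s0 - s0) * f (s + s0)"
    using eventually_at_right_less[of "0::real"] by eventually_elim (simp add: f)
  with powr_series_limit[OF x]
  have "((\<lambda>s. complex_of_real (s + s0 - s0) * f (s + s0)) \<longlongrightarrow> L / complex_of_real (ln 2)) (at_right 0)"
    by (rule Lim_transform_eventually)
  then show ?thesis unfolding has_residue_def by (subst filterlim_at_right_to_0)
qed

section \<open>Orthonormal bases and traces\<close>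

text \<open>Interpreted for \<open>H_sum\<close>, where the volume trace lives, and for each
  \<open>H_level n\<close>, where the commutator traces are taken.\<close>

locale inner_space =
  fixes H :: "'h::complex_vector set" and ip :: "'h \<Rightarrow> 'h \<Rightarrow> complex"
  assumes subspace_H: "cvec.subspace H"
    and ip_add_right: "x \<in> H \<Longrightarrow> y \<in> H \<Longrightarrow> z \<in> H \<Longrightarrow> ip x (y + z) = ip x y + ip x z"
    and ip_scale_right: "x \<in> H \<Longrightarrow> y \<in> H \<Longrightarrow> ip x (c *\<^sub>C y) = c * ip x y"
    and ip_sym: "x \<in> H \<Longrightarrow> y \<in> H \<Longrightarrow> ip y x = cnj (ip x y)"
    and ip_nonneg: "x \<in> H \<Longrightarrow> 0 \<le> Re (ip x x)"
    and ip_self_zero: "x \<in> H \<Longrightarrow> ip x x = 0 \<Longrightarrow> x = 0"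
begin

lemmas H_zero = cvec.subspace_0[OF subspace_H]
  and H_add = cvec.subspace_add[OF subspace_H]
  and H_diff = cvec.subspace_diff[OF subspace_H]
  and H_scale = cvec.subspace_scale[OF subspace_H]
  and H_sum = cvec.subspace_sum[OF subspace_H]

lemma ip_zero_right: "x \<in> H \<Longrightarrow> ip x 0 = 0"
  using ip_scale_right[of x 0 0] H_zero by (simp only: cvec.scale_zero_right mult_zero_left)

lemma ip_diff_right: "x \<in> H \<Longrightarrow> y \<in> H \<Longrightarrow> z \<in> H \<Longrightarrow> ip x (y - z) = ip x y - ip x z"
  using ip_add_right[of x "y - z" z] H_diff[of y z] by simp

lemma ip_diff_left: "x \<in> H \<Longrightarrow> y \<in> H \<Longrightarrow> z \<in> H \<Longrightarrow> ip (y - z) x = ip y x - ip z x"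
  using ip_sym[of x "y - z"] ip_sym[of x y] ip_sym[of x z] by (simp add: ip_diff_right H_diff)

lemma ip_sum_right:
  assumes "x \<in> H" "\<And>i. i \<in> F \<Longrightarrow> f i \<in> H"
  shows "ip x (\<Sum>i\<in>F. f i) = (\<Sum>i\<in>F. ip x (f i))"
  using assms(2)
proof (induction F rule: infinite_finite_induct)
  case (insert i F)
  then show ?case using assms(1) by (simp add: ip_add_right H_sum)
qed (use assms(1) in \<open>simp_all add: ip_zero_right\<close>)

lemma hnorm_sq: "x \<in> H \<Longrightarrow> (hnorm ip x)\<^sup>2 = Re (ip x x)"
  by (simp add: hnorm_def ip_nonneg)

lemma hnorm_nonneg: "x \<in> H \<Longrightarrow> 0 \<le> hnorm ip x"
  by (simp add: hnorm_def ip_nonneg)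

lemma ip_self: "x \<in> H \<Longrightarrow> ip x x = complex_of_real ((hnorm ip x)\<^sup>2)"
  using ip_sym[of x x] by (simp add: hnorm_sq complex_eq_iff)

text \<open>Expand and complete the square. The choice of Fourier coefficients for c gives Bessel's
  inequality, and the last sum shows that this choice is optimal.\<close>

lemma approximation_identity:
  assumes x: "x \<in> H" and F: "finite F" "F \<subseteq> H" "\<And>b b'. b \<in> F \<Longrightarrow> b' \<in> F \<Longrightarrow> ip b b' = (if b = b' then 1 else 0)"
  shows "(hnorm ip (x - (\<Sum>b\<in>F. c b *\<^sub>C b)))\<^sup>2 =
    (hnorm ip x)\<^sup>2 - (\<Sum>b\<in>F. (cmod (ip b x))\<^sup>2) + (\<Sum>b\<in>F. (cmod (c b - ip b x))\<^sup>2)"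
proof -
  let ?S = "\<Sum>b\<in>F. c b *\<^sub>C b"
  have S: "?S \<in> H" using F(2) by (intro H_sum H_scale) auto
  have xS: "ip x ?S = (\<Sum>b\<in>F. c b * cnj (ip b x))"
  proof -
    have "ip x ?S = (\<Sum>b\<in>F. ip x (c b *\<^sub>C b))"
      using F(2) x by (intro ip_sum_right H_scale) auto
    also have "\<dots> = (\<Sum>b\<in>F. c b * cnj (ip b x))"
    proof (intro sum.cong refl)
      fix b assume "b \<in> F"
      then have b: "b \<in> H" using F(2) by blast
      show "ip x (c b *\<^sub>C b) = c b * cnj (ip b x)"
        using ip_scale_right[OF x b] ip_sym[OF b x] by simp
    qed
    finally show ?thesis .
  qed
  have bS: "ip b ?S = c b" if "b \<in> F" for b
  proof -
    have "ip b ?S = (\<Sum>b'\<in>F. ip b (c b' *\<^sub>C b'))"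
      using F(2) that by (intro ip_sum_right H_scale) auto
    also have "\<dots> = (\<Sum>b'\<in>F. if b' = b then c b else 0)"
      using F(2,3) that by (intro sum.cong refl) (auto simp: ip_scale_right subset_iff)
    finally show ?thesis using F(1) that by simp
  qed
  have SS: "ip ?S ?S = (\<Sum>b\<in>F. c b * cnj (c b))"
  proof -
    have "ip ?S ?S = (\<Sum>b\<in>F. ip ?S (c b *\<^sub>C b))"
      using F(2) S by (intro ip_sum_right H_scale) auto
    also have "\<dots> = (\<Sum>b\<in>F. c b * cnj (c b))"
    proof (intro sum.cong refl)
      fix b assume b: "b \<in> F"
      then have bH: "b \<in> H" using F(2) by blast
      show "ip ?S (c b *\<^sub>C b) = c b * cnj (c b)"
        using ip_scale_right[OF S bH] ip_sym[OF bH S] bS[OF b] by simp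
    qed
    finally show ?thesis .
  qed
  have r1: "Re (ip x ?S) = (\<Sum>b\<in>F. Re (c b * cnj (ip b x)))" by (simp only: xS Re_sum)
  have r2: "Re (ip ?S x) = (\<Sum>b\<in>F. Re (c b * cnj (ip b x)))"
    unfolding ip_sym[OF x S] complex_cnj r1[symmetric] by simp
  have r3: "Re (ip ?S ?S) = (\<Sum>b\<in>F. Re (c b * cnj (c b)))" by (simp only: SS Re_sum)
  have "(hnorm ip (x - ?S))\<^sup>2 = Re (ip x x) - Re (ip x ?S) - Re (ip ?S x) + Re (ip ?S ?S)"
    using x S by (simp add: hnorm_sq H_diff ip_diff_left ip_diff_right)
  also have "\<dots> = (hnorm ip x)\<^sup>2 + (\<Sum>b\<in>F. Re (c b * cnj (c b)) - 2 * Re (c b * cnj (ip b x)))"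
    unfolding r1 r2 r3 hnorm_sq[OF x] sum_subtractf sum_distrib_left[symmetric] by simp
  also have "(\<Sum>b\<in>F. Re (c b * cnj (c b)) - 2 * Re (c b * cnj (ip b x))) =
      (\<Sum>b\<in>F. (cmod (c b - ip b x))\<^sup>2 - (cmod (ip b x))\<^sup>2)"
    by (intro sum.cong refl) (simp add: cmod_power2, simp add: power2_eq_square algebra_simps)
  finally show ?thesis by (simp add: sum_subtractf)
qed

lemma bessel:
  assumes "x \<in> H" "finite F" "F \<subseteq> H" "\<And>b b'. b \<in> F \<Longrightarrow> b' \<in> F \<Longrightarrow> ip b b' = (if b = b' then 1 else 0)"
  shows "(\<Sum>b\<in>F. (cmod (ip b x))\<^sup>2) \<le> (hnorm ip x)\<^sup>2"
  using approximation_identity[OF assms, where c = "\<lambda>b. ip b x"]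
    zero_le_power2[of "hnorm ip (x - (\<Sum>b\<in>F. ip b x *\<^sub>C b))"] by simp

text \<open>Bessel's inequality for the single vector obtained by normalizing x.\<close>

lemma cauchy_schwarz:
  assumes x: "x \<in> H" and y: "y \<in> H" shows "cmod (ip x y) \<le> hnorm ip x * hnorm ip y"
proof (cases "hnorm ip x = 0")
  case True
  then have "x = 0" using x ip_self[OF x] by (intro ip_self_zero) simp_all
  then show ?thesis using True ip_sym[OF y H_zero] ip_zero_right[OF y] by simp
next
  case False
  define n where "n = hnorm ip x"
  have n: "n > 0" using False hnorm_nonneg[OF x] by (simp add: n_def)
  let ?b = "complex_of_real (1 / n) *\<^sub>C x"
  have b: "?b \<in> H" using x by (rule H_scale)
  have bz: "ip ?b z = complex_of_real (1 / n) * ip x z" if "z \<in> H" for z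
    using ip_sym[OF that b] ip_sym[OF that x] ip_scale_right[OF that x] by (simp add: that)
  have "ip ?b ?b = complex_of_real (1 / n * (1 / n * n\<^sup>2))"
    by (simp only: bz[OF b] ip_scale_right[OF x x] ip_self[OF x] n_def[symmetric] of_real_mult)
  then have "ip ?b ?b = 1" using n by (simp add: power2_eq_square)
  then have "(\<Sum>b\<in>{?b}. (cmod (ip b y))\<^sup>2) \<le> (hnorm ip y)\<^sup>2"
    using b by (intro bessel y) auto
  then have "(cmod (ip ?b y))\<^sup>2 \<le> (hnorm ip y)\<^sup>2" by simp
  then have "cmod (ip ?b y) \<le> hnorm ip y" using hnorm_nonneg[OF y] by (rule power2_le_imp_le)
  then have "cmod (ip x y) / n \<le> hnorm ip y" using n unfolding bz[OF y] by (simp add: norm_mult norm_divide)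
  then show ?thesis using n by (simp add: n_def[symmetric] field_simps)
qed

lemma onb_facts:
  assumes "is_onb H ip B"
  shows "B \<subseteq> H" "\<And>b b'. b \<in> B \<Longrightarrow> b' \<in> B \<Longrightarrow> ip b b' = (if b = b' then 1 else 0)" "dense_in H ip (cvec.span B)"
  using assms by (auto simp: is_onb_def)

text \<open>Density gives a good approximant with coefficients on a finite set F0. For every finite
  F containing F0, the Fourier sum over F is at least as good.\<close>

lemma onb_expansion:
  assumes B: "is_onb H ip B" and x: "x \<in> H"
  shows "((\<lambda>F. hnorm ip (x - (\<Sum>b\<in>F. ip b x *\<^sub>C b))) \<longlongrightarrow> 0) (finite_subsets_at_top B)"
proof (rule tendstoI)
  fix e :: real assume e: "e > 0"
  obtain y where y: "y \<in> cvec.span B" "hnorm ip (x - y) < e"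
    using onb_facts(3)[OF B] x e unfolding dense_in_def by blast
  then obtain F0 r where F0: "finite F0" "F0 \<subseteq> B" and yr: "y = (\<Sum>b\<in>F0. r b *\<^sub>C b)"
    unfolding cvec.span_explicit by blast
  have "dist (hnorm ip (x - (\<Sum>b\<in>F. ip b x *\<^sub>C b))) 0 < e" if F: "finite F" "F0 \<subseteq> F" "F \<subseteq> B" for F
  proof -
    have FH: "F \<subseteq> H" "\<And>b b'. b \<in> F \<Longrightarrow> b' \<in> F \<Longrightarrow> ip b b' = (if b = b' then 1 else 0)"
      using F onb_facts[OF B] by blast+
    \<comment> \<open>Padding with zeros makes y a competitor with coefficients on F.\<close>
    have "y = (\<Sum>b\<in>F. (if b \<in> F0 then r b else 0) *\<^sub>C b)"
      unfolding yr using F by (intro sum.mono_neutral_cong_left) (auto simp: cvec.scale_zero_left)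
    then have "(hnorm ip (x - (\<Sum>b\<in>F. ip b x *\<^sub>C b)))\<^sup>2 \<le> (hnorm ip (x - y))\<^sup>2"
      using approximation_identity[OF x F(1) FH, where c = "\<lambda>b. ip b x"]
        approximation_identity[OF x F(1) FH, where c = "\<lambda>b. if b \<in> F0 then r b else 0"]
      by (simp add: sum_nonneg)
    moreover have yH: "y \<in> H" unfolding yr using F0 onb_facts(1)[OF B] by (intro H_sum H_scale) auto
    ultimately have "hnorm ip (x - (\<Sum>b\<in>F. ip b x *\<^sub>C b)) \<le> hnorm ip (x - y)"
      using x by (intro power2_le_imp_le[OF _ hnorm_nonneg[OF H_diff]]) auto
    moreover have "0 \<le> hnorm ip (x - (\<Sum>b\<in>F. ip b x *\<^sub>C b))"
      using x FH(1) by (intro hnorm_nonneg H_diff H_sum H_scale) auto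
    ultimately show ?thesis using y(2) by simp
  qed
  then show "\<forall>\<^sub>F F in finite_subsets_at_top B. dist (hnorm ip (x - (\<Sum>b\<in>F. ip b x *\<^sub>C b))) 0 < e"
    unfolding eventually_finite_subsets_at_top using F0 by blast
qed

section \<open>Bounded operators and traces in an orthonormal basis\<close>

lemma linear_into_zero: "linear_into H H T \<Longrightarrow> T 0 = 0"
  unfolding linear_into_def using H_zero by (metis cvec.scale_zero_left)

lemma linear_into_sum:
  assumes T: "linear_into H H T" and f: "\<And>i. i \<in> F \<Longrightarrow> f i \<in> H"
  shows "T (\<Sum>i\<in>F. f i) = (\<Sum>i\<in>F. T (f i))"
  using f
proof (induction F rule: infinite_finite_induct)
  case (insert i F)
  then have "(\<Sum>i\<in>F. f i) \<in> H" by (intro H_sum) auto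
  then show ?case using insert T unfolding linear_into_def by simp
qed (use linear_into_zero[OF T] in simp_all)

lemma linear_into_diff:
  assumes T: "linear_into H H T" and xy: "x \<in> H" "y \<in> H"
  shows "T (x - y) = T x - T y"
proof -
  have "T ((x - y) + y) = T (x - y) + T y"
    using T xy H_diff unfolding linear_into_def by blast
  then show ?thesis by simp
qed

lemma bounded_op_bound:
  assumes "bounded_op H H ip T"
  obtains C where "C > 0" "\<And>x. x \<in> H \<Longrightarrow> hnorm ip (T x) \<le> C * hnorm ip x"
proof -
  obtain C where C: "\<And>x. x \<in> H \<Longrightarrow> hnorm ip (T x) \<le> C * hnorm ip x"
    using assms unfolding bounded_op_def by blast
  have "hnorm ip (T x) \<le> max C 1 * hnorm ip x" if "x \<in> H" for x
    using C[OF that] hnorm_nonneg[OF that] mult_right_mono[of C "max C 1" "hnorm ip x"] by linarith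
  then show ?thesis using that[of "max C 1"] by simp
qed

text \<open>Boundedness carries the convergent expansion of x through T. The case of the identity is
  Parseval's formula.\<close>

lemma bounded_op_expansion:
  assumes B: "is_onb H ip B" and T: "bounded_op H H ip T" and x: "x \<in> H" and y: "y \<in> H"
  shows "((\<lambda>b. ip b x * ip y (T b)) has_sum ip y (T x)) B"
  unfolding has_sum_def
proof (rule LIM_zero_cancel, rule tendsto_norm_zero_cancel)
  have lin: "linear_into H H T" and TH: "\<And>z. z \<in> H \<Longrightarrow> T z \<in> H"
    using T unfolding bounded_op_def linear_into_def by blast+
  obtain C where C: "C > 0" "\<And>x. x \<in> H \<Longrightarrow> hnorm ip (T x) \<le> C * hnorm ip x"
    using bounded_op_bound[OF T] by blast
  have BH: "B \<subseteq> H" using onb_facts[OF B] by blast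
  let ?r = "\<lambda>F. x - (\<Sum>b\<in>F. ip b x *\<^sub>C b)"
  have *: "norm ((\<Sum>b\<in>F. ip b x * ip y (T b)) - ip y (T x)) \<le> hnorm ip y * (C * hnorm ip (?r F))"
    if F: "finite F" "F \<subseteq> B" for F
  proof -
    have s: "ip b x *\<^sub>C b \<in> H" if "b \<in> F" for b using that F BH by (intro H_scale) auto
    then have S: "(\<Sum>b\<in>F. ip b x *\<^sub>C b) \<in> H" by (intro H_sum) auto
    have "ip y (T (\<Sum>b\<in>F. ip b x *\<^sub>C b)) = (\<Sum>b\<in>F. ip y (T (ip b x *\<^sub>C b)))"
    proof -
      have "T (\<Sum>b\<in>F. ip b x *\<^sub>C b) = (\<Sum>b\<in>F. T (ip b x *\<^sub>C b))"
        by (rule linear_into_sum[OF lin]) (rule s)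
      moreover have "ip y (\<Sum>b\<in>F. T (ip b x *\<^sub>C b)) = (\<Sum>b\<in>F. ip y (T (ip b x *\<^sub>C b)))"
        by (rule ip_sum_right[OF y]) (intro TH s)
      ultimately show ?thesis by simp
    qed
    also have "\<dots> = (\<Sum>b\<in>F. ip b x * ip y (T b))"
      using F BH lin TH y by (intro sum.cong refl) (auto simp: linear_into_def subset_iff ip_scale_right)
    finally have "(\<Sum>b\<in>F. ip b x * ip y (T b)) - ip y (T x) = - ip y (T (?r F))"
      using linear_into_diff[OF lin x S] ip_diff_right[OF y TH[OF x] TH[OF S]] by simp
    then have "norm ((\<Sum>b\<in>F. ip b x * ip y (T b)) - ip y (T x)) = cmod (ip y (T (?r F)))" by simp
    also have "\<dots> \<le> hnorm ip y * hnorm ip (T (?r F))"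
      using x S by (intro cauchy_schwarz y TH H_diff)
    also have "\<dots> \<le> hnorm ip y * (C * hnorm ip (?r F))"
      using x S y by (intro mult_left_mono C hnorm_nonneg H_diff)
    finally show ?thesis .
  qed
  show "((\<lambda>F. norm ((\<Sum>b\<in>F. ip b x * ip y (T b)) - ip y (T x))) \<longlongrightarrow> 0) (finite_subsets_at_top B)"
  proof (rule tendsto_sandwich[OF _ _ tendsto_const])
    have "((\<lambda>F. hnorm ip y * (C * hnorm ip (?r F))) \<longlongrightarrow> hnorm ip y * (C * 0)) (finite_subsets_at_top B)"
      by (intro tendsto_mult tendsto_const onb_expansion B x)
    then show "((\<lambda>F. hnorm ip y * (C * hnorm ip (?r F))) \<longlongrightarrow> 0) (finite_subsets_at_top B)" by simp
    show "\<forall>\<^sub>F F in finite_subsets_at_top B. norm ((\<Sum>b\<in>F. ip b x * ip y (T b)) - ip y (T x)) \<le> hnorm ip y * (C * hnorm ip (?r F))"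
      using * by (intro eventually_finite_subsets_at_top_weakI)
  qed simp
qed

lemma parseval:
  assumes B: "is_onb H ip B" and x: "x \<in> H" and y: "y \<in> H"
  shows "((\<lambda>b. ip b x * ip y b) has_sum ip y x) B"
    and "(\<lambda>b. norm (ip b x * ip y b)) summable_on B"
    and "(\<Sum>\<^sub>\<infinity>b\<in>B. norm (ip b x * ip y b)) \<le> hnorm ip x * hnorm ip y"
proof -
  have "bounded_op H H ip (\<lambda>x. x)"
    unfolding bounded_op_def linear_into_def by (auto intro!: exI[of _ 1])
  from bounded_op_expansion[OF B this x y] show "((\<lambda>b. ip b x * ip y b) has_sum ip y x) B" .
  have BH: "B \<subseteq> H" using onb_facts[OF B] by blast
  have bound: "(\<Sum>b\<in>F. norm (ip b x * ip y b)) \<le> hnorm ip x * hnorm ip y" if F: "finite F" "F \<subseteq> B" for F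
  proof -
    have FH: "F \<subseteq> H" "\<And>b b'. b \<in> F \<Longrightarrow> b' \<in> F \<Longrightarrow> ip b b' = (if b = b' then 1 else 0)"
      using F onb_facts[OF B] by blast+
    have L: "L2_set (\<lambda>b. cmod (ip b z)) F \<le> hnorm ip z" if "z \<in> H" for z
      unfolding L2_set_def using bessel[OF that F(1) FH] hnorm_nonneg[OF that] by (intro real_le_lsqrt) (auto simp: sum_nonneg)
    have "(\<Sum>b\<in>F. norm (ip b x * ip y b)) = (\<Sum>b\<in>F. \<bar>cmod (ip b x)\<bar> * \<bar>cmod (ip b y)\<bar>)"
    proof (intro sum.cong refl)
      fix b assume "b \<in> F"
      then have "b \<in> H" using FH(1) by blast
      then show "norm (ip b x * ip y b) = \<bar>cmod (ip b x)\<bar> * \<bar>cmod (ip b y)\<bar>"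
        using ip_sym[OF _ y, of b] by (simp add: norm_mult)
    qed
    also have "\<dots> \<le> L2_set (\<lambda>b. cmod (ip b x)) F * L2_set (\<lambda>b. cmod (ip b y)) F"
      by (rule L2_set_mult_ineq)
    also have "\<dots> \<le> hnorm ip x * hnorm ip y"
      using L x y hnorm_nonneg by (intro mult_mono) auto
    finally show ?thesis .
  qed
  show s: "(\<lambda>b. norm (ip b x * ip y b)) summable_on B"
    using bound by (intro nonneg_bounded_partial_sums_imp_summable_on[where C = "hnorm ip x * hnorm ip y"] eventually_finite_subsets_at_top_weakI) auto
  show "(\<Sum>\<^sub>\<infinity>b\<in>B. norm (ip b x * ip y b)) \<le> hnorm ip x * hnorm ip y"
    using s bound by (rule infsum_le_finite_sums)
qed

lemma hnorm_onb: "is_onb H ip B \<Longrightarrow> b \<in> B \<Longrightarrow> hnorm ip b = 1"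
  using onb_facts(2)[of B b b] by (simp add: hnorm_def)

text \<open>Independence of the basis by Fubini. Parseval in B bounds the absolute row sum at e by
  the norm of T e, so the double series converges absolutely and may be summed in either
  order.\<close>

theorem has_op_trace_onb:
  assumes E: "is_onb H ip E" and T: "bounded_op H H ip T" and s: "(\<lambda>e. hnorm ip (T e)) summable_on E"
  shows "has_op_trace H ip T (\<Sum>\<^sub>\<infinity>e\<in>E. ip e (T e))"
  unfolding has_op_trace_def
proof (intro conjI allI impI T)
  fix B assume B: "is_onb H ip B"
  have EH: "E \<subseteq> H" and BH: "B \<subseteq> H" using onb_facts E B by blast+
  have TH: "T z \<in> H" if "z \<in> H" for z using T that unfolding bounded_op_def linear_into_def by blast
  \<comment> \<open>Summing over b gives \<open>ip e (T e)\<close>, and summing over e gives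
    \<open>ip b (T b)\<close>.\<close>
  define f where "f = (\<lambda>(e, b). ip b (T e) * ip e b)"
  have row: "((\<lambda>b. f (e, b)) has_sum ip e (T e)) B" "(\<lambda>b. norm (f (e, b))) summable_on B"
    "(\<Sum>\<^sub>\<infinity>b\<in>B. norm (f (e, b))) \<le> hnorm ip (T e)" if "e \<in> E" for e
    using parseval[OF B, of "T e" e] that EH TH hnorm_onb[OF E that] by (auto simp: f_def)
  have "(\<lambda>e. norm (\<Sum>\<^sub>\<infinity>b\<in>B. norm (f (e, b)))) summable_on E"
  proof (rule summable_on_comparison_test[OF s])
    fix e assume "e \<in> E"
    moreover have "0 \<le> (\<Sum>\<^sub>\<infinity>b\<in>B. norm (f (e, b)))" by (rule infsum_nonneg) simp
    ultimately show "norm (\<Sum>\<^sub>\<infinity>b\<in>B. norm (f (e, b))) \<le> hnorm ip (T e)" using row(3) by simp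
  qed simp
  then have "(\<lambda>x. norm (f x)) summable_on E \<times> B"
    using row(2) by (subst Infinite_Sum.abs_summable_on_Sigma_iff) auto
  then have "f summable_on E \<times> B" by (rule abs_summable_summable)
  then obtain t where t: "(f has_sum t) (E \<times> B)" by (auto simp: summable_on_def)
  have "((\<lambda>e. ip e (T e)) has_sum t) E"
    using t row(1) by (rule has_sum_SigmaD)
  then have teq: "(\<Sum>\<^sub>\<infinity>e\<in>E. ip e (T e)) = t" by (rule infsumI)
  have "((\<lambda>(b, e). f (e, b)) has_sum t) (B \<times> E)" using t has_sum_swap by blast
  then show "((\<lambda>b. ip b (T b)) has_sum (\<Sum>\<^sub>\<infinity>e\<in>E. ip e (T e))) B"
    unfolding teq
  proof (rule has_sum_SigmaD)
    fix b assume b: "b \<in> B"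
    show "((\<lambda>e. case (b, e) of (b, e) \<Rightarrow> f (e, b)) has_sum ip b (T b)) E"
      using bounded_op_expansion[OF E T, of b b] b BH by (auto simp: f_def mult.commute)
  qed
qed

lemma op_trace_onb:
  assumes E: "is_onb H ip E" and t: "has_op_trace H ip T t"
  shows "op_trace H ip T = t"
  unfolding op_trace_def using E t has_sum_unique unfolding has_op_trace_def by (intro the_equality) blast+

end

section \<open>The Hilbert space \<open>H_sum\<close>\<close>

text \<open>Regroups an unconditional sum into finite levels; it turns sums over words or basis
  indices into ordinary series in n.\<close>

lemma sums_levels:
  fixes f :: "'a \<Rightarrow> 'b::banach" and lev :: "'a \<Rightarrow> nat"
  assumes fin: "\<And>n. finite {x \<in> A. lev x = n}" and s: "f summable_on A"
  shows "(\<lambda>n. \<Sum>x\<in>{x \<in> A. lev x = n}. f x) sums infsum f A"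
proof -
  let ?L = "\<lambda>n. {x \<in> A. lev x = n}"
  have bij: "bij_betw snd (Sigma UNIV ?L) A"
    by (rule bij_betwI[where g = "\<lambda>x. (lev x, x)"]) auto
  have "((\<lambda>p. f (snd p)) has_sum infsum f A) (Sigma UNIV ?L)"
    using has_sum_reindex_bij_betw[OF bij, of f] s by simp
  then have "((\<lambda>n. \<Sum>x\<in>?L n. f x) has_sum infsum f A) UNIV"
    by (rule has_sum_SigmaD) (use fin in \<open>simp add: has_sum_finite\<close>)
  then show "(\<lambda>n. \<Sum>x\<in>?L n. f x) sums infsum f A" by (rule has_sum_imp_sums)
qed

text \<open>Tonelli for the partition into levels.\<close>

lemma abs_summable_levels:
  fixes f :: "'a \<Rightarrow> 'b::banach" and lev :: "'a \<Rightarrow> nat"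
  assumes fin: "\<And>n. finite {x \<in> A. lev x = n}"
    and s: "summable (\<lambda>n. \<Sum>x\<in>{x \<in> A. lev x = n}. norm (f x))"
  shows "(\<lambda>x. norm (f x)) summable_on A"
proof -
  let ?L = "\<lambda>n. {x \<in> A. lev x = n}"
  have bij: "bij_betw snd (Sigma UNIV ?L) A"
    by (rule bij_betwI[where g = "\<lambda>x. (lev x, x)"]) auto
  have "(\<lambda>p. norm (f (snd p))) summable_on Sigma UNIV ?L"
  proof (rule summable_on_SigmaI)
    show "((\<lambda>y. norm (f (snd (n, y)))) has_sum (\<Sum>x\<in>?L n. norm (f x))) (?L n)" for n
      using fin by (simp add: has_sum_finite)
    show "(\<lambda>n. \<Sum>x\<in>?L n. norm (f x)) summable_on UNIV"
      using s by (subst summable_on_UNIV_nonneg_real_iff) (auto simp: sum_nonneg)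
  qed simp
  then show ?thesis
    using summable_on_reindex_bij_betw[OF bij, of "\<lambda>x. norm (f x)"] by simp
qed

lemma words_level: "{w \<in> (UNIV :: 3 list set). length w = n} = words n"
  by (auto simp: words_def)

section \<open>Norms computed level by level\<close>

definition mnorm2 :: "complex^3^3 \<Rightarrow> real" where
  "mnorm2 x = (\<Sum>i\<in>UNIV. \<Sum>j\<in>UNIV. (cmod (x $ i $ j))\<^sup>2)"

definition lnorm2 :: "nat \<Rightarrow> hvec \<Rightarrow> real" where
  "lnorm2 n \<xi> = (\<Sum>w\<in>words n. mnorm2 (\<xi> w))"

lemma mat_scaleC [simp]: "(c *\<^sub>C x) $ i $ j = c * (x :: complex^3^3) $ i $ j"
  by (simp add: scaleC_vec_def scaleC_complex_def)

lemma hvec_scaleC [simp]: "(c *\<^sub>C \<xi>) w = c *\<^sub>C (\<xi> :: hvec) w"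
  by (simp add: scaleC_fun_def)

lemma hs_inner_eq: "hs_inner x y = (\<Sum>i\<in>UNIV. \<Sum>j\<in>UNIV. cnj (x $ i $ j) * y $ i $ j)"
  unfolding hs_inner_def trace_def matrix_matrix_mult_def by (simp, rule sum.swap)

lemma mnorm2_nonneg: "0 \<le> mnorm2 x"
  by (simp add: mnorm2_def sum_nonneg)

lemma lnorm2_nonneg: "0 \<le> lnorm2 n \<xi>"
  by (simp add: lnorm2_def mnorm2_nonneg sum_nonneg)

lemma hs_inner_self: "hs_inner x x = complex_of_real (mnorm2 x)"
  by (simp add: hs_inner_eq mnorm2_def complex_norm_square mult.commute del: of_real_power)

lemma mnorm2_zero_iff: "mnorm2 x = 0 \<longleftrightarrow> x = 0"
  by (simp add: mnorm2_def sum_nonneg_eq_0_iff sum_nonneg vec_eq_iff)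

lemma mnorm2_zero [simp]: "mnorm2 0 = 0"
  by (simp add: mnorm2_zero_iff)

lemma cmod_entry_le: "(cmod (x $ i $ j))\<^sup>2 \<le> mnorm2 x"
proof -
  have "(cmod (x $ i $ j))\<^sup>2 \<le> (\<Sum>j\<in>UNIV. (cmod (x $ i $ j))\<^sup>2)"
    by (rule member_le_sum) auto
  also have "\<dots> \<le> mnorm2 x"
    unfolding mnorm2_def by (rule member_le_sum[where f = "\<lambda>i. \<Sum>j\<in>UNIV. (cmod (x $ i $ j))\<^sup>2"]) (auto simp: sum_nonneg)
  finally show ?thesis .
qed

lemma cmod_hs_inner_le: "cmod (hs_inner x y) \<le> (mnorm2 x + mnorm2 y) / 2"
proof -
  have *: "cmod (cnj a * b) \<le> ((cmod a)\<^sup>2 + (cmod b)\<^sup>2) / 2" for a b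
    using sum_squares_bound[of "cmod a" "cmod b"] by (simp add: norm_mult)
  have "cmod (hs_inner x y) \<le> (\<Sum>i\<in>UNIV. \<Sum>j\<in>UNIV. ((cmod (x $ i $ j))\<^sup>2 + (cmod (y $ i $ j))\<^sup>2) / 2)"
    unfolding hs_inner_eq by (intro order_trans[OF norm_sum] sum_mono *)
  then show ?thesis by (simp add: mnorm2_def sum.distrib flip: sum_divide_distrib)
qed

lemma mnorm2_add_le: "mnorm2 (x + y) \<le> 2 * mnorm2 x + 2 * mnorm2 y"
proof -
  have *: "(cmod (a + b))\<^sup>2 \<le> 2 * (cmod a)\<^sup>2 + 2 * (cmod b)\<^sup>2" for a b
  proof -
    have "(cmod (a + b))\<^sup>2 \<le> (cmod a + cmod b)\<^sup>2" by (intro power_mono norm_triangle_ineq) auto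
    also have "\<dots> \<le> 2 * (cmod a)\<^sup>2 + 2 * (cmod b)\<^sup>2"
      using sum_squares_bound[of "cmod a" "cmod b"] by (simp add: power2_sum)
    finally show ?thesis .
  qed
  have "mnorm2 (x + y) \<le> (\<Sum>i\<in>UNIV. \<Sum>j\<in>UNIV. 2 * (cmod (x $ i $ j))\<^sup>2 + 2 * (cmod (y $ i $ j))\<^sup>2)"
    unfolding mnorm2_def by (intro sum_mono) (simp add: *)
  then show ?thesis by (simp add: mnorm2_def sum.distrib sum_distrib_left)
qed

lemma mnorm2_scaleC: "mnorm2 (c *\<^sub>C x) = (cmod c)\<^sup>2 * mnorm2 x"
  by (simp add: mnorm2_def norm_mult power_mult_distrib sum_distrib_left)

lemma mnorm2_transpose: "mnorm2 (transpose x) = mnorm2 x"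
  unfolding mnorm2_def transpose_def by (simp, rule sum.swap)

lemma lnorm2_add_le: "lnorm2 n (\<xi> + \<eta>) \<le> 2 * lnorm2 n \<xi> + 2 * lnorm2 n \<eta>"
  unfolding lnorm2_def plus_fun_apply sum_distrib_left sum.distrib[symmetric]
  by (intro sum_mono mnorm2_add_le)

lemma lnorm2_scaleC: "lnorm2 n (c *\<^sub>C \<xi>) = (cmod c)\<^sup>2 * lnorm2 n \<xi>"
  by (simp add: lnorm2_def mnorm2_scaleC sum_distrib_left)

lemma mnorm2_le_lnorm2: "mnorm2 (\<xi> w) \<le> lnorm2 (length w) \<xi>"
  unfolding lnorm2_def by (rule member_le_sum[OF _ _ finite_words]) (simp_all add: words_def mnorm2_nonneg)

lemma offdiag_zero: "0 \<in> offdiag"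
  and offdiag_add: "x \<in> offdiag \<Longrightarrow> y \<in> offdiag \<Longrightarrow> x + y \<in> offdiag"
  and offdiag_scaleC: "x \<in> offdiag \<Longrightarrow> c *\<^sub>C x \<in> offdiag"
  and offdiag_transpose: "x \<in> offdiag \<Longrightarrow> transpose x \<in> offdiag"
  by (auto simp: offdiag_def transpose_def)

lemma hnorm_level: "(hnorm inner_H (level n \<xi>))\<^sup>2 = lnorm2 n \<xi>"
proof -
  have "inner_H (level n \<xi>) (level n \<xi>) = (\<Sum>\<^sub>\<infinity>w\<in>words n. complex_of_real (mnorm2 (\<xi> w)))"
    unfolding inner_H_def
    by (intro infsum_cong_neutral) (auto simp: level_def hs_inner_self)
  also have "\<dots> = complex_of_real (lnorm2 n \<xi>)" by (simp add: lnorm2_def)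
  finally show ?thesis by (simp add: hnorm_def lnorm2_nonneg)
qed

lemma H_sum_iff: "\<xi> \<in> H_sum \<longleftrightarrow> (\<forall>w. \<xi> w \<in> offdiag) \<and> summable (\<lambda>n. lnorm2 n \<xi>)"
proof -
  have "(\<forall>n. level n \<xi> \<in> H_level n) \<longleftrightarrow> (\<forall>w. \<xi> w \<in> offdiag)"
  proof safe
    fix w assume "\<forall>n. level n \<xi> \<in> H_level n"
    then have "level (length w) \<xi> w \<in> offdiag" unfolding H_level_def by blast
    then show "\<xi> w \<in> offdiag" by (simp add: level_def words_def)
  qed (simp add: H_level_def level_def offdiag_zero)
  then show ?thesis by (simp add: H_sum_def hnorm_level)
qed

lemma H_sumD: "\<xi> \<in> H_sum \<Longrightarrow> \<xi> w \<in> offdiag" "\<xi> \<in> H_sum \<Longrightarrow> summable (\<lambda>n. lnorm2 n \<xi>)"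
  by (auto simp: H_sum_iff)

text \<open>The scalar bound |xy| \<le> (x^2 + y^2) / 2 makes the level sums absolutely summable,
  which the unconditional sum in \<open>inner_H\<close> requires.\<close>

lemma inner_H_sums:
  assumes "\<xi> \<in> H_sum" "\<eta> \<in> H_sum"
  shows "(\<lambda>w. hs_inner (\<xi> w) (\<eta> w)) summable_on UNIV"
    and "(\<lambda>n. \<Sum>w\<in>words n. hs_inner (\<xi> w) (\<eta> w)) sums inner_H \<xi> \<eta>"
proof -
  have s: "summable (\<lambda>n. (lnorm2 n \<xi> + lnorm2 n \<eta>) / 2)"
    using assms by (intro summable_divide summable_add H_sumD)
  have "summable (\<lambda>n. \<Sum>w\<in>words n. norm (hs_inner (\<xi> w) (\<eta> w)))"
  proof (rule summable_comparison_test'[OF s, of 0])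
    fix n
    have "(\<Sum>w\<in>words n. norm (hs_inner (\<xi> w) (\<eta> w))) \<le> (\<Sum>w\<in>words n. (mnorm2 (\<xi> w) + mnorm2 (\<eta> w)) / 2)"
      by (intro sum_mono cmod_hs_inner_le)
    also have "\<dots> = (lnorm2 n \<xi> + lnorm2 n \<eta>) / 2"
      by (simp add: lnorm2_def sum.distrib flip: sum_divide_distrib)
    finally show "norm (\<Sum>w\<in>words n. norm (hs_inner (\<xi> w) (\<eta> w))) \<le> (lnorm2 n \<xi> + lnorm2 n \<eta>) / 2"
      by (simp add: sum_nonneg)
  qed
  then have s2: "summable (\<lambda>n. \<Sum>w\<in>{w \<in> (UNIV :: 3 list set). length w = n}. norm (hs_inner (\<xi> w) (\<eta> w)))"
    unfolding words_level .
  have fin: "finite {w \<in> (UNIV :: 3 list set). length w = n}" for n unfolding words_level by simp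
  show "(\<lambda>w. hs_inner (\<xi> w) (\<eta> w)) summable_on UNIV"
    using abs_summable_levels[OF fin s2] by (rule abs_summable_summable)
  from sums_levels[OF fin this] show "(\<lambda>n. \<Sum>w\<in>words n. hs_inner (\<xi> w) (\<eta> w)) sums inner_H \<xi> \<eta>"
    unfolding words_level inner_H_def .
qed

lemma inner_H_self:
  assumes "\<xi> \<in> H_sum" shows "inner_H \<xi> \<xi> = complex_of_real (\<Sum>n. lnorm2 n \<xi>)"
proof -
  have "(\<lambda>n. complex_of_real (lnorm2 n \<xi>)) sums inner_H \<xi> \<xi>"
    using inner_H_sums(2)[OF assms assms] by (simp add: hs_inner_self lnorm2_def)
  moreover have "(\<lambda>n. complex_of_real (lnorm2 n \<xi>)) sums complex_of_real (\<Sum>n. lnorm2 n \<xi>)"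
    using H_sumD(2)[OF assms] by (intro sums_of_real summable_sums)
  ultimately show ?thesis by (rule sums_unique2)
qed

lemma hnorm_H_sum: "\<xi> \<in> H_sum \<Longrightarrow> hnorm inner_H \<xi> = sqrt (\<Sum>n. lnorm2 n \<xi>)"
  by (simp add: hnorm_def inner_H_self)

lemma hnorm_H_sum_sq: "\<xi> \<in> H_sum \<Longrightarrow> (hnorm inner_H \<xi>)\<^sup>2 = (\<Sum>n. lnorm2 n \<xi>)"
  by (simp add: hnorm_H_sum suminf_nonneg lnorm2_nonneg H_sumD)

lemma hnorm_H_sum_nonneg: "\<xi> \<in> H_sum \<Longrightarrow> 0 \<le> hnorm inner_H \<xi>"
  by (simp add: hnorm_H_sum suminf_nonneg lnorm2_nonneg H_sumD)

lemma subspace_H_sum: "cvec.subspace H_sum"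
proof (rule cvec.subspaceI)
  show "0 \<in> H_sum"
    by (simp add: H_sum_iff lnorm2_def offdiag_zero)
  show "\<xi> + \<eta> \<in> H_sum" if "\<xi> \<in> H_sum" "\<eta> \<in> H_sum" for \<xi> \<eta>
  proof -
    have s: "summable (\<lambda>n. 2 * lnorm2 n \<xi> + 2 * lnorm2 n \<eta>)"
      using that by (intro summable_add summable_mult H_sumD)
    have "summable (\<lambda>n. lnorm2 n (\<xi> + \<eta>))"
      by (rule summable_comparison_test'[OF s, of 0]) (use lnorm2_add_le lnorm2_nonneg in simp)
    then show ?thesis using that by (auto simp: H_sum_iff offdiag_add)
  qed
  show "c *\<^sub>C \<xi> \<in> H_sum" if "\<xi> \<in> H_sum" for c \<xi>
    using that by (auto simp: H_sum_iff offdiag_scaleC lnorm2_scaleC intro: summable_mult)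
qed

lemma H_sum_diff: "\<xi> \<in> H_sum \<Longrightarrow> \<eta> \<in> H_sum \<Longrightarrow> \<xi> - \<eta> \<in> H_sum"
  by (rule cvec.subspace_diff[OF subspace_H_sum])

lemma cmod_entry_le_hnorm:
  assumes "\<xi> \<in> H_sum" shows "cmod (\<xi> w $ i $ j) \<le> hnorm inner_H \<xi>"
proof (rule power2_le_imp_le)
  have "(cmod (\<xi> w $ i $ j))\<^sup>2 \<le> lnorm2 (length w) \<xi>"
    using cmod_entry_le mnorm2_le_lnorm2 order_trans by blast
  also have "\<dots> \<le> (\<Sum>n. lnorm2 n \<xi>)"
    using sum_le_suminf[OF H_sumD(2)[OF assms], of "{length w}"] by (simp add: lnorm2_nonneg)
  finally show "(cmod (\<xi> w $ i $ j))\<^sup>2 \<le> (hnorm inner_H \<xi>)\<^sup>2" by (simp add: hnorm_H_sum_sq assms)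
  show "0 \<le> hnorm inner_H \<xi>" using assms by (simp add: hnorm_H_sum suminf_nonneg lnorm2_nonneg H_sumD)
qed

lemma lnorm2_tendsto:
  assumes "\<And>w i j. (\<lambda>k. X k w $ i $ j) \<longlonglongrightarrow> L w $ i $ j"
  shows "(\<lambda>k. lnorm2 n (X k)) \<longlonglongrightarrow> lnorm2 n L"
  unfolding lnorm2_def mnorm2_def by (intro tendsto_intros assms)

lemma offdiag_limit:
  assumes "\<And>w i j. (\<lambda>k. X k w $ i $ j) \<longlonglongrightarrow> L w $ i $ j" "\<And>k w. X k w \<in> offdiag"
  shows "L w \<in> offdiag"
  unfolding offdiag_def
proof (intro CollectI allI)
  fix j
  have "(\<lambda>k. X k w $ j $ j) = (\<lambda>k. 0)" using assms(2) by (auto simp: offdiag_def)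
  then show "L w $ j $ j = 0" using assms(1)[of w j j] by (simp add: LIMSEQ_const_iff)
qed

text \<open>Fatou's lemma: a partial sum of the squared norm involves finitely many entries, so a
  uniform bound survives entrywise limits. It serves both completeness and the compactness of the
  resolvent.\<close>

lemma H_sum_limit:
  assumes X: "\<And>k. X k \<in> H_sum" "\<And>k. hnorm inner_H (X k) \<le> e" and lim: "\<And>w i j. (\<lambda>k. X k w $ i $ j) \<longlonglongrightarrow> L w $ i $ j"
  shows "L \<in> H_sum" "hnorm inner_H L \<le> e"
proof -
  have e: "0 \<le> e"
    using order_trans[OF hnorm_H_sum_nonneg[OF X(1)] X(2)] .
  have *: "(\<Sum>n<M. lnorm2 n L) \<le> e\<^sup>2" for M
  proof (rule LIMSEQ_le_const2)
    show "(\<lambda>k. \<Sum>n<M. lnorm2 n (X k)) \<longlonglongrightarrow> (\<Sum>n<M. lnorm2 n L)"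
      by (intro tendsto_intros lnorm2_tendsto lim)
    have "(\<Sum>n<M. lnorm2 n (X k)) \<le> e\<^sup>2" for k
    proof -
      have "(\<Sum>n<M. lnorm2 n (X k)) \<le> (\<Sum>n. lnorm2 n (X k))"
        by (intro sum_le_suminf H_sumD X) (auto simp: lnorm2_nonneg)
      also have "\<dots> \<le> e\<^sup>2"
        unfolding hnorm_H_sum_sq[OF X(1), symmetric]
        using X(2) X(1) by (intro power_mono) (auto simp: hnorm_H_sum suminf_nonneg lnorm2_nonneg H_sumD)
      finally show ?thesis .
    qed
    then show "\<exists>N. \<forall>k\<ge>N. (\<Sum>n<M. lnorm2 n (X k)) \<le> e\<^sup>2" by blast
  qed
  have s: "summable (\<lambda>n. lnorm2 n L)"
    using * by (intro summableI_nonneg_bounded[where x = "e\<^sup>2"]) (auto simp: lnorm2_nonneg)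
  then show L: "L \<in> H_sum" using offdiag_limit[OF lim] X(1) by (auto simp: H_sum_iff)
  have "(\<Sum>n. lnorm2 n L) \<le> e\<^sup>2" using s * by (rule suminf_le_const)
  then show "hnorm inner_H L \<le> e" using e by (simp add: hnorm_H_sum[OF L] real_le_lsqrt suminf_nonneg s lnorm2_nonneg)
qed

interpretation hsum: inner_space H_sum inner_H
proof (unfold_locales, rule subspace_H_sum)
  fix \<xi> \<eta> \<zeta> and c :: complex assume H: "\<xi> \<in> H_sum" "\<eta> \<in> H_sum"
  have "hs_inner x (y + z) = hs_inner x y + hs_inner x z" for x y z
    by (simp add: hs_inner_eq algebra_simps sum.distrib)
  then show "inner_H \<xi> (\<eta> + \<zeta>) = inner_H \<xi> \<eta> + inner_H \<xi> \<zeta>" if "\<zeta> \<in> H_sum"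
    unfolding inner_H_def using inner_H_sums(1)[OF H] inner_H_sums(1)[OF H(1) that] by (simp add: infsum_add)
  have "hs_inner x (c *\<^sub>C y) = c * hs_inner x y" for x y
    by (simp add: hs_inner_eq algebra_simps sum_distrib_left)
  then show "inner_H \<xi> (c *\<^sub>C \<eta>) = c * inner_H \<xi> \<eta>"
    unfolding inner_H_def by (simp add: infsum_cmult_right')
  have "hs_inner y x = cnj (hs_inner x y)" for x y
    by (simp add: hs_inner_eq mult.commute)
  then show "inner_H \<eta> \<xi> = cnj (inner_H \<xi> \<eta>)"
    unfolding inner_H_def by (metis (no_types, lifting) infsum_cnj infsum_cong)
next
  fix \<xi> assume \<xi>: "\<xi> \<in> H_sum"
  show "0 \<le> Re (inner_H \<xi> \<xi>)"
    using H_sumD(2)[OF \<xi>] by (simp add: inner_H_self[OF \<xi>] suminf_nonneg lnorm2_nonneg)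
  assume "inner_H \<xi> \<xi> = 0"
  then have "hnorm inner_H \<xi> = 0" by (simp add: hnorm_def)
  then have "\<xi> w $ i $ j = 0" for w i j using cmod_entry_le_hnorm[OF \<xi>, of w i j] by simp
  then show "\<xi> = 0" by (simp add: fun_eq_iff vec_eq_iff)
qed

lemma hilbert_space_H_sum: "hilbert_space H_sum inner_H"
  unfolding hilbert_space_def
proof (intro conjI ballI allI impI hsum.subspace_H hsum.ip_add_right hsum.ip_scale_right hsum.ip_nonneg)
  show "inner_H \<eta> \<xi> = cnj (inner_H \<xi> \<eta>)" if "\<xi> \<in> H_sum" "\<eta> \<in> H_sum" for \<xi> \<eta>
    by (rule hsum.ip_sym[OF that])
  show "\<xi> = 0" if "\<xi> \<in> H_sum" "inner_H \<xi> \<xi> = 0" for \<xi>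
    by (rule hsum.ip_self_zero[OF that])
  fix X assume X: "(\<forall>k::nat. X k \<in> H_sum) \<and> (\<forall>e>0. \<exists>N. \<forall>k\<ge>N. \<forall>l\<ge>N. hnorm inner_H (X k - X l) < e)"
  have "Cauchy (\<lambda>k. X k w $ i $ j)" for w i j
  proof (rule metric_CauchyI)
    fix e :: real assume "e > 0"
    then obtain N where N: "\<And>k l. N \<le> k \<Longrightarrow> N \<le> l \<Longrightarrow> hnorm inner_H (X k - X l) < e" using X by blast
    have "dist (X k w $ i $ j) (X l w $ i $ j) < e" if "N \<le> k" "N \<le> l" for k l
      using cmod_entry_le_hnorm[OF H_sum_diff, of "X k" "X l" w i j] X N[OF that] by (simp add: dist_norm)
    then show "\<exists>M. \<forall>m\<ge>M. \<forall>n\<ge>M. dist (X m w $ i $ j) (X n w $ i $ j) < e" by blast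
  qed
  then have conv: "convergent (\<lambda>k. X k w $ i $ j)" for w i j by (simp add: Cauchy_convergent_iff)
  define L :: hvec where "L w = (\<chi> i j. lim (\<lambda>k. X k w $ i $ j))" for w
  have lim: "(\<lambda>k. X k w $ i $ j) \<longlonglongrightarrow> L w $ i $ j" for w i j
    using conv[of w i j] by (simp add: L_def convergent_LIMSEQ_iff)
  have close: "\<exists>N. \<forall>k\<ge>N. X k - L \<in> H_sum \<and> hnorm inner_H (X k - L) \<le> e" if "e > 0" for e
  proof -
    obtain N where N: "\<And>k l. N \<le> k \<Longrightarrow> N \<le> l \<Longrightarrow> hnorm inner_H (X k - X l) < e" using X \<open>e > 0\<close> by blast
    have "X k - L \<in> H_sum \<and> hnorm inner_H (X k - L) \<le> e" if "N \<le> k" for k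
    proof -
      \<comment> \<open>Letting l tend to infinity in the Cauchy estimate bounds X k - L, although L
        is only an entrywise limit so far.\<close>
      have "(\<lambda>l. (X k - X (l + N)) w $ i $ j) \<longlonglongrightarrow> (X k - L) w $ i $ j" for w i j
        using tendsto_diff[OF tendsto_const LIMSEQ_ignore_initial_segment[OF lim]] by simp
      moreover have "X k - X (l + N) \<in> H_sum" "hnorm inner_H (X k - X (l + N)) \<le> e" for l
        using X N[OF that, of "l + N"] by (auto intro: H_sum_diff)
      ultimately show ?thesis using H_sum_limit[of "\<lambda>l. X k - X (l + N)" e "X k - L"] by blast
    qed
    then show ?thesis by blast
  qed
  show "\<exists>L\<in>H_sum. (\<lambda>k. hnorm inner_H (X k - L)) \<longlonglongrightarrow> 0"
  proof (rule bexI)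
    show "(\<lambda>k. hnorm inner_H (X k - L)) \<longlonglongrightarrow> 0"
    proof (rule LIMSEQ_I)
      fix e :: real assume "e > 0"
      then obtain N where "\<And>k. N \<le> k \<Longrightarrow> X k - L \<in> H_sum \<and> hnorm inner_H (X k - L) \<le> e / 2"
        using close[of "e / 2"] by auto
      then have "norm (hnorm inner_H (X k - L) - 0) < e" if "N \<le> k" for k
        \<comment> \<open>The entry bound supplies the nonnegativity of the norm.\<close>
        using that \<open>e > 0\<close> cmod_entry_le_hnorm[of "X k - L" "[]" 1 1] norm_ge_zero[of "(X k - L) [] $ 1 $ 1"]
        by (smt (verit) diff_zero field_sum_of_halves real_norm_def)
      then show "\<exists>no. \<forall>k\<ge>no. norm (hnorm inner_H (X k - L) - 0) < e" by blast
    qed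
    obtain k where k: "X k - L \<in> H_sum" using close[of 1] by auto
    have "X k \<in> H_sum" using X by blast
    from H_sum_diff[OF this k] show "L \<in> H_sum" by (simp only: diff_diff_eq2 add_diff_cancel_left')
  qed
qed

lemma H_level_subset: "H_level n \<subseteq> H_sum"
proof
  fix \<xi> assume \<xi>: "\<xi> \<in> H_level n"
  have "lnorm2 m \<xi> = 0" if "m \<noteq> n" for m
    unfolding lnorm2_def using \<xi> that by (intro sum.neutral) (auto simp: H_level_def words_def)
  then have "summable (\<lambda>m. lnorm2 m \<xi>)" by (intro summable_finite[of "{n}"]) auto
  then show "\<xi> \<in> H_sum" using \<xi> by (simp add: H_sum_iff H_level_def)
qed

interpretation hlevel: inner_space "H_level n" inner_H for n
proof unfold_locales
  show "cvec.subspace (H_level n)"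
    by (rule cvec.subspaceI) (auto simp: H_level_def offdiag_zero offdiag_add offdiag_scaleC cvec.scale_zero_right)
  fix \<xi> \<eta> \<zeta> c assume "\<xi> \<in> H_level n"
  then have \<xi>: "\<xi> \<in> H_sum" using H_level_subset by blast
  show "0 \<le> Re (inner_H \<xi> \<xi>)" by (rule hsum.ip_nonneg[OF \<xi>])
  show "\<xi> = 0" if "inner_H \<xi> \<xi> = 0" by (rule hsum.ip_self_zero[OF \<xi> that])
  assume "\<eta> \<in> H_level n"
  then have \<eta>: "\<eta> \<in> H_sum" using H_level_subset by blast
  show "inner_H \<xi> (c *\<^sub>C \<eta>) = c * inner_H \<xi> \<eta>" by (rule hsum.ip_scale_right[OF \<xi> \<eta>])
  show "inner_H \<eta> \<xi> = cnj (inner_H \<xi> \<eta>)" by (rule hsum.ip_sym[OF \<xi> \<eta>])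
  assume "\<zeta> \<in> H_level n"
  then show "inner_H \<xi> (\<eta> + \<zeta>) = inner_H \<xi> \<eta> + inner_H \<xi> \<zeta>"
    using H_level_subset by (intro hsum.ip_add_right[OF \<xi> \<eta>]) blast
qed

text \<open>The operators below preserve the degree, so boundedness can be checked level by level
  with one constant for all n.\<close>

lemma H_sum_bounded:
  assumes \<xi>: "\<xi> \<in> H_sum" and \<eta>: "\<And>w. \<eta> w \<in> offdiag" "\<And>n. lnorm2 n \<eta> \<le> C\<^sup>2 * lnorm2 n \<xi>" and C: "0 \<le> C"
  shows "\<eta> \<in> H_sum" "hnorm inner_H \<eta> \<le> C * hnorm inner_H \<xi>"
proof -
  have s: "summable (\<lambda>n. C\<^sup>2 * lnorm2 n \<xi>)" using H_sumD(2)[OF \<xi>] by (rule summable_mult)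
  have s': "summable (\<lambda>n. lnorm2 n \<eta>)"
    by (rule summable_comparison_test'[OF s, of 0]) (use \<eta>(2) lnorm2_nonneg in simp)
  then show H: "\<eta> \<in> H_sum" using \<eta>(1) by (simp add: H_sum_iff)
  have "(\<Sum>n. lnorm2 n \<eta>) \<le> (\<Sum>n. C\<^sup>2 * lnorm2 n \<xi>)"
    using \<eta>(2) s' s by (rule suminf_le)
  also have "\<dots> = C\<^sup>2 * (\<Sum>n. lnorm2 n \<xi>)" by (rule suminf_mult[OF H_sumD(2)[OF \<xi>]])
  finally have "hnorm inner_H \<eta> \<le> sqrt (C\<^sup>2 * (\<Sum>n. lnorm2 n \<xi>))"
    by (simp add: hnorm_H_sum[OF H])
  then show "hnorm inner_H \<eta> \<le> C * hnorm inner_H \<xi>"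
    using C by (simp add: hnorm_H_sum[OF \<xi>] real_sqrt_mult)
qed

section \<open>Matrix units as an orthonormal basis\<close>

definition unit_index :: "(3 list \<times> 3 \<times> 3) set" where
  "unit_index = {(w, i, j). i \<noteq> j}"

text \<open>The vectors e_w \<otimes> e_ij; those with i \<noteq> j are the basis in which all
  traces are computed.\<close>

definition unit_vec :: "3 list \<times> 3 \<times> 3 \<Rightarrow> hvec" where
  "unit_vec = (\<lambda>(w, i, j) w'. \<chi> a b. if w' = w \<and> a = i \<and> b = j then 1 else 0)"

lemma unit_vec_entry: "unit_vec (w, i, j) w' $ a $ b = (if w' = w \<and> a = i \<and> b = j then 1 else 0)"
  by (simp add: unit_vec_def)

lemma unit_vec_H_level: "i \<noteq> j \<Longrightarrow> unit_vec (w, i, j) \<in> H_level (length w)"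
  by (auto simp: H_level_def offdiag_def unit_vec_entry words_def vec_eq_iff)

lemma unit_vec_H_sum: "p \<in> unit_index \<Longrightarrow> unit_vec p \<in> H_sum"
  using unit_vec_H_level H_level_subset by (cases p) (fastforce simp: unit_index_def)

lemma inner_unit_vec: "inner_H (unit_vec (w, i, j)) \<xi> = \<xi> w $ i $ j"
proof -
  have *: "hs_inner (unit_vec (w, i, j) w') x = (if w' = w then x $ i $ j else 0)" for w' x
  proof -
    have "cnj (unit_vec (w, i, j) w' $ a $ b) * x $ a $ b =
      (if a = i then if b = j then if w' = w then x $ i $ j else 0 else 0 else 0)" for a b
      by (simp add: unit_vec_entry)
    moreover have "(\<Sum>b\<in>UNIV. if a = i then if b = j then c else 0 else 0) = (if a = i then c else 0)"
      for a :: 3 and c :: complex by simp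
    ultimately show ?thesis by (simp add: hs_inner_eq)
  qed
  have "inner_H (unit_vec (w, i, j)) \<xi> = (\<Sum>\<^sub>\<infinity>w'\<in>{w}. \<xi> w $ i $ j)"
    unfolding inner_H_def * by (intro infsum_cong_neutral) auto
  then show ?thesis by simp
qed

lemma inj_unit_vec: "inj_on unit_vec unit_index"
proof (rule inj_onI)
  fix p q assume "p \<in> unit_index" "q \<in> unit_index" and eq: "unit_vec p = unit_vec q"
  obtain w i j w' i' j' where pq: "p = (w, i, j)" "q = (w', i', j')" by (metis prod_cases3)
  have "unit_vec (w, i, j) w $ i $ j = 1" by (simp add: unit_vec_entry)
  then have "unit_vec (w', i', j') w $ i $ j = 1" using eq by (simp only: pq)
  then have "w = w' \<and> i = i' \<and> j = j'" unfolding unit_vec_entry by (metis zero_neq_one)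
  then show "p = q" by (simp add: pq)
qed

definition level_index :: "nat \<Rightarrow> (3 list \<times> 3 \<times> 3) set" where
  "level_index n = {p \<in> unit_index. length (fst p) = n}"

lemma level_index_eq: "level_index n = words n \<times> {(i, j). i \<noteq> j}"
  by (auto simp: level_index_def unit_index_def words_def)

lemma finite_level_index: "finite (level_index n)"
  unfolding level_index_eq by (intro finite_cartesian_product) auto

text \<open>The dimension of level n: 3^n words times six off-diagonal matrix units.\<close>

lemma card_level_index: "card (level_index n) = 6 * 3 ^ n"
proof -
  have "{(i, j). i \<noteq> (j :: 3)} = Sigma UNIV (\<lambda>i. UNIV - {i})" by auto
  then have "card {(i, j). i \<noteq> (j :: 3)} = 6" by (simp add: card_SigmaI)
  then show ?thesis by (simp add: level_index_eq card_cartesian_product card_words)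
qed

lemma sum_level_index:
  "(\<Sum>(w, i, j)\<in>level_index n. f w i j) = (\<Sum>w\<in>words n. \<Sum>i\<in>UNIV. \<Sum>j\<in>UNIV - {i}. f w i j)"
proof -
  have "{(i, j). i \<noteq> (j :: 3)} = Sigma UNIV (\<lambda>i. UNIV - {i})" by auto
  then show ?thesis unfolding level_index_eq by (simp add: sum.Sigma split_def flip: sum.cartesian_product)
qed

lemma sum_hvec_entry: "(\<Sum>p\<in>P. f p) w $ i $ j = (\<Sum>p\<in>P. (f p :: hvec) w $ i $ j)"
  by (induction P rule: infinite_finite_induct) simp_all

lemma level_expansion:
  assumes "\<And>w. \<xi> w \<in> offdiag"
  shows "level n \<xi> = (\<Sum>(w, i, j)\<in>level_index n. (\<xi> w $ i $ j) *\<^sub>C unit_vec (w, i, j))"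
proof (rule ext, subst vec_eq_iff, intro allI, subst vec_eq_iff, intro allI)
  fix w :: "3 list" and i j :: 3
  have "(\<Sum>(w, i, j)\<in>level_index n. (\<xi> w $ i $ j) *\<^sub>C unit_vec (w, i, j)) w $ i $ j =
    (\<Sum>p\<in>level_index n. if p = (w, i, j) then \<xi> w $ i $ j else 0)"
    unfolding sum_hvec_entry by (intro sum.cong refl) (auto simp: unit_vec_entry split: if_splits)
  also have "\<dots> = level n \<xi> w $ i $ j"
    using assms[of w] finite_level_index by (auto simp: level_index_eq level_def offdiag_def)
  finally show "level n \<xi> w $ i $ j = (\<Sum>(w, i, j)\<in>level_index n. (\<xi> w $ i $ j) *\<^sub>C unit_vec (w, i, j)) w $ i $ j" ..
qed

lemma level_in_span:
  assumes "\<And>w. \<xi> w \<in> offdiag"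
  shows "level n \<xi> \<in> cvec.span (unit_vec ` level_index n)"
  unfolding level_expansion[OF assms]
proof (intro cvec.span_sum)
  fix p assume "p \<in> level_index n"
  then have "(case p of (w, i, j) \<Rightarrow> \<xi> w $ i $ j) *\<^sub>C unit_vec p \<in> cvec.span (unit_vec ` level_index n)"
    by (intro cvec.span_scale cvec.span_base imageI)
  then show "(case p of (w, i, j) \<Rightarrow> (\<xi> w $ i $ j) *\<^sub>C unit_vec (w, i, j)) \<in> cvec.span (unit_vec ` level_index n)"
    by (simp add: split_def)
qed

lemma unit_vec_orthonormal:
  assumes "b \<in> unit_vec ` unit_index" "b' \<in> unit_vec ` unit_index"
  shows "inner_H b b' = (if b = b' then 1 else 0)"
proof -
  obtain p q where pq: "p \<in> unit_index" "q \<in> unit_index" "b = unit_vec p" "b' = unit_vec q" using assms by auto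
  have "inner_H b b' = (if p = q then 1 else 0)"
    unfolding pq by (cases p; cases q) (auto simp: inner_unit_vec unit_vec_entry)
  moreover have "p = q \<longleftrightarrow> b = b'" using inj_unit_vec pq by (auto dest: inj_onD)
  ultimately show ?thesis by simp
qed

lemma onb_H_level: "is_onb (H_level n) inner_H (unit_vec ` level_index n)"
  unfolding is_onb_def dense_in_def
proof (intro conjI ballI allI impI)
  have sub: "unit_vec ` level_index n \<subseteq> H_level n"
    using unit_vec_H_level by (auto simp: level_index_def unit_index_def)
  then show "unit_vec ` level_index n \<subseteq> H_level n" .
  show "cvec.span (unit_vec ` level_index n) \<subseteq> H_level n"
    using cvec.span_minimal[OF sub hlevel.subspace_H] .
  show "inner_H b b' = (if b = b' then 1 else 0)" if "b \<in> unit_vec ` level_index n" "b' \<in> unit_vec ` level_index n" for b b'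
    using that by (intro unit_vec_orthonormal) (auto simp: level_index_def)
  fix \<xi> and e :: real assume \<xi>: "\<xi> \<in> H_level n" and e: "e > 0"
  have "level n \<xi> = \<xi>" using \<xi> by (auto simp: level_def H_level_def fun_eq_iff)
  then have "\<xi> \<in> cvec.span (unit_vec ` level_index n)" using level_in_span[of \<xi> n] \<xi> by (auto simp: H_level_def)
  moreover have "hnorm inner_H (\<xi> - \<xi>) < e" using e hlevel.ip_zero_right[OF hlevel.H_zero] by (simp add: hnorm_def)
  ultimately show "\<exists>\<eta>\<in>cvec.span (unit_vec ` level_index n). hnorm inner_H (\<xi> - \<eta>) < e" by blast
qed

definition trunc :: "nat \<Rightarrow> hvec \<Rightarrow> hvec" where
  "trunc M \<xi> w = (if length w < M then \<xi> w else 0)"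

lemma trunc_eq: "trunc M \<xi> = (\<Sum>n<M. level n \<xi>)"
proof (rule ext, subst vec_eq_iff, intro allI, subst vec_eq_iff, intro allI)
  fix w :: "3 list" and i j :: 3
  have "(\<Sum>n<M. level n \<xi>) w $ i $ j = (\<Sum>n<M. if n = length w then \<xi> w $ i $ j else 0)"
    unfolding sum_hvec_entry by (intro sum.cong refl) (auto simp: level_def words_def)
  then show "trunc M \<xi> w $ i $ j = (\<Sum>n<M. level n \<xi>) w $ i $ j" by (simp add: trunc_def)
qed

lemma lnorm2_trunc: "lnorm2 n (trunc M \<xi>) = (if n < M then lnorm2 n \<xi> else 0)"
  and lnorm2_diff_trunc: "lnorm2 n (\<xi> - trunc M \<xi>) = (if n < M then 0 else lnorm2 n \<xi>)"
  by (auto simp: lnorm2_def trunc_def words_def)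

lemma trunc_tendsto:
  assumes \<xi>: "\<xi> \<in> H_sum"
  shows "(\<lambda>M. hnorm inner_H (\<xi> - trunc M \<xi>)) \<longlonglongrightarrow> 0"
proof -
  have H: "trunc M \<xi> \<in> H_sum" for M
    using H_sum_bounded(1)[OF \<xi>, of "trunc M \<xi>" 1] H_sumD(1)[OF \<xi>]
    by (auto simp: lnorm2_trunc trunc_def offdiag_zero lnorm2_nonneg)
  have "hnorm inner_H (\<xi> - trunc M \<xi>) = sqrt (\<Sum>n. lnorm2 (n + M) \<xi>)" for M
  proof -
    have "(\<Sum>n. lnorm2 n (\<xi> - trunc M \<xi>)) = (\<Sum>n. lnorm2 (n + M) (\<xi> - trunc M \<xi>)) + (\<Sum>n<M. lnorm2 n (\<xi> - trunc M \<xi>))"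
      using H_sumD(2)[OF H_sum_diff[OF \<xi> H]] by (rule suminf_split_initial_segment)
    also have "\<dots> = (\<Sum>n. lnorm2 (n + M) \<xi>)" unfolding lnorm2_diff_trunc by simp
    finally show ?thesis by (simp add: hnorm_H_sum H_sum_diff \<xi> H)
  qed
  moreover have "(\<lambda>M. sqrt (\<Sum>n. lnorm2 (n + M) \<xi>)) \<longlonglongrightarrow> sqrt 0"
    by (intro tendsto_real_sqrt suminf_exist_split2 H_sumD \<xi>)
  ultimately show ?thesis by simp
qed

lemma trunc_in_span:
  assumes "\<And>w. \<xi> w \<in> offdiag"
  shows "trunc M \<xi> \<in> cvec.span (unit_vec ` unit_index)"
  unfolding trunc_eq
proof (intro cvec.span_sum)
  fix n
  have "unit_vec ` level_index n \<subseteq> unit_vec ` unit_index" by (auto simp: level_index_def)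
  then show "level n \<xi> \<in> cvec.span (unit_vec ` unit_index)"
    by (rule subsetD[OF cvec.span_mono level_in_span[OF assms]])
qed

lemma onb_H_sum: "is_onb H_sum inner_H (unit_vec ` unit_index)"
  unfolding is_onb_def dense_in_def
proof (intro conjI ballI allI impI unit_vec_orthonormal)
  show sub: "unit_vec ` unit_index \<subseteq> H_sum" using unit_vec_H_sum by auto
  show "cvec.span (unit_vec ` unit_index) \<subseteq> H_sum"
    using cvec.span_minimal[OF sub subspace_H_sum] .
  fix \<xi> and e :: real assume \<xi>: "\<xi> \<in> H_sum" and e: "e > 0"
  obtain M where "norm (hnorm inner_H (\<xi> - trunc M \<xi>) - 0) < e"
    using LIMSEQ_D[OF trunc_tendsto[OF \<xi>] e] by blast
  then have "hnorm inner_H (\<xi> - trunc M \<xi>) < e" by simp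
  then show "\<exists>\<eta>\<in>cvec.span (unit_vec ` unit_index). hnorm inner_H (\<xi> - \<eta>) < e"
    using trunc_in_span[of \<xi> M] H_sumD(1)[OF \<xi>] by blast
qed

section \<open>The operator \<open>D\<close>\<close>

lemma D_sum_apply: "D_sum \<xi> w = (2 ^ length w) *\<^sub>C transpose (\<xi> w)"
  unfolding D_sum_def op_sum_def D_level_def hvec_scaleC F_level_def by (simp add: level_def words_def)

lemma D_sum_entry: "D_sum \<xi> w $ i $ j = 2 ^ length w * \<xi> w $ j $ i"
  by (simp add: D_sum_apply transpose_def)

lemma hvec_eqI: "(\<And>w i j. \<xi> w $ i $ j = \<eta> w $ i $ j) \<Longrightarrow> \<xi> = (\<eta> :: hvec)"
  by (rule ext) (simp add: vec_eq_iff)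

lemma D_sum_add: "D_sum (\<xi> + \<eta>) = D_sum \<xi> + D_sum \<eta>"
  by (rule hvec_eqI) (simp add: D_sum_entry algebra_simps)

lemma D_sum_scaleC: "D_sum (c *\<^sub>C \<xi>) = c *\<^sub>C D_sum \<xi>"
  by (rule hvec_eqI) (simp add: D_sum_entry)

lemma lnorm2_D_sum: "lnorm2 n (D_sum \<xi>) = 4 ^ n * lnorm2 n \<xi>"
proof -
  have "mnorm2 (D_sum \<xi> w) = 4 ^ n * mnorm2 (\<xi> w)" if "w \<in> words n" for w
    using that by (simp add: D_sum_apply mnorm2_scaleC mnorm2_transpose words_def norm_power power2_eq_square flip: power_mult_distrib)
  then show ?thesis by (simp add: lnorm2_def sum_distrib_left)
qed

lemma D_sum_offdiag: "\<xi> w \<in> offdiag \<Longrightarrow> D_sum \<xi> w \<in> offdiag"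
  by (simp add: D_sum_apply offdiag_scaleC offdiag_transpose)

lemma D_domD: "\<xi> \<in> D_dom \<Longrightarrow> \<xi> \<in> H_sum" "\<xi> \<in> D_dom \<Longrightarrow> D_sum \<xi> \<in> H_sum"
  by (auto simp: D_dom_def)

lemma D_dom_finite_levels:
  assumes "\<xi> \<in> H_sum" "\<And>n. M \<le> n \<Longrightarrow> lnorm2 n \<xi> = 0" shows "\<xi> \<in> D_dom"
proof -
  have "summable (\<lambda>n. lnorm2 n (D_sum \<xi>))"
    using assms(2) by (intro summable_finite[of "{..<M}"]) (auto simp: lnorm2_D_sum not_less)
  then show ?thesis using assms(1) by (auto simp: D_dom_def H_sum_iff D_sum_offdiag)
qed

lemma lnorm2_H_level: "\<xi> \<in> H_level n \<Longrightarrow> m \<noteq> n \<Longrightarrow> lnorm2 m \<xi> = 0"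
  unfolding lnorm2_def by (intro sum.neutral) (auto simp: H_level_def words_def)

lemma H_level_D_dom: "\<xi> \<in> H_level n \<Longrightarrow> \<xi> \<in> D_dom"
  using H_level_subset lnorm2_H_level by (intro D_dom_finite_levels[of _ "Suc n"]) auto

lemma subspace_D_dom: "cvec.subspace D_dom"
proof (rule cvec.subspaceI)
  have "D_sum 0 = 0" using D_sum_scaleC[of 0 0] by (simp only: cvec.scale_zero_left)
  then show "0 \<in> D_dom" using hsum.H_zero by (simp only: D_dom_def mem_Collect_eq simp_thms)
qed (auto simp: D_dom_def D_sum_add D_sum_scaleC intro: hsum.H_add hsum.H_scale)

lemma hs_inner_transpose: "hs_inner (transpose x) y = hs_inner x (transpose y)"
  unfolding hs_inner_eq transpose_def by (simp, rule sum.swap)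

lemma D_sum_symmetric: "inner_H (D_sum \<xi>) \<eta> = inner_H \<xi> (D_sum \<eta>)"
proof -
  have "hs_inner ((2 ^ n) *\<^sub>C x) y = hs_inner x ((2 ^ n) *\<^sub>C y)" for n x y
    by (simp add: hs_inner_eq mult.left_commute mult.assoc)
  then have "hs_inner (D_sum \<xi> w) (\<eta> w) = hs_inner (\<xi> w) (D_sum \<eta> w)" for w
    by (simp add: D_sum_apply hs_inner_transpose transpose_def hs_inner_eq) (subst sum.swap, simp add: mult_ac)
  then show ?thesis by (simp add: inner_H_def)
qed

lemma trunc_D_dom: assumes "\<xi> \<in> H_sum" shows "trunc M \<xi> \<in> D_dom"
proof (rule D_dom_finite_levels[where M = M])
  show "trunc M \<xi> \<in> H_sum"
    using H_sum_bounded(1)[OF assms, of "trunc M \<xi>" 1] H_sumD(1)[OF assms]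
    by (auto simp: lnorm2_trunc trunc_def offdiag_zero lnorm2_nonneg)
qed (simp add: lnorm2_trunc)

lemma unit_vec_D_dom: "p \<in> unit_index \<Longrightarrow> unit_vec p \<in> D_dom"
  using unit_vec_H_level H_level_D_dom by (cases p) (fastforce simp: unit_index_def)

lemma offdiag_eqI:
  fixes \<xi> \<eta> :: hvec
  assumes "\<And>w. \<xi> w \<in> offdiag" "\<And>w. \<eta> w \<in> offdiag" "\<And>w i j. i \<noteq> j \<Longrightarrow> \<xi> w $ i $ j = \<eta> w $ i $ j"
  shows "\<xi> = \<eta>"
proof (rule hvec_eqI)
  fix w i j show "\<xi> w $ i $ j = \<eta> w $ i $ j"
    using assms(1)[of w] assms(2)[of w] assms(3)[of i j w] by (cases "i = j") (auto simp: offdiag_def)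
qed

lemma self_adjoint_D_sum: "self_adjoint H_sum inner_H D_dom D_sum"
  unfolding self_adjoint_def
proof (intro conjI ballI impI subspace_D_dom D_sum_symmetric)
  show "dense_in H_sum inner_H D_dom"
    unfolding dense_in_def
  proof (intro conjI ballI allI impI)
    show "D_dom \<subseteq> H_sum" by (auto simp: D_dom_def)
    fix \<xi> and e :: real assume \<xi>: "\<xi> \<in> H_sum" and e: "e > 0"
    obtain M where "norm (hnorm inner_H (\<xi> - trunc M \<xi>) - 0) < e"
      using LIMSEQ_D[OF trunc_tendsto[OF \<xi>] e] by blast
    then have "hnorm inner_H (\<xi> - trunc M \<xi>) < e" by simp
    then show "\<exists>\<eta>\<in>D_dom. hnorm inner_H (\<xi> - \<eta>) < e" using trunc_D_dom[OF \<xi>] by blast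
  qed
  show "linear_into D_dom H_sum D_sum"
    by (simp add: linear_into_def D_domD D_sum_add D_sum_scaleC)
  fix \<eta> assume \<eta>: "\<eta> \<in> H_sum" and "\<exists>\<zeta>\<in>H_sum. \<forall>\<xi>\<in>D_dom. inner_H (D_sum \<xi>) \<eta> = inner_H \<xi> \<zeta>"
  then obtain \<zeta> where \<zeta>: "\<zeta> \<in> H_sum" "\<And>\<xi>. \<xi> \<in> D_dom \<Longrightarrow> inner_H (D_sum \<xi>) \<eta> = inner_H \<xi> \<zeta>" by blast
  \<comment> \<open>Testing against e_w \<otimes> e_ij gives this entrywise, and then \<zeta> \<in>
    \<open>H_sum\<close> puts \<eta> into the domain.\<close>
  have "D_sum \<eta> = \<zeta>"
  proof (rule offdiag_eqI)
    show "D_sum \<eta> w $ i $ j = \<zeta> w $ i $ j" if "i \<noteq> j" for w i j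
      using \<zeta>(2)[OF unit_vec_D_dom, of "(w, i, j)"] that
      by (simp add: unit_index_def D_sum_symmetric inner_unit_vec)
  qed (use \<eta> \<zeta>(1) in \<open>auto simp: H_sum_iff D_sum_offdiag\<close>)
  then show "\<eta> \<in> D_dom" using \<eta> \<zeta>(1) by (simp add: D_dom_def)
qed

text \<open>The resolvent at 0: transposition is an involution, so D_n has inverse 2^-n F_n.\<close>

definition D_inv :: "hvec \<Rightarrow> hvec" where
  "D_inv \<xi> w = (1 / 2 ^ length w) *\<^sub>C transpose (\<xi> w)"

lemma D_inv_entry: "D_inv \<xi> w $ i $ j = 1 / 2 ^ length w * \<xi> w $ j $ i"
  by (simp add: D_inv_def transpose_def)

lemma lnorm2_D_inv: "lnorm2 n (D_inv \<xi>) = (1 / 4) ^ n * lnorm2 n \<xi>"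
proof -
  have "mnorm2 (D_inv \<xi> w) = (1 / 4) ^ n * mnorm2 (\<xi> w)" if "w \<in> words n" for w
    using that by (simp add: D_inv_def mnorm2_scaleC mnorm2_transpose words_def norm_power norm_divide power2_eq_square power_divide flip: power_mult_distrib)
  then show ?thesis by (simp add: lnorm2_def sum_distrib_left)
qed

lemma D_inv_offdiag: "\<xi> w \<in> offdiag \<Longrightarrow> D_inv \<xi> w \<in> offdiag"
  by (simp add: D_inv_def offdiag_scaleC offdiag_transpose)

lemma D_inv_H_sum:
  assumes "\<xi> \<in> H_sum" shows "D_inv \<xi> \<in> H_sum" "hnorm inner_H (D_inv \<xi>) \<le> 1 * hnorm inner_H \<xi>"
proof -
  have "lnorm2 n (D_inv \<xi>) \<le> 1\<^sup>2 * lnorm2 n \<xi>" for n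
    by (simp add: lnorm2_D_inv lnorm2_nonneg power_le_one mult_left_le_one_le)
  then show "D_inv \<xi> \<in> H_sum" "hnorm inner_H (D_inv \<xi>) \<le> 1 * hnorm inner_H \<xi>"
    using H_sum_bounded[OF assms, of "D_inv \<xi>" 1] D_inv_offdiag H_sumD(1)[OF assms] by auto
qed

lemma D_sum_D_inv: "D_sum (D_inv \<xi>) = \<xi>"
  and D_inv_D_sum: "D_inv (D_sum \<xi>) = \<xi>"
  by (rule hvec_eqI, simp add: D_sum_entry D_inv_entry)+

lemma D_inv_diff: "D_inv \<xi> - D_inv \<eta> = D_inv (\<xi> - \<eta>)"
  by (rule hvec_eqI) (simp add: D_inv_entry algebra_simps)

lemma lnorm2_diff_le: "lnorm2 n (\<xi> - \<eta>) \<le> 2 * lnorm2 n \<xi> + 2 * lnorm2 n \<eta>"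
proof -
  have "\<xi> - \<eta> = \<xi> + (-1) *\<^sub>C \<eta>" by (rule hvec_eqI) simp
  moreover have "lnorm2 n ((-1) *\<^sub>C \<eta>) = lnorm2 n \<eta>" unfolding lnorm2_scaleC by simp
  ultimately show ?thesis using lnorm2_add_le[of n \<xi> "(-1) *\<^sub>C \<eta>"] by (simp only:)
qed

lemma lnorm2_le_hnorm_sq:
  assumes "\<xi> \<in> H_sum" shows "lnorm2 n \<xi> \<le> (hnorm inner_H \<xi>)\<^sup>2"
  using sum_le_suminf[OF H_sumD(2)[OF assms], of "{n}"] by (simp add: lnorm2_nonneg hnorm_H_sum_sq assms)

text \<open>A bounded sequence has an entrywise convergent subsequence. The inverse scales squared
  norms in degree n by 4^-n, and this damping upgrades entrywise to norm convergence.\<close>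

lemma compact_D_inv: "compact_op H_sum inner_H D_inv"
  unfolding compact_op_def
proof (intro conjI allI impI)
  have add: "D_inv (\<xi> + \<eta>) = D_inv \<xi> + D_inv \<eta>" for \<xi> \<eta>
    by (rule hvec_eqI) (simp add: D_inv_entry algebra_simps)
  have scale: "D_inv (c *\<^sub>C \<xi>) = c *\<^sub>C D_inv \<xi>" for c \<xi>
    by (rule hvec_eqI) (simp add: D_inv_entry)
  show "bounded_op H_sum H_sum inner_H D_inv"
    unfolding bounded_op_def linear_into_def using D_inv_H_sum add scale by blast
  fix X assume X: "\<forall>k::nat. X k \<in> H_sum \<and> hnorm inner_H (X k) \<le> 1"
  have bnd: "norm (case p of (w, i, j) \<Rightarrow> X k w $ i $ j) \<le> 1" for k p
    using X order_trans[OF cmod_entry_le_hnorm[of "X k"]] by (cases p) auto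
  \<comment> \<open>A diagonal subsequence over the countably many entries.\<close>
  obtain r where r: "strict_mono r" and
    conv: "\<And>p. p \<in> UNIV \<Longrightarrow> \<exists>l. (\<lambda>k. case p of (w, i, j) \<Rightarrow> X (r k) w $ i $ j) \<longlonglongrightarrow> l"
    using function_convergent_subsequence[of "UNIV :: (3 list \<times> 3 \<times> 3) set" "\<lambda>k p. case p of (w, i, j) \<Rightarrow> X k w $ i $ j" 1] bnd
    by (auto simp: countableI_type)
  define L :: hvec where "L w = (\<chi> i j. lim (\<lambda>k. X (r k) w $ i $ j))" for w
  have lim: "(\<lambda>k. X (r k) w $ i $ j) \<longlonglongrightarrow> L w $ i $ j" for w i j
  proof -
    have "convergent (\<lambda>k. X (r k) w $ i $ j)" using conv[of "(w, i, j)"] by (simp add: convergent_def)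
    then show ?thesis by (simp add: L_def convergent_LIMSEQ_iff)
  qed
  have L: "L \<in> H_sum" "hnorm inner_H L \<le> 1"
    using H_sum_limit[of "\<lambda>k. X (r k)" 1 L, OF _ _ lim] X by auto
  have bound: "lnorm2 n (X k - L) \<le> 4" for n k
  proof -
    have "lnorm2 n (X k) \<le> 1"
      using lnorm2_le_hnorm_sq[of "X k" n] X power_mono[of "hnorm inner_H (X k)" 1 2] hnorm_H_sum_nonneg[of "X k"] by fastforce
    moreover have "lnorm2 n L \<le> 1"
      using lnorm2_le_hnorm_sq[of L n] L power_mono[of "hnorm inner_H L" 1 2] hnorm_H_sum_nonneg[of L] by fastforce
    ultimately show ?thesis using lnorm2_diff_le[of n "X k" L] by linarith
  qed
  \<comment> \<open>Dominated convergence for series, with the majorant 4 * 4^-n coming from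
    \<open>bound\<close>.\<close>
  have "(\<lambda>k. \<Sum>n. (1 / 4) ^ n * lnorm2 n (X (r k) - L)) \<longlonglongrightarrow> (\<Sum>n. 0)"
  proof (rule tannerys_theorem[where M = "\<lambda>n. 4 * (1 / 4) ^ n", THEN conjunct2, THEN conjunct2])
    show "(\<lambda>k. (1 / 4) ^ n * lnorm2 n (X (r k) - L)) \<longlonglongrightarrow> 0" for n
    proof -
      have "(\<lambda>k. (X (r k) - L) w $ i $ j) \<longlonglongrightarrow> (0::hvec) w $ i $ j" for w i j
        using LIM_zero[OF lim[of w i j]] by simp
      from lnorm2_tendsto[OF this] have "(\<lambda>k. lnorm2 n (X (r k) - L)) \<longlonglongrightarrow> lnorm2 n 0" .
      moreover have "lnorm2 n 0 = 0" by (simp add: lnorm2_def)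
      ultimately have "(\<lambda>k. (1 / 4) ^ n * lnorm2 n (X (r k) - L)) \<longlonglongrightarrow> (1 / 4) ^ n * 0"
        by (intro tendsto_mult tendsto_const) simp
      then show ?thesis by simp
    qed
    have "norm ((1 / 4) ^ n * lnorm2 n (X (r k) - L)) \<le> 4 * (1 / 4) ^ n" for n k
      using mult_left_mono[OF bound[of n "r k"], of "(1 / 4) ^ n"] by (simp add: lnorm2_nonneg abs_mult mult.commute)
    then show "\<forall>\<^sub>F (n, k) in at_top \<times>\<^sub>F sequentially. norm ((1 / 4) ^ n * lnorm2 n (X (r k) - L)) \<le> 4 * (1 / 4) ^ n"
      by (intro always_eventually) auto
    show "summable (\<lambda>n. 4 * (1 / 4) ^ n :: real)" by (intro summable_mult summable_geometric) simp
  qed simp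
  then have "(\<lambda>k. sqrt (\<Sum>n. (1 / 4) ^ n * lnorm2 n (X (r k) - L))) \<longlonglongrightarrow> sqrt 0"
    by (intro tendsto_real_sqrt) simp
  moreover have "hnorm inner_H (D_inv (X (r k)) - D_inv L) = sqrt (\<Sum>n. (1 / 4) ^ n * lnorm2 n (X (r k) - L))" for k
    using X L D_inv_H_sum(1)[of "X (r k) - L"] by (simp add: D_inv_diff hnorm_H_sum lnorm2_D_inv H_sum_diff)
  ultimately have "(\<lambda>k. hnorm inner_H (D_inv (X (r k)) - D_inv L)) \<longlonglongrightarrow> 0" by simp
  then show "\<exists>r L. strict_mono r \<and> L \<in> H_sum \<and> (\<lambda>k. hnorm inner_H (D_inv (X (r k)) - L)) \<longlonglongrightarrow> 0"
    using r D_inv_H_sum(1)[OF L(1)] by blast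
qed

lemma compact_resolvent_D_sum: "compact_resolvent H_sum inner_H D_dom D_sum"
  unfolding compact_resolvent_def
proof (rule exI[of _ 0], rule exI[of _ D_inv], intro conjI ballI compact_D_inv)
  fix \<xi> assume \<xi>: "\<xi> \<in> H_sum"
  show "D_inv \<xi> \<in> D_dom" using D_inv_H_sum(1)[OF \<xi>] \<xi> by (simp add: D_dom_def D_sum_D_inv)
  show "D_sum (D_inv \<xi>) - 0 *\<^sub>C D_inv \<xi> = \<xi>"
    by (simp only: D_sum_D_inv cvec.scale_zero_left diff_zero)
next
  fix \<xi> show "D_inv (D_sum \<xi> - 0 *\<^sub>C \<xi>) = \<xi>"
    by (simp only: D_inv_D_sum cvec.scale_zero_left diff_zero)
qed

section \<open>Powers of \<open>|D|\<close>\<close>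

text \<open>The explicit form of |D|^p. The value 0 outside \<open>H_sum\<close> matches the
  normalization in \<open>abs_power\<close>.\<close>

definition D_pow :: "real \<Rightarrow> hvec \<Rightarrow> hvec" where
  "D_pow p \<xi> w = (if \<xi> \<in> H_sum then complex_of_real (2 powr (p * real (length w))) *\<^sub>C \<xi> w else 0)"

lemma D_pow_entry: "\<xi> \<in> H_sum \<Longrightarrow> D_pow p \<xi> w $ i $ j = complex_of_real (2 powr (p * real (length w))) * \<xi> w $ i $ j"
  by (simp add: D_pow_def)

lemma lnorm2_D_pow:
  assumes "\<xi> \<in> H_sum" shows "lnorm2 n (D_pow p \<xi>) = (2 powr (p * real n))\<^sup>2 * lnorm2 n \<xi>"
  using assms by (simp add: lnorm2_def D_pow_def mnorm2_scaleC words_def sum_distrib_left)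

lemma bounded_D_pow:
  assumes "p \<le> 0" shows "bounded_op H_sum H_sum inner_H (D_pow p)"
proof -
  have le: "lnorm2 n (D_pow p \<xi>) \<le> 1\<^sup>2 * lnorm2 n \<xi>" if "\<xi> \<in> H_sum" for n \<xi>
  proof -
    have "2 powr (p * real n) \<le> 2 powr 0" using assms by (intro powr_mono) (auto simp: mult_nonpos_nonneg)
    then have "(2 powr (p * real n))\<^sup>2 \<le> 1" by (simp add: power_le_one)
    then show ?thesis using that mult_right_mono[OF _ lnorm2_nonneg] by (simp add: lnorm2_D_pow) fastforce
  qed
  have off: "D_pow p \<xi> w \<in> offdiag" if "\<xi> \<in> H_sum" for \<xi> w
    using that by (simp add: D_pow_def H_sumD offdiag_scaleC)
  show ?thesis
    unfolding bounded_op_def linear_into_def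
  proof (intro conjI ballI allI exI[of _ 1])
    fix \<xi> assume \<xi>: "\<xi> \<in> H_sum"
    show "D_pow p \<xi> \<in> H_sum" "hnorm inner_H (D_pow p \<xi>) \<le> 1 * hnorm inner_H \<xi>"
      using H_sum_bounded[OF \<xi>, of "D_pow p \<xi>" 1] le[OF \<xi>] off[OF \<xi>] by auto
    show "D_pow p (c *\<^sub>C \<xi>) = c *\<^sub>C D_pow p \<xi>" for c
      using \<xi> hsum.H_scale[OF \<xi>, of c] by (intro hvec_eqI) (simp add: D_pow_entry)
    show "D_pow p (\<xi> + \<eta>) = D_pow p \<xi> + D_pow p \<eta>" if "\<eta> \<in> H_sum" for \<eta>
      using \<xi> that hsum.H_add[OF \<xi> that] by (intro hvec_eqI) (simp add: D_pow_entry algebra_simps)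
  qed
qed

text \<open>Transposition preserves the norm of each \<xi>(w), so an eigenvector can be nonzero only
  at words w with 2^(length w) equal to |l|.\<close>

lemma D_pow_eigenvector:
  assumes \<xi>: "\<xi> \<in> H_sum" and eig: "D_sum \<xi> = complex_of_real l *\<^sub>C \<xi>"
  shows "D_pow p \<xi> = complex_of_real (\<bar>l\<bar> powr p) *\<^sub>C \<xi>"
proof
  fix w
  show "D_pow p \<xi> w = (complex_of_real (\<bar>l\<bar> powr p) *\<^sub>C \<xi>) w"
  proof (cases "\<xi> w = 0")
    case True
    then show ?thesis by (simp add: D_pow_def)
  next
    case False
    have "mnorm2 (D_sum \<xi> w) = mnorm2 (complex_of_real l *\<^sub>C \<xi> w)" using eig by simp
    then have "(2 ^ length w)\<^sup>2 * mnorm2 (\<xi> w) = l\<^sup>2 * mnorm2 (\<xi> w)"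
      by (simp add: D_sum_apply mnorm2_scaleC mnorm2_transpose norm_power)
    then have "(2 ^ length w)\<^sup>2 = \<bar>l\<bar>\<^sup>2" using False by (simp add: mnorm2_zero_iff)
    then have "\<bar>l\<bar> = 2 ^ length w" by (metis abs_ge_zero power2_eq_iff_nonneg zero_le_numeral zero_le_power)
    then have "\<bar>l\<bar> powr p = 2 powr (p * real (length w))"
      by (simp add: powr_powr mult.commute flip: powr_realpow)
    then show ?thesis using \<xi> by (simp add: D_pow_def)
  qed
qed

text \<open>Eigenvectors determine S on the basis, and boundedness determines it everywhere through
  the expansion of \<open>inner_H \<eta> (S \<xi>)\<close>.\<close>

lemma D_power_unique:
  assumes S: "bounded_op H_sum H_sum inner_H S" "\<And>\<xi>. \<xi> \<notin> H_sum \<Longrightarrow> S \<xi> = 0"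
    and eig: "\<And>(l::real) \<xi>. \<xi> \<in> D_dom \<Longrightarrow> D_sum \<xi> = complex_of_real l *\<^sub>C \<xi> \<Longrightarrow> S \<xi> = complex_of_real (\<bar>l\<bar> powr p) *\<^sub>C \<xi>"
    and p: "p \<le> 0"
  shows "S = D_pow p"
proof -
  have lin: "linear_into H_sum H_sum S" using S(1) by (simp add: bounded_op_def)
  have unit: "S b = D_pow p b" if b: "b \<in> unit_vec ` unit_index" for b
  proof -
    obtain w i j where b: "b = unit_vec (w, i, j)" and ij: "i \<noteq> j" using b by (auto simp: unit_index_def)
    let ?b' = "unit_vec (w, j, i)"
    have D: "b \<in> D_dom" "?b' \<in> D_dom" using ij by (auto simp: b unit_index_def intro: unit_vec_D_dom)
    \<comment> \<open>e_ij + e_ji and e_ij - e_ji are symmetric and antisymmetric, hence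
      eigenvectors with eigenvalues 2^n and -2^n for n = \<open>length w\<close>.\<close>
    let ?e = "b + ?b'" and ?f = "b + (-1) *\<^sub>C ?b'"
    have ef: "?e \<in> D_dom" "?f \<in> D_dom"
      by (rule cvec.subspace_add[OF subspace_D_dom D])
        (rule cvec.subspace_add[OF subspace_D_dom D(1) cvec.subspace_scale[OF subspace_D_dom D(2)]])
    have e: "D_sum ?e = complex_of_real (2 ^ length w) *\<^sub>C ?e"
    proof (rule hvec_eqI)
      fix w' i' j'
      show "D_sum ?e w' $ i' $ j' = (complex_of_real (2 ^ length w) *\<^sub>C ?e) w' $ i' $ j'"
        unfolding D_sum_entry b by (cases "w' = w"; cases "i' = i"; cases "j' = j"; cases "i' = j"; cases "j' = i")
          (simp_all add: unit_vec_entry)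
    qed
    have f: "D_sum ?f = complex_of_real (- (2 ^ length w)) *\<^sub>C ?f"
    proof (rule hvec_eqI)
      fix w' i' j'
      show "D_sum ?f w' $ i' $ j' = (complex_of_real (- (2 ^ length w)) *\<^sub>C ?f) w' $ i' $ j'"
        unfolding D_sum_entry b by (cases "w' = w"; cases "i' = i"; cases "j' = j"; cases "i' = j"; cases "j' = i")
          (simp_all add: unit_vec_entry)
    qed
    have h: "b = (1 / 2) *\<^sub>C (?e + ?f)" by (rule hvec_eqI) simp
    have efH: "?e \<in> H_sum" "?f \<in> H_sum" using ef D_domD by auto
    have Sb: "T b = (1 / 2) *\<^sub>C (T ?e + T ?f)" if "linear_into H_sum H_sum T" for T
      using that efH hsum.H_add[OF efH] h unfolding linear_into_def by metis
    have "S ?e = D_pow p ?e" "S ?f = D_pow p ?f"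
      using eig[OF ef(1) e] eig[OF ef(2) f] D_pow_eigenvector[OF efH(1) e] D_pow_eigenvector[OF efH(2) f] by simp_all
    then show ?thesis
      using Sb[OF lin] Sb[of "D_pow p"] bounded_D_pow[OF p] unfolding bounded_op_def by simp
  qed
  show ?thesis
  proof
    fix \<xi>
    show "S \<xi> = D_pow p \<xi>"
    proof (cases "\<xi> \<in> H_sum")
      case True
      have B: "bounded_op H_sum H_sum inner_H (D_pow p)" by (rule bounded_D_pow[OF p])
      have ip_eq: "inner_H \<eta> (S \<xi>) = inner_H \<eta> (D_pow p \<xi>)" if "\<eta> \<in> H_sum" for \<eta>
      proof (rule has_sum_unique)
        show "((\<lambda>b. inner_H b \<xi> * inner_H \<eta> (S b)) has_sum inner_H \<eta> (S \<xi>)) (unit_vec ` unit_index)"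
          by (rule hsum.bounded_op_expansion[OF onb_H_sum S(1) True that])
        have "((\<lambda>b. inner_H b \<xi> * inner_H \<eta> (D_pow p b)) has_sum inner_H \<eta> (D_pow p \<xi>)) (unit_vec ` unit_index)"
          by (rule hsum.bounded_op_expansion[OF onb_H_sum B True that])
        then show "((\<lambda>b. inner_H b \<xi> * inner_H \<eta> (S b)) has_sum inner_H \<eta> (D_pow p \<xi>)) (unit_vec ` unit_index)"
          using unit by (simp cong: has_sum_cong)
      qed
      have H: "S \<xi> \<in> H_sum" "D_pow p \<xi> \<in> H_sum"
        using S(1) B True unfolding bounded_op_def linear_into_def by blast+
      show ?thesis
      proof (rule offdiag_eqI)
        show "S \<xi> w $ i $ j = D_pow p \<xi> w $ i $ j" if "i \<noteq> j" for w i j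
          using ip_eq[OF unit_vec_H_sum, of "(w, i, j)"] that by (simp add: unit_index_def inner_unit_vec)
      qed (use H in \<open>auto simp: H_sum_iff\<close>)
    next
      case False
      have "D_pow p \<xi> = 0" by (rule ext) (use False in \<open>simp add: D_pow_def\<close>)
      then show ?thesis using S(2)[OF False] by (simp only:)
    qed
  qed
qed

lemma D_power_eq: assumes p: "p \<le> 0" shows "D_power p = D_pow p"
  unfolding D_power_def abs_power_def
proof (rule the_equality)
  have "D_pow p \<xi> = 0" if "\<xi> \<notin> H_sum" for \<xi>
    by (rule ext) (use that in \<open>simp add: D_pow_def\<close>)
  then show "bounded_op H_sum H_sum inner_H (D_pow p) \<and> (\<forall>\<xi>. \<xi> \<notin> H_sum \<longrightarrow> D_pow p \<xi> = 0) \<and>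
    (\<forall>l::real. \<forall>\<xi>\<in>D_dom. D_sum \<xi> = complex_of_real l *\<^sub>C \<xi> \<longrightarrow> D_pow p \<xi> = complex_of_real (\<bar>l\<bar> powr p) *\<^sub>C \<xi>)"
    using bounded_D_pow[OF p] D_pow_eigenvector D_domD(1) by blast
  show "S = D_pow p" if "bounded_op H_sum H_sum inner_H S \<and> (\<forall>\<xi>. \<xi> \<notin> H_sum \<longrightarrow> S \<xi> = 0) \<and>
    (\<forall>l::real. \<forall>\<xi>\<in>D_dom. D_sum \<xi> = complex_of_real l *\<^sub>C \<xi> \<longrightarrow> S \<xi> = complex_of_real (\<bar>l\<bar> powr p) *\<^sub>C \<xi>)" for S
    using that by (intro D_power_unique p) blast+
qed

section \<open>The representation\<close>

text \<open>The diagonal last factor acts on matrices from the left, so row i sees only the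
  component b(v_i), which then acts on the word index.\<close>

lemma act_entry:
  assumes c: "c \<in> dmats n" and w: "w \<in> words n"
  shows "act n c z w $ i $ j = mvec n (vcomp c i) (\<lambda>w'. z w' $ i $ j) w"
proof -
  have "act n c z w $ i $ j = (\<Sum>w'\<in>words n. \<Sum>k\<in>UNIV. c (w @ [i]) (w' @ [k]) * z w' $ k $ j)"
    using w by (simp add: act_def)
  also have "\<dots> = (\<Sum>w'\<in>words n. \<Sum>k\<in>UNIV. if k = i then vcomp c i w w' * z w' $ i $ j else 0)"
    by (intro sum.cong refl) (auto simp: vcomp_def dmats_off[OF c])
  finally show ?thesis by (simp add: mvec_def)
qed

lemma mvec_cong: "(\<And>w. w \<in> words n \<Longrightarrow> f w = g w) \<Longrightarrow> mvec n x f = mvec n x g"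
  by (simp add: mvec_def fun_eq_iff)

lemma pi_sum_entry:
  assumes "a \<in> gasket_inf"
  shows "pi_sum a \<xi> w $ i $ j = mvec (length w) (vcomp (rho (length w) a) i) (\<lambda>w'. \<xi> w' $ i $ j) w"
proof -
  have w: "w \<in> words (length w)" by (simp add: words_def)
  have "pi_sum a \<xi> w $ i $ j = mvec (length w) (vcomp (rho (length w) a) i) (\<lambda>w'. level (length w) \<xi> w' $ i $ j) w"
    unfolding pi_sum_def op_sum_def pi_level_def by (rule act_entry[OF rho_dmats[OF assms] w])
  also have "mvec (length w) (vcomp (rho (length w) a) i) (\<lambda>w'. level (length w) \<xi> w' $ i $ j) =
      mvec (length w) (vcomp (rho (length w) a) i) (\<lambda>w'. \<xi> w' $ i $ j)"
    by (rule mvec_cong) (simp add: level_def)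
  finally show ?thesis .
qed

lemma lnorm2_wnorm: "lnorm2 n \<xi> = (\<Sum>i\<in>UNIV. \<Sum>j\<in>UNIV. (wnorm n (\<lambda>w. \<xi> w $ i $ j))\<^sup>2)"
proof -
  have "lnorm2 n \<xi> = (\<Sum>i\<in>UNIV. \<Sum>w\<in>words n. \<Sum>j\<in>UNIV. (cmod (\<xi> w $ i $ j))\<^sup>2)"
    unfolding lnorm2_def mnorm2_def by (rule sum.swap)
  also have "\<dots> = (\<Sum>i\<in>UNIV. \<Sum>j\<in>UNIV. \<Sum>w\<in>words n. (cmod (\<xi> w $ i $ j))\<^sup>2)"
    by (intro sum.cong refl sum.swap)
  finally show ?thesis by (simp only: wnorm_sq)
qed

lemma wnorm_mvec_sq_le:
  assumes "opnorm n x \<le> C" shows "(wnorm n (mvec n x f))\<^sup>2 \<le> C\<^sup>2 * (wnorm n f)\<^sup>2"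
proof -
  have "wnorm n (mvec n x f) \<le> C * wnorm n f"
    using opnorm_bound[of n x f] mult_right_mono[OF assms wnorm_nonneg] order_trans by blast
  then have "(wnorm n (mvec n x f))\<^sup>2 \<le> (C * wnorm n f)\<^sup>2" by (intro power_mono) auto
  then show ?thesis by (simp add: power_mult_distrib)
qed

lemma opnorm_vcomp_rho: "opnorm n (vcomp (rho n a) i) \<le> norm a"
  using opnorm_vcomp opnorm_rho order_trans by blast

lemma lnorm2_pi_sum:
  assumes "a \<in> gasket_inf" shows "lnorm2 n (pi_sum a \<xi>) \<le> (norm a)\<^sup>2 * lnorm2 n \<xi>"
proof -
  have "wnorm n (\<lambda>w. pi_sum a \<xi> w $ i $ j) = wnorm n (mvec n (vcomp (rho n a) i) (\<lambda>w'. \<xi> w' $ i $ j))" for i j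
    by (rule wnorm_cong) (simp add: pi_sum_entry assms words_def)
  then show ?thesis
    unfolding lnorm2_wnorm sum_distrib_left
    by (intro sum_mono) (simp add: wnorm_mvec_sq_le opnorm_vcomp_rho)
qed

lemma pi_sum_offdiag:
  assumes "a \<in> gasket_inf" "\<And>w. \<xi> w \<in> offdiag" shows "pi_sum a \<xi> w \<in> offdiag"
  using assms(2) by (simp add: offdiag_def pi_sum_entry[OF assms(1)] mvec_def)

lemma pi_sum_H_sum:
  assumes "a \<in> gasket_inf" "\<xi> \<in> H_sum"
  shows "pi_sum a \<xi> \<in> H_sum" "hnorm inner_H (pi_sum a \<xi>) \<le> norm a * hnorm inner_H \<xi>"
  using H_sum_bounded[OF assms(2), of "pi_sum a \<xi>" "norm a"] pi_sum_offdiag[OF assms(1), of \<xi>] lnorm2_pi_sum[OF assms(1)]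
    H_sumD(1)[OF assms(2)] by auto

lemma mvec_add_right: "mvec n x (\<lambda>w. f w + g w) = (\<lambda>u. mvec n x f u + mvec n x g u)"
  by (simp add: mvec_def fun_eq_iff sum.distrib algebra_simps)

lemma pi_sum_add: "a \<in> gasket_inf \<Longrightarrow> pi_sum a (\<xi> + \<eta>) = pi_sum a \<xi> + pi_sum a \<eta>"
  by (rule hvec_eqI) (simp add: pi_sum_entry mvec_add_right)

lemma pi_sum_scaleC: "a \<in> gasket_inf \<Longrightarrow> pi_sum a (c *\<^sub>C \<xi>) = c *\<^sub>C pi_sum a \<xi>"
  by (rule hvec_eqI) (simp add: pi_sum_entry mvec_scale)

lemma mvec_mstar:
  "(\<Sum>w\<in>words n. cnj (mvec n (mstar x) f w) * g w) = (\<Sum>w\<in>words n. cnj (f w) * mvec n x g w)"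
proof -
  have "(\<Sum>w\<in>words n. cnj (mvec n (mstar x) f w) * g w) = (\<Sum>w\<in>words n. \<Sum>v\<in>words n. cnj (f v) * (x v w * g w))"
    by (simp add: mvec_def mstar_def sum_distrib_left sum_distrib_right mult_ac)
  also have "\<dots> = (\<Sum>v\<in>words n. \<Sum>w\<in>words n. cnj (f v) * (x v w * g w))" by (rule sum.swap)
  finally show ?thesis by (simp add: mvec_def sum_distrib_left)
qed

lemma level_inner:
  "(\<Sum>w\<in>words n. hs_inner (\<xi> w) (\<eta> w)) = (\<Sum>i\<in>UNIV. \<Sum>j\<in>UNIV. \<Sum>w\<in>words n. cnj (\<xi> w $ i $ j) * \<eta> w $ i $ j)"
  unfolding hs_inner_eq by (subst sum.swap) (intro sum.cong refl sum.swap)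

lemma gasket_inf_closed:
  assumes "a \<in> gasket_inf"
  shows "star a \<in> gasket_inf" "c *\<^sub>C a \<in> gasket_inf" "b \<in> gasket_inf \<Longrightarrow> a + b \<in> gasket_inf"
proof -
  have s: "cvec.subspace gasket_inf" "\<forall>a\<in>gasket_inf. star a \<in> gasket_inf"
    using star_subalgebra_gasket_inf unfolding star_subalgebra_def by blast+
  show "star a \<in> gasket_inf" using s(2) assms by blast
  show "c *\<^sub>C a \<in> gasket_inf" using cvec.subspace_scale[OF s(1) assms] .
  show "a + b \<in> gasket_inf" if "b \<in> gasket_inf" using cvec.subspace_add[OF s(1) assms that] .
qed

lemma pi_sum_adjoint:
  assumes a: "a \<in> gasket_inf" and H: "\<xi> \<in> H_sum" "\<eta> \<in> H_sum"
  shows "inner_H (pi_sum (star a) \<xi>) \<eta> = inner_H \<xi> (pi_sum a \<eta>)"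
proof (rule sums_unique2)
  note sa = gasket_inf_closed(1)[OF a]
  have "(\<Sum>w\<in>words n. hs_inner (pi_sum (star a) \<xi> w) (\<eta> w)) = (\<Sum>w\<in>words n. hs_inner (\<xi> w) (pi_sum a \<eta> w))" for n
    unfolding level_inner
  proof (rule sum.cong[OF refl], rule sum.cong[OF refl])
    fix i j :: 3
    let ?x = "vcomp (rho n a) i"
    have "(\<Sum>w\<in>words n. cnj (pi_sum (star a) \<xi> w $ i $ j) * \<eta> w $ i $ j) =
      (\<Sum>w\<in>words n. cnj (mvec n (mstar ?x) (\<lambda>w. \<xi> w $ i $ j) w) * \<eta> w $ i $ j)"
      by (intro sum.cong refl) (simp add: pi_sum_entry[OF sa] words_def rho_star)
    also have "\<dots> = (\<Sum>w\<in>words n. cnj (\<xi> w $ i $ j) * mvec n ?x (\<lambda>w. \<eta> w $ i $ j) w)" by (rule mvec_mstar)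
    also have "\<dots> = (\<Sum>w\<in>words n. cnj (\<xi> w $ i $ j) * pi_sum a \<eta> w $ i $ j)"
      by (intro sum.cong refl) (simp add: pi_sum_entry[OF a] words_def)
    finally show "(\<Sum>w\<in>words n. cnj (pi_sum (star a) \<xi> w $ i $ j) * \<eta> w $ i $ j) =
      (\<Sum>w\<in>words n. cnj (\<xi> w $ i $ j) * pi_sum a \<eta> w $ i $ j)" .
  qed
  then show "(\<lambda>n. \<Sum>w\<in>words n. hs_inner (\<xi> w) (pi_sum a \<eta> w)) sums inner_H (pi_sum (star a) \<xi>) \<eta>"
    using inner_H_sums(2)[OF pi_sum_H_sum(1)[OF sa H(1)] H(2)] by simp
  show "(\<lambda>n. \<Sum>w\<in>words n. hs_inner (\<xi> w) (pi_sum a \<eta> w)) sums inner_H \<xi> (pi_sum a \<eta>)"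
    by (rule inner_H_sums(2)[OF H(1) pi_sum_H_sum(1)[OF a H(2)]])
qed

lemma bounded_pi_sum: "a \<in> gasket_inf \<Longrightarrow> bounded_op H_sum H_sum inner_H (pi_sum a)"
  unfolding bounded_op_def linear_into_def using pi_sum_H_sum pi_sum_add pi_sum_scaleC by blast

lemma representation_pi_sum: "representation gasket_inf H_sum inner_H pi_sum"
  unfolding representation_def
proof (intro conjI ballI allI bounded_pi_sum pi_sum_adjoint)
  fix a b \<xi> assume a: "a \<in> gasket_inf"
  show "pi_sum (c *\<^sub>C a) \<xi> = c *\<^sub>C pi_sum a \<xi>" for c
    by (rule hvec_eqI) (simp add: pi_sum_entry a gasket_inf_closed(2)[OF a] rho_scaleC mvec_scaleC)
  assume b: "b \<in> gasket_inf"
  show "pi_sum (a + b) \<xi> = pi_sum a \<xi> + pi_sum b \<xi>"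
    by (rule hvec_eqI) (simp add: pi_sum_entry a b gasket_inf_closed(3)[OF a b] rho_add mvec_add)
  show "pi_sum (a * b) \<xi> = pi_sum a (pi_sum b \<xi>)"
  proof (rule hvec_eqI)
    fix w i j
    have "pi_sum (a * b) \<xi> w $ i $ j = mvec (length w) (vcomp (rho (length w) a) i)
        (mvec (length w) (vcomp (rho (length w) b) i) (\<lambda>w'. \<xi> w' $ i $ j)) w"
      unfolding pi_sum_entry[OF gasket_inf_mult[OF a b]] rho_mult[OF a b] vcomp_mmul[OF rho_dmats[OF a]] mvec_mmul ..
    also have "mvec (length w) (vcomp (rho (length w) a) i) (mvec (length w) (vcomp (rho (length w) b) i) (\<lambda>w'. \<xi> w' $ i $ j))
      = mvec (length w) (vcomp (rho (length w) a) i) (\<lambda>w'. pi_sum b \<xi> w' $ i $ j)"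
      by (rule mvec_cong) (simp add: pi_sum_entry[OF b] words_def)
    finally show "pi_sum (a * b) \<xi> w $ i $ j = pi_sum a (pi_sum b \<xi>) w $ i $ j"
      by (simp add: pi_sum_entry[OF a])
  qed
qed

section \<open>Commutators\<close>

definition D_comm :: "uhf \<Rightarrow> hvec \<Rightarrow> hvec" where
  "D_comm a \<xi> = D_sum (pi_sum a \<xi>) - pi_sum a (D_sum \<xi>)"

lemma mvec_diff: "mvec n (x - y) f u = mvec n x f u - mvec n y f u"
  by (simp add: mvec_def sum_subtractf algebra_simps)

text \<open>\<pi>(a) acts according to the row index. If it comes before the transposition, the row
  of the (i, j) entry is j; if after, it is i.\<close>

lemma D_comm_entry:
  assumes a: "a \<in> gasket_inf"
  shows "D_comm a \<xi> w $ i $ j = 2 ^ length w *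
    mvec (length w) (vcomp (rho (length w) a) j - vcomp (rho (length w) a) i) (\<lambda>w'. \<xi> w' $ j $ i) w"
proof -
  have "mvec (length w) x (\<lambda>w'. D_sum \<xi> w' $ i $ j) = mvec (length w) x (\<lambda>w'. 2 ^ length w * \<xi> w' $ j $ i)" for x
    by (rule mvec_cong) (simp add: D_sum_entry words_def)
  then have "pi_sum a (D_sum \<xi>) w $ i $ j = 2 ^ length w *
      mvec (length w) (vcomp (rho (length w) a) i) (\<lambda>w'. \<xi> w' $ j $ i) w"
    unfolding pi_sum_entry[OF a] by (simp only: mvec_scale)
  then show ?thesis
    by (simp add: D_comm_def D_sum_entry pi_sum_entry[OF a] mvec_diff right_diff_distrib)
qed

lemma lnorm2_D_comm:
  assumes a: "a \<in> gasket_inf" and C: "osc_le n (rho n a) C"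
  shows "lnorm2 n (D_comm a \<xi>) \<le> (2 ^ n * C)\<^sup>2 * lnorm2 n \<xi>"
proof -
  have *: "(wnorm n (\<lambda>w. D_comm a \<xi> w $ i $ j))\<^sup>2 \<le> (2 ^ n * C)\<^sup>2 * (wnorm n (\<lambda>w. \<xi> w $ j $ i))\<^sup>2" for i j
  proof -
    let ?x = "vcomp (rho n a) j - vcomp (rho n a) i"
    have "wnorm n (\<lambda>w. D_comm a \<xi> w $ i $ j) = wnorm n (\<lambda>w. 2 ^ n * mvec n ?x (\<lambda>w'. \<xi> w' $ j $ i) w)"
      by (rule wnorm_cong) (simp add: D_comm_entry[OF a] words_def)
    also have "\<dots> = 2 ^ n * wnorm n (mvec n ?x (\<lambda>w'. \<xi> w' $ j $ i))" by (simp add: wnorm_scale norm_power)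
    finally have "(wnorm n (\<lambda>w. D_comm a \<xi> w $ i $ j))\<^sup>2 = (2 ^ n)\<^sup>2 * (wnorm n (mvec n ?x (\<lambda>w'. \<xi> w' $ j $ i)))\<^sup>2"
      by (simp only: power_mult_distrib)
    also have "\<dots> \<le> (2 ^ n)\<^sup>2 * (C\<^sup>2 * (wnorm n (\<lambda>w. \<xi> w $ j $ i))\<^sup>2)"
      using C unfolding osc_le_def by (intro mult_left_mono wnorm_mvec_sq_le) auto
    finally show ?thesis by (simp add: power_mult_distrib mult.assoc)
  qed
  have "lnorm2 n (D_comm a \<xi>) \<le> (\<Sum>i\<in>UNIV. \<Sum>j\<in>UNIV. (2 ^ n * C)\<^sup>2 * (wnorm n (\<lambda>w. \<xi> w $ j $ i))\<^sup>2)"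
    unfolding lnorm2_wnorm by (intro sum_mono *)
  also have "\<dots> = (\<Sum>i\<in>UNIV. \<Sum>j\<in>UNIV. (2 ^ n * C)\<^sup>2 * (wnorm n (\<lambda>w. \<xi> w $ i $ j))\<^sup>2)" by (rule sum.swap)
  also have "\<dots> = (2 ^ n * C)\<^sup>2 * lnorm2 n \<xi>" unfolding lnorm2_wnorm sum_distrib_left ..
  finally show ?thesis .
qed

lemma D_comm_offdiag:
  assumes "a \<in> gasket_inf" "\<And>w. \<xi> w \<in> offdiag" shows "D_comm a \<xi> w \<in> offdiag"
  using assms(2) by (simp add: offdiag_def D_comm_entry[OF assms(1)] mvec_def)

lemma D_comm_add: "a \<in> gasket_inf \<Longrightarrow> D_comm a (\<xi> + \<eta>) = D_comm a \<xi> + D_comm a \<eta>"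
  by (simp add: D_comm_def pi_sum_add D_sum_add)

lemma D_comm_scaleC: "a \<in> gasket_inf \<Longrightarrow> D_comm a (c *\<^sub>C \<xi>) = c *\<^sub>C D_comm a \<xi>"
  by (simp add: D_comm_def pi_sum_scaleC D_sum_scaleC cvec.scale_right_diff_distrib)

text \<open>\<pi>(a) preserves degrees, and in degree n the squared norm of D \<xi> is 4^n times
  that of \<xi>, so the bound for \<pi>(a) carries over to the graph norm.\<close>

lemma pi_sum_D_dom:
  assumes a: "a \<in> gasket_inf" and \<xi>: "\<xi> \<in> D_dom" shows "pi_sum a \<xi> \<in> D_dom"
proof -
  have "lnorm2 n (D_sum (pi_sum a \<xi>)) \<le> (norm a)\<^sup>2 * lnorm2 n (D_sum \<xi>)" for n
    using mult_left_mono[OF lnorm2_pi_sum[OF a, of n \<xi>], of "4 ^ n"] by (simp add: lnorm2_D_sum mult_ac)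
  moreover have "D_sum (pi_sum a \<xi>) w \<in> offdiag" for w
    using H_sumD(1)[OF D_domD(1)[OF \<xi>]] by (intro D_sum_offdiag pi_sum_offdiag a)
  ultimately have "D_sum (pi_sum a \<xi>) \<in> H_sum"
    using H_sum_bounded(1)[OF D_domD(2)[OF \<xi>], of "D_sum (pi_sum a \<xi>)" "norm a"] by simp
  then show ?thesis using pi_sum_H_sum(1)[OF a D_domD(1)[OF \<xi>]] by (simp add: D_dom_def)
qed

theorem spectral_triple_gasket: "spectral_triple gasket_inf H_sum inner_H pi_sum D_dom D_sum"
  unfolding spectral_triple_def
proof (intro conjI star_subalgebra_gasket_inf closed_gasket_inf hilbert_space_H_sum representation_pi_sum
    self_adjoint_D_sum compact_resolvent_D_sum exI[of _ lipschitz_elements] star_subalgebra_lipschitz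
    lipschitz_dense ballI pi_sum_D_dom)
  show "lipschitz_elements \<subseteq> gasket_inf" by (auto simp: lipschitz_elements_def)
  fix a assume "a \<in> lipschitz_elements"
  then obtain C where a: "a \<in> gasket_inf" and C: "\<And>n. osc_le n (rho n a) (C / 2 ^ n)"
    unfolding lipschitz_elements_def by blast
  show "a \<in> gasket_inf" by (rule a)
  have "(\<lambda>\<xi>. D_sum (pi_sum a \<xi>) - pi_sum a (D_sum \<xi>)) = D_comm a" by (simp add: D_comm_def fun_eq_iff)
  moreover have "bounded_op D_dom H_sum inner_H (D_comm a)"
    unfolding bounded_op_def linear_into_def
  \<comment> \<open>The absolute value, because \<open>H_sum_bounded\<close> asks for a nonnegative
    constant and nothing is assumed about the sign of C.\<close>
  proof (intro conjI ballI allI exI[of _ "\<bar>C\<bar>"] D_comm_add D_comm_scaleC a)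
    fix \<xi> assume "\<xi> \<in> D_dom"
    then have \<xi>: "\<xi> \<in> H_sum" by (rule D_domD)
    have "lnorm2 n (D_comm a \<xi>) \<le> \<bar>C\<bar>\<^sup>2 * lnorm2 n \<xi>" for n
      using lnorm2_D_comm[OF a C, of n \<xi>] by simp
    then show "D_comm a \<xi> \<in> H_sum" "hnorm inner_H (D_comm a \<xi>) \<le> \<bar>C\<bar> * hnorm inner_H \<xi>"
      using H_sum_bounded[OF \<xi>, of "D_comm a \<xi>" "\<bar>C\<bar>"] D_comm_offdiag[OF a H_sumD(1)[OF \<xi>]] by auto
  qed
  ultimately show "bounded_op D_dom H_sum inner_H (\<lambda>\<xi>. D_sum (pi_sum a \<xi>) - pi_sum a (D_sum \<xi>))" by simp
qed

section \<open>The volume form\<close>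

lemma finite_unit_level: "finite {p \<in> unit_index. length (fst p) = n}"
  using finite_level_index[of n] by (simp add: level_index_def)

lemma three_powr: "2 powr (ln 3 / ln 2) = (3::real)"
  by (simp add: powr_def)

lemma powr_neg_mult: "2 powr (- s * real n) = (2 powr (- s)) ^ n"
  using powr_realpow[of "2 powr (- s)" n] by (simp add: powr_powr)

text \<open>Since 3 = 2^d with d = ln 3 / ln 2, the growth 3^n of the levels shifts the exponent
  from s to s - d.\<close>

lemma power3_powr: "3 ^ n * 2 powr (- s * real n) = (2 powr (- (s - ln 3 / ln 2))) ^ n"
proof -
  have "2 powr (- (s - ln 3 / ln 2)) = 3 * 2 powr (- s)"
    using powr_add[of 2 "ln 3 / ln 2" "- s"] unfolding three_powr by simp
  then show ?thesis unfolding powr_neg_mult by (simp only: power_mult_distrib)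
qed

lemma hnorm_D_pow_unit:
  assumes p: "p \<in> unit_index"
  shows "hnorm inner_H (D_pow (- s) (unit_vec p)) = 2 powr (- s * real (length (fst p)))"
proof -
  obtain w i j where p3: "p = (w, i, j)" by (metis prod_cases3)
  have u: "unit_vec p \<in> H_sum" by (rule unit_vec_H_sum[OF p])
  let ?c = "2 powr (- s * real (length w))"
  have D: "D_pow (- s) (unit_vec p) = complex_of_real ?c *\<^sub>C unit_vec p"
    by (rule hvec_eqI) (simp add: D_pow_entry[OF u], simp add: p3 unit_vec_entry)
  have "hnorm inner_H (unit_vec p) = 1" using hsum.hnorm_onb[OF onb_H_sum] p by blast
  then have n1: "(\<Sum>n. lnorm2 n (unit_vec p)) = 1" using hnorm_H_sum_sq[OF u] by simp
  have "(\<Sum>n. lnorm2 n (complex_of_real ?c *\<^sub>C unit_vec p)) = ?c\<^sup>2 * (\<Sum>n. lnorm2 n (unit_vec p))"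
    unfolding lnorm2_scaleC by (subst suminf_mult[OF H_sumD(2)[OF u]]) simp
  then show ?thesis
    unfolding D hnorm_H_sum[OF hsum.H_scale[OF u]] n1 by (simp add: p3)
qed

text \<open>Level n contributes 6 * 3^n * 2^(-s n), a geometric series of ratio 2^-(s - d).\<close>

lemma summable_unit_index:
  assumes s: "s > ln 3 / ln 2"
  shows "(\<lambda>p. 2 powr (- s * real (length (fst p)))) summable_on unit_index"
proof -
  have "summable (\<lambda>n. 6 * (2 powr (- (s - ln 3 / ln 2))) ^ n)"
    using s by (intro summable_mult summable_geometric) (simp add: powr_less_one)
  moreover have "(\<Sum>p\<in>{p \<in> unit_index. length (fst p) = n}. norm (2 powr (- s * real (length (fst p))))) = 6 * (2 powr (- (s - ln 3 / ln 2))) ^ n" for n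
  proof -
    have "(\<Sum>p\<in>{p \<in> unit_index. length (fst p) = n}. norm (2 powr (- s * real (length (fst p))))) = (\<Sum>p\<in>level_index n. 2 powr (- s * real n))"
      unfolding level_index_def by (intro sum.cong) auto
    also have "\<dots> = 6 * (3 ^ n * 2 powr (- s * real n))" by (simp add: card_level_index)
    finally show ?thesis by (simp only: power3_powr)
  qed
  ultimately have "summable (\<lambda>n. \<Sum>p\<in>{p \<in> unit_index. length (fst p) = n}. norm (2 powr (- s * real (length (fst p)))))" by simp
  from abs_summable_levels[OF finite_unit_level this] show ?thesis by simp
qed

lemma d_pos: "ln 3 / ln 2 > (0::real)"
  by simp

lemma bounded_op_comp:
  assumes "bounded_op H_sum H_sum inner_H S" "bounded_op H_sum H_sum inner_H T"
  shows "bounded_op H_sum H_sum inner_H (S \<circ> T)"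
proof -
  obtain C where C: "C > 0" "\<And>x. x \<in> H_sum \<Longrightarrow> hnorm inner_H (S x) \<le> C * hnorm inner_H x"
    using hsum.bounded_op_bound[OF assms(1)] by blast
  obtain K where K: "K > 0" "\<And>x. x \<in> H_sum \<Longrightarrow> hnorm inner_H (T x) \<le> K * hnorm inner_H x"
    using hsum.bounded_op_bound[OF assms(2)] by blast
  have T: "T x \<in> H_sum" if "x \<in> H_sum" for x using assms(2) that unfolding bounded_op_def linear_into_def by blast
  have "hnorm inner_H (S (T x)) \<le> (C * K) * hnorm inner_H x" if "x \<in> H_sum" for x
    using order_trans[OF C(2)[OF T[OF that]] mult_left_mono[OF K(2)[OF that] less_imp_le[OF C(1)]]]
    by (simp add: mult.assoc)
  then show ?thesis using assms T unfolding bounded_op_def linear_into_def comp_def by metis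
qed

lemma op_trace_sums:
  assumes "has_op_trace H_sum inner_H T t"
  shows "(\<lambda>n. \<Sum>p\<in>level_index n. inner_H (unit_vec p) (T (unit_vec p))) sums t"
proof -
  have "((\<lambda>e. inner_H e (T e)) has_sum t) (unit_vec ` unit_index)"
    using assms onb_H_sum unfolding has_op_trace_def by blast
  then have hs: "((\<lambda>p. inner_H (unit_vec p) (T (unit_vec p))) has_sum t) unit_index"
    unfolding has_sum_reindex[OF inj_unit_vec] by (simp only: o_def)
  show ?thesis
    using sums_levels[OF finite_unit_level has_sum_imp_summable[OF hs]] infsumI[OF hs] by (simp add: level_index_def)
qed

lemma has_op_trace_decay:
  assumes T: "bounded_op H_sum H_sum inner_H T" and s: "s > ln 3 / ln 2"
    and bound: "\<And>p. p \<in> unit_index \<Longrightarrow> hnorm inner_H (T (unit_vec p)) \<le> C * 2 powr (- s * real (length (fst p)))"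
  obtains t where "has_op_trace H_sum inner_H T t"
proof -
  have "(\<lambda>p. C * 2 powr (- s * real (length (fst p)))) summable_on unit_index"
    by (intro summable_on_cmult_right summable_unit_index s)
  then have "(\<lambda>p. hnorm inner_H (T (unit_vec p))) summable_on unit_index"
  proof (rule summable_on_comparison_test)
    fix p assume p: "p \<in> unit_index"
    show "0 \<le> hnorm inner_H (T (unit_vec p))"
      using T unit_vec_H_sum[OF p] unfolding bounded_op_def linear_into_def by (intro hnorm_H_sum_nonneg) blast
  qed (rule bound)
  then have "(\<lambda>e. hnorm inner_H (T e)) summable_on unit_vec ` unit_index"
    by (subst summable_on_reindex[OF inj_unit_vec]) (simp add: o_def)
  from hsum.has_op_trace_onb[OF onb_H_sum T this] show ?thesis by (rule that)
qed

lemma volume_trace: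
  assumes a: "a \<in> gasket_inf" and s: "s > ln 3 / ln 2"
  shows "trace_class H_sum inner_H (pi_sum a \<circ> D_power (- s))"
    and "op_trace H_sum inner_H (pi_sum a \<circ> D_power (- s)) =
      powr_series (\<lambda>n. 6 * (mtr (Suc n) (rho n a) / 3 ^ Suc n)) (s - ln 3 / ln 2)"
proof -
  have s0: "s > 0" using s d_pos by (rule less_trans[rotated])
  have D: "D_power (- s) = D_pow (- s)" using s0 by (intro D_power_eq) simp
  have B: "bounded_op H_sum H_sum inner_H (D_pow (- s))" using s0 by (intro bounded_D_pow) simp
  let ?T = "pi_sum a \<circ> D_pow (- s)"
  have T: "bounded_op H_sum H_sum inner_H ?T"
    by (intro bounded_op_comp bounded_pi_sum a B)
  have "hnorm inner_H (?T (unit_vec p)) \<le> norm a * 2 powr (- s * real (length (fst p)))" if p: "p \<in> unit_index" for p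
  proof -
    have "D_pow (- s) (unit_vec p) \<in> H_sum"
      using B unit_vec_H_sum[OF p] unfolding bounded_op_def linear_into_def by simp
    from pi_sum_H_sum(2)[OF a this] show ?thesis unfolding hnorm_D_pow_unit[OF p] o_apply .
  qed
  from has_op_trace_decay[OF T s this] obtain t where tr: "has_op_trace H_sum inner_H ?T t" by blast
  then show "trace_class H_sum inner_H (pi_sum a \<circ> D_power (- s))" unfolding D trace_class_def by blast
  have "(\<Sum>p\<in>level_index n. inner_H (unit_vec p) (?T (unit_vec p))) =
    complex_of_real ((2 powr (- (s - ln 3 / ln 2))) ^ n) * (6 * (mtr (Suc n) (rho n a) / 3 ^ Suc n))" for n
  proof -
    have "(\<Sum>p\<in>level_index n. inner_H (unit_vec p) (?T (unit_vec p))) =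
      (\<Sum>(w, i, j)\<in>level_index n. complex_of_real (2 powr (- s * real n)) * rho n a (w @ [i]) (w @ [i]))"
    proof (intro sum.cong refl)
      fix p assume p: "p \<in> level_index n"
      obtain w i j where p3: "p = (w, i, j)" by (metis prod_cases3)
      have w: "w \<in> words n" "length w = n" using p by (auto simp: p3 words_def level_index_def)
      have u: "unit_vec p \<in> H_sum" using p by (intro unit_vec_H_sum) (auto simp: level_index_def)
      have "inner_H (unit_vec p) (?T (unit_vec p)) =
         mvec n (vcomp (rho n a) i) (\<lambda>w'. D_pow (- s) (unit_vec p) w' $ i $ j) w"
        unfolding p3 inner_unit_vec o_apply pi_sum_entry[OF a] w(2) ..
      also have "\<dots> = (\<Sum>w'\<in>words n. if w' = w then complex_of_real (2 powr (- s * real n)) * rho n a (w @ [i]) (w @ [i]) else 0)"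
        unfolding mvec_def D_pow_entry[OF u] using w
        by (intro sum.cong refl) (auto simp: p3 unit_vec_entry vcomp_def)
      finally show "inner_H (unit_vec p) (?T (unit_vec p)) =
        (case p of (w, i, j) \<Rightarrow> complex_of_real (2 powr (- s * real n)) * rho n a (w @ [i]) (w @ [i]))"
        using w by (simp add: p3)
    qed
    \<comment> \<open>The diagonal entry does not depend on j, and two values of j differ from
      i.\<close>
    also have "\<dots> = complex_of_real (2 powr (- s * real n)) * (\<Sum>w\<in>words n. \<Sum>i\<in>UNIV. 2 * rho n a (w @ [i]) (w @ [i]))"
      unfolding sum_level_index by (simp add: sum_distrib_left card_Diff_singleton mult_ac)
    also have "(\<Sum>w\<in>words n. \<Sum>i\<in>UNIV. 2 * rho n a (w @ [i]) (w @ [i])) = 2 * mtr (Suc n) (rho n a)"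
      unfolding mtr_def sum_words_Suc sum_distrib_left by (rule sum.swap)
    \<comment> \<open>3^n is shifted into the exponent, while the normalized trace at level n
      divides by 3^(n+1). The factor 6 is 2 * 3.\<close>
    finally show ?thesis
      unfolding power3_powr[symmetric] by (simp add: field_simps)
  qed
  then show "op_trace H_sum inner_H (pi_sum a \<circ> D_power (- s)) =
      powr_series (\<lambda>n. 6 * (mtr (Suc n) (rho n a) / 3 ^ Suc n)) (s - ln 3 / ln 2)"
    unfolding D hsum.op_trace_onb[OF onb_H_sum tr] using op_trace_sums[OF tr] by (simp add: sums_iff powr_series_def)
qed

lemma volume_residue:
  assumes a: "a \<in> gasket_inf"
  shows "has_residue (\<lambda>s. op_trace H_sum inner_H (pi_sum a \<circ> D_power (- s))) (ln 3 / ln 2)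
    (complex_of_real (6 / ln 2) * uhf_trace a)"
proof -
  have "(\<lambda>n. 6 * (mtr (Suc n) (rho n a) / 3 ^ Suc n)) \<longlonglongrightarrow> 6 * uhf_trace a"
    by (intro tendsto_mult tendsto_const gasket_inf_trace a)
  from has_residue_powr_series[OF this volume_trace(2)[OF a]] show ?thesis by simp
qed

section \<open>The critical exponent of |D|\<close>

lemma D_power_trace_class:
  assumes s: "s > ln 3 / ln 2" shows "trace_class H_sum inner_H (D_power (- s))"
proof -
  have s0: "s > 0" using s d_pos by (rule less_trans[rotated])
  then have "bounded_op H_sum H_sum inner_H (D_pow (- s))" by (intro bounded_D_pow) simp
  from has_op_trace_decay[OF this s, of 1] hnorm_D_pow_unit
  obtain t where "has_op_trace H_sum inner_H (D_pow (- s)) t" by auto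
  then show ?thesis using D_power_eq[of "- s"] s0 unfolding trace_class_def by auto
qed

lemma D_power_not_trace_class:
  assumes s: "0 < s" "s \<le> ln 3 / ln 2" shows "\<not> trace_class H_sum inner_H (D_power (- s))"
proof
  have D: "D_power (- s) = D_pow (- s)" using s by (intro D_power_eq) simp
  assume "trace_class H_sum inner_H (D_power (- s))"
  then obtain t where t: "has_op_trace H_sum inner_H (D_pow (- s)) t"
    unfolding D trace_class_def by blast
  have "(\<Sum>p\<in>level_index n. inner_H (unit_vec p) (D_pow (- s) (unit_vec p))) =
    complex_of_real (6 * (2 powr (- (s - ln 3 / ln 2))) ^ n)" for n
  proof -
    have "inner_H (unit_vec p) (D_pow (- s) (unit_vec p)) = complex_of_real (2 powr (- s * real n))"
      if p: "p \<in> level_index n" for p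
    proof -
      obtain w i j where p3: "p = (w, i, j)" by (metis prod_cases3)
      have u: "unit_vec p \<in> H_sum" using p by (intro unit_vec_H_sum) (simp add: level_index_def)
      have "inner_H (unit_vec p) (D_pow (- s) (unit_vec p)) = D_pow (- s) (unit_vec p) w $ i $ j"
        by (simp only: p3 inner_unit_vec)
      then show ?thesis
        using p unfolding D_pow_entry[OF u] by (simp add: p3 unit_vec_entry level_index_def)
    qed
    then have "(\<Sum>p\<in>level_index n. inner_H (unit_vec p) (D_pow (- s) (unit_vec p))) =
      complex_of_real (6 * (3 ^ n * 2 powr (- s * real n)))" by (simp add: card_level_index)
    then show ?thesis by (simp only: power3_powr)
  qed
  then have "summable (\<lambda>n. complex_of_real (6 * (2 powr (- (s - ln 3 / ln 2))) ^ n))"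
    using op_trace_sums[OF t] by (simp add: sums_iff)
  then have "summable (\<lambda>n. 6 * (2 powr (- (s - ln 3 / ln 2))) ^ n)"
    by (simp only: summable_of_real_iff)
  then have lim: "(\<lambda>n. 6 * (2 powr (- (s - ln 3 / ln 2))) ^ n) \<longlonglongrightarrow> 0" by (rule summable_LIMSEQ_zero)
  \<comment> \<open>The exponent -(s - d) is nonnegative, also at s = d, so the level sums cannot
    tend to 0.\<close>
  have "6 \<le> 6 * (2 powr (- (s - ln 3 / ln 2))) ^ n" for n
    using s by (simp add: one_le_power ge_one_powr_ge_zero)
  then have "(6::real) \<le> 0" by (intro LIMSEQ_le_const[OF lim]) blast
  then show False by simp
qed

theorem metric_dimension_gasket: "metric_dimension H_sum inner_H D_dom D_sum = ln 3 / ln 2"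
proof -
  have "{s. s > 0 \<and> trace_class H_sum inner_H (abs_power H_sum inner_H D_dom D_sum (- s))} = {ln 3 / ln 2<..}"
  proof (intro equalityI subsetI CollectI)
    fix s :: real assume "s \<in> {s. s > 0 \<and> trace_class H_sum inner_H (abs_power H_sum inner_H D_dom D_sum (- s))}"
    then show "s \<in> {ln 3 / ln 2<..}"
      using D_power_not_trace_class[of s] unfolding D_power_def by fastforce
  next
    fix s :: real assume "s \<in> {ln 3 / ln 2<..}"
    then have "s > ln 3 / ln 2" by simp
    then show "s > 0 \<and> trace_class H_sum inner_H (abs_power H_sum inner_H D_dom D_sum (- s))"
      using D_power_trace_class[of s] less_trans[OF d_pos] unfolding D_power_def by blast
  qed
  then show ?thesis unfolding metric_dimension_def by simp
qed

section \<open>The Dirichlet form\<close>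

lemma comm_level_eq:
  assumes a: "a \<in> gasket_inf" and \<xi>: "\<xi> \<in> H_level n" shows "comm_level n a \<xi> = D_comm a \<xi>"
proof (rule hvec_eqI)
  fix w i j
  have act: "pi_level n a \<zeta> w $ i $ j = (if w \<in> words n then mvec n (vcomp (rho n a) i) (\<lambda>w'. \<zeta> w' $ i $ j) w else 0)" for \<zeta> i j
    using act_entry[OF rho_dmats[OF a, of n], of w \<zeta> i j] by (simp add: pi_level_def act_def)
  have D: "D_level n \<zeta> w $ i $ j = 2 ^ n * \<zeta> w $ j $ i" for \<zeta> w i j
    unfolding D_level_def hvec_scaleC F_level_def by (simp add: transpose_def)
  show "comm_level n a \<xi> w $ i $ j = D_comm a \<xi> w $ i $ j"
  proof (cases "w \<in> words n")
    case True
    then have "length w = n" by (simp add: words_def)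
    then show ?thesis using True
      by (simp only: D_comm_entry[OF a] comm_level_def minus_apply vector_minus_component D act if_True mvec_scale mvec_diff right_diff_distrib)
  next
    case False
    have z: "\<xi> w' = 0" if "w' \<in> words (length w)" for w'
      using \<xi> False that by (auto simp: H_level_def words_def)
    have "mvec (length w) x (\<lambda>w'. \<xi> w' $ j $ i) w = 0" for x
      by (simp add: mvec_def z)
    then have "D_comm a \<xi> w $ i $ j = 0" by (simp only: D_comm_entry[OF a] mult_zero_right)
    moreover have "comm_level n a \<xi> w $ i $ j = 0"
      using False by (simp only: comm_level_def minus_apply vector_minus_component D act if_False mult_zero_right diff_zero)
    ultimately show ?thesis by simp
  qed
qed

text \<open>On one level the crude oscillation bound 2 * norm a suffices for every a. This matters
  because elements of \<open>energy_dom\<close> are not assumed to be Lipschitz.\<close>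

lemma D_comm_H_level:
  assumes a: "a \<in> gasket_inf" and \<xi>: "\<xi> \<in> H_level n"
  shows "D_comm a \<xi> \<in> H_level n" "hnorm inner_H (D_comm a \<xi>) \<le> (2 ^ n * (2 * norm a)) * hnorm inner_H \<xi>"
proof -
  have H: "\<xi> \<in> H_sum" using \<xi> H_level_subset by blast
  have le: "lnorm2 m (D_comm a \<xi>) \<le> (2 ^ n * (2 * norm a))\<^sup>2 * lnorm2 m \<xi>" for m
  proof (cases "m = n")
    case True
    then show ?thesis using lnorm2_D_comm[OF a osc_le_rho] by simp
  next
    case False
    then show ?thesis
      using lnorm2_D_comm[OF a osc_le_rho, of m \<xi>] lnorm2_H_level[OF \<xi>] by simp
  qed
  have off: "D_comm a \<xi> w \<in> offdiag" for w by (rule D_comm_offdiag[OF a H_sumD(1)[OF H]])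
  show "hnorm inner_H (D_comm a \<xi>) \<le> (2 ^ n * (2 * norm a)) * hnorm inner_H \<xi>"
    by (rule H_sum_bounded(2)[OF H off le]) simp
  have "D_comm a \<xi> w = 0" if "w \<notin> words n" for w
  proof -
    have "mnorm2 (D_comm a \<xi> w) \<le> 0"
      using mnorm2_le_lnorm2[of "D_comm a \<xi>" w] le[of "length w"] lnorm2_H_level[OF \<xi>, of "length w"] that
      by (simp add: words_def)
    then show ?thesis using mnorm2_nonneg[of "D_comm a \<xi> w"] by (simp add: mnorm2_zero_iff[symmetric])
  qed
  then show "D_comm a \<xi> \<in> H_level n" using off by (simp add: H_level_def)
qed

text \<open>The adjoint of [D, a] is -[D, star a], since D is symmetric and \<pi> respects
  adjoints.\<close>

lemma D_comm_adjoint: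
  assumes a: "a \<in> gasket_inf" and \<xi>: "\<xi> \<in> D_dom" and \<eta>: "\<eta> \<in> D_dom"
  shows "inner_H (D_comm a \<xi>) \<eta> = inner_H \<xi> ((-1) *\<^sub>C D_comm (star a) \<eta>)"
proof -
  note sa = gasket_inf_closed(1)[OF a]
  note H = D_domD[OF \<xi>] D_domD[OF \<eta>]
  note P = pi_sum_D_dom[OF a \<xi>] pi_sum_D_dom[OF sa \<eta>]
  note PH = D_domD[OF P(1)] D_domD[OF P(2)] pi_sum_H_sum(1)[OF a H(2)] pi_sum_H_sum(1)[OF sa H(4)]
  have adj: "inner_H (pi_sum a x) y = inner_H x (pi_sum (star a) y)" if "x \<in> H_sum" "y \<in> H_sum" for x y
    using pi_sum_adjoint[OF sa that] by (simp add: star_star)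
  have "inner_H (D_comm a \<xi>) \<eta> = inner_H (D_sum (pi_sum a \<xi>)) \<eta> - inner_H (pi_sum a (D_sum \<xi>)) \<eta>"
    unfolding D_comm_def by (rule hsum.ip_diff_left) (use H PH in auto)
  also have "\<dots> = inner_H \<xi> (pi_sum (star a) (D_sum \<eta>)) - inner_H \<xi> (D_sum (pi_sum (star a) \<eta>))"
    by (simp add: D_sum_symmetric adj H)
  also have "\<dots> = - (inner_H \<xi> (D_comm (star a) \<eta>))"
    unfolding D_comm_def using hsum.ip_diff_right[OF H(1) PH(4) PH(6)] by simp
  also have "\<dots> = inner_H \<xi> ((-1) *\<^sub>C D_comm (star a) \<eta>)"
    unfolding D_comm_def using hsum.ip_scale_right[OF H(1) H_sum_diff[OF PH(4) PH(6)], of "-1"] by simp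
  finally show ?thesis .
qed

lemma op_adjoint_comm_level:
  assumes a: "a \<in> gasket_inf" and \<eta>: "\<eta> \<in> H_level n"
  shows "op_adjoint (H_level n) inner_H (comm_level n a) \<eta> = (-1) *\<^sub>C D_comm (star a) \<eta>"
  unfolding op_adjoint_def
proof (rule the_equality)
  note sa = gasket_inf_closed(1)[OF a]
  have adj: "inner_H (comm_level n a \<xi>) \<eta> = inner_H \<xi> ((-1) *\<^sub>C D_comm (star a) \<eta>)" if "\<xi> \<in> H_level n" for \<xi>
    unfolding comm_level_eq[OF a that] by (rule D_comm_adjoint[OF a H_level_D_dom[OF that] H_level_D_dom[OF \<eta>]])
  have mem: "(-1) *\<^sub>C D_comm (star a) \<eta> \<in> H_level n"
    by (intro hlevel.H_scale D_comm_H_level sa \<eta>)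
  then show "(-1) *\<^sub>C D_comm (star a) \<eta> \<in> H_level n \<and>
    (\<forall>\<xi>\<in>H_level n. inner_H (comm_level n a \<xi>) \<eta> = inner_H \<xi> ((-1) *\<^sub>C D_comm (star a) \<eta>))"
    using adj by blast
  fix \<zeta> assume \<zeta>: "\<zeta> \<in> H_level n \<and> (\<forall>\<xi>\<in>H_level n. inner_H (comm_level n a \<xi>) \<eta> = inner_H \<xi> \<zeta>)"
  show "\<zeta> = (-1) *\<^sub>C D_comm (star a) \<eta>"
  proof (rule offdiag_eqI)
    fix w and i j :: 3 assume ij: "i \<noteq> j"
    show "\<zeta> w $ i $ j = ((-1) *\<^sub>C D_comm (star a) \<eta>) w $ i $ j"
    proof (cases "w \<in> words n")
      case True
      then have "unit_vec (w, i, j) \<in> H_level n" using unit_vec_H_level[OF ij, of w] by (simp add: words_def)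
      then have "inner_H (unit_vec (w, i, j)) \<zeta> = inner_H (unit_vec (w, i, j)) ((-1) *\<^sub>C D_comm (star a) \<eta>)"
        using \<zeta> adj by metis
      then show ?thesis by (simp only: inner_unit_vec)
    next
      case False
      then have "\<zeta> w = 0" "((-1) *\<^sub>C D_comm (star a) \<eta>) w = 0" using \<zeta> mem unfolding H_level_def by blast+
      then show ?thesis by (simp only:)
    qed
  qed (use \<zeta> mem in \<open>unfold H_level_def, blast+\<close>)
qed

lemma inner_H_self_level:
  assumes "\<xi> \<in> H_level n" shows "inner_H \<xi> \<xi> = complex_of_real (lnorm2 n \<xi>)"
proof -
  have "(\<Sum>m. lnorm2 m \<xi>) = (\<Sum>m\<in>{n}. lnorm2 m \<xi>)"
    by (rule suminf_finite) (use lnorm2_H_level[OF assms] in auto)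
  then show ?thesis using inner_H_self[of \<xi>] assms H_level_subset by auto
qed

text \<open>[D, a] sends e_w \<otimes> e_kl to 2^n times column w of b(v_k) - b(v_l), placed in the
  (l, k) entry.\<close>

lemma lnorm2_D_comm_unit:
  assumes a: "a \<in> gasket_inf" and w: "w \<in> words n"
  shows "lnorm2 n (D_comm a (unit_vec (w, k, l))) =
    4 ^ n * (\<Sum>u\<in>words n. (cmod ((vcomp (rho n a) k - vcomp (rho n a) l) u w))\<^sup>2)"
proof -
  have e: "D_comm a (unit_vec (w, k, l)) u $ i $ j =
    (if i = l then if j = k then 2 ^ n * (vcomp (rho n a) k - vcomp (rho n a) l) u w else 0 else 0)" if "u \<in> words n" for u i j
  proof -
    have "mvec n x (\<lambda>w'. unit_vec (w, k, l) w' $ j $ i) u = (\<Sum>w'\<in>words n. if w' = w then if j = k \<and> i = l then x u w else 0 else 0)" for x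
      unfolding mvec_def by (intro sum.cong refl) (auto simp: unit_vec_entry)
    moreover have "length u = n" using that by (simp add: words_def)
    ultimately show ?thesis using w by (simp add: D_comm_entry[OF a])
  qed
  have "mnorm2 (D_comm a (unit_vec (w, k, l)) u) = 4 ^ n * (cmod ((vcomp (rho n a) k - vcomp (rho n a) l) u w))\<^sup>2" if "u \<in> words n" for u
  proof -
    let ?c = "2 ^ n * (vcomp (rho n a) k - vcomp (rho n a) l) u w"
    have "mnorm2 (D_comm a (unit_vec (w, k, l)) u) = (\<Sum>i\<in>UNIV. \<Sum>j\<in>UNIV. if i = l then if j = k then (cmod ?c)\<^sup>2 else 0 else 0)"
      unfolding mnorm2_def e[OF that] by (intro sum.cong refl) simp
    also have "\<dots> = (\<Sum>i\<in>UNIV. if i = l then (cmod ?c)\<^sup>2 else 0)"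
      by (intro sum.cong refl) simp
    also have "\<dots> = (2 ^ n)\<^sup>2 * (cmod ((vcomp (rho n a) k - vcomp (rho n a) l) u w))\<^sup>2"
      by (simp add: norm_mult norm_power power_mult_distrib)
    finally show ?thesis by (simp add: power2_eq_square flip: power_mult_distrib)
  qed
  then show ?thesis by (simp add: lnorm2_def sum_distrib_left)
qed

text \<open>The trace is the sum of squared norms of [D_n, a] e over the basis. For fixed k \<noteq>
  l the columns assemble to a Hilbert-Schmidt norm, and the ordered pairs k \<noteq> l are those in
  the definition of the energy.\<close>

lemma comm_trace:
  assumes a: "a \<in> gasket_inf"
  shows "op_trace (H_level n) inner_H (op_adjoint (H_level n) inner_H (comm_level n a) \<circ> comm_level n a) =
    complex_of_real (4 ^ n * energy n (rho n a))"
proof -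
  note sa = gasket_inf_closed(1)[OF a]
  let ?h = "\<lambda>w k l. \<Sum>u\<in>words n. (cmod ((vcomp (rho n a) k - vcomp (rho n a) l) u w))\<^sup>2"
  let ?T = "op_adjoint (H_level n) inner_H (comm_level n a) \<circ> comm_level n a"
  have T: "?T \<xi> = (-1) *\<^sub>C D_comm (star a) (D_comm a \<xi>)" if "\<xi> \<in> H_level n" for \<xi>
    unfolding o_apply comm_level_eq[OF a that] by (rule op_adjoint_comm_level[OF a D_comm_H_level(1)[OF a that]])
  have TH: "?T \<xi> \<in> H_level n" if "\<xi> \<in> H_level n" for \<xi>
    unfolding T[OF that] by (intro hlevel.H_scale D_comm_H_level sa a that)
  have B: "bounded_op (H_level n) (H_level n) inner_H ?T"
    unfolding bounded_op_def linear_into_def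
  proof (intro conjI ballI allI exI[of _ "(2 ^ n * (2 * norm (star a))) * (2 ^ n * (2 * norm a))"] TH)
    fix \<xi> assume \<xi>: "\<xi> \<in> H_level n"
    show "?T (\<xi> + \<eta>) = ?T \<xi> + ?T \<eta>" if "\<eta> \<in> H_level n" for \<eta>
      unfolding T[OF \<xi>] T[OF that] T[OF hlevel.H_add[OF \<xi> that]] D_comm_add[OF a] D_comm_add[OF sa] scaleC_add_right ..
    show "?T (c *\<^sub>C \<xi>) = c *\<^sub>C ?T \<xi>" for c
      unfolding T[OF \<xi>] T[OF hlevel.H_scale[OF \<xi>]] D_comm_scaleC[OF a] D_comm_scaleC[OF sa] scaleC_scaleC
      by (simp only: mult.commute)
    let ?\<zeta> = "D_comm (star a) (D_comm a \<xi>)"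
    have z: "?\<zeta> \<in> H_level n" by (intro D_comm_H_level sa a \<xi>)
    have "hnorm inner_H ((-1) *\<^sub>C ?\<zeta>) = hnorm inner_H ?\<zeta>"
      unfolding hnorm_def inner_H_self_level[OF z] inner_H_self_level[OF hlevel.H_scale[OF z]] lnorm2_scaleC by simp
    also have "\<dots> \<le> (2 ^ n * (2 * norm (star a))) * hnorm inner_H (D_comm a \<xi>)"
      by (intro D_comm_H_level sa a \<xi>)
    also have "\<dots> \<le> (2 ^ n * (2 * norm (star a))) * ((2 ^ n * (2 * norm a)) * hnorm inner_H \<xi>)"
      by (intro mult_left_mono D_comm_H_level a \<xi>) simp
    finally show "hnorm inner_H (?T \<xi>) \<le> (2 ^ n * (2 * norm (star a))) * (2 ^ n * (2 * norm a)) * hnorm inner_H \<xi>"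
      unfolding T[OF \<xi>] by (simp only: mult.assoc)
  qed
  have fin: "finite (unit_vec ` level_index n)" using finite_level_index by simp
  have inj: "inj_on unit_vec (level_index n)"
    using inj_unit_vec by (rule inj_on_subset) (auto simp: level_index_def)
  have "op_trace (H_level n) inner_H ?T = (\<Sum>\<^sub>\<infinity>e\<in>unit_vec ` level_index n. inner_H e (?T e))"
    by (intro hlevel.op_trace_onb[OF onb_H_level] hlevel.has_op_trace_onb[OF onb_H_level B] summable_on_finite fin)
  also have "\<dots> = (\<Sum>p\<in>level_index n. inner_H (unit_vec p) (?T (unit_vec p)))"
    using fin by (simp only: infsum_finite sum.reindex[OF inj] o_def)
  also have "\<dots> = (\<Sum>(w, k, l)\<in>level_index n. complex_of_real (4 ^ n * ?h w k l))"
  proof (intro sum.cong refl)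
    fix p assume p: "p \<in> level_index n"
    obtain w k l where p3: "p = (w, k, l)" by (metis prod_cases3)
    have w: "w \<in> words n" "k \<noteq> l" using p by (auto simp: p3 level_index_eq)
    have u: "unit_vec p \<in> H_level n" using unit_vec_H_level[OF w(2), of w] w(1) by (simp add: p3 words_def)
    have c: "D_comm a (unit_vec p) \<in> H_level n" by (rule D_comm_H_level(1)[OF a u])
    have "inner_H (unit_vec p) (?T (unit_vec p)) = inner_H (D_comm a (unit_vec p)) (D_comm a (unit_vec p))"
      unfolding T[OF u] using D_comm_adjoint[OF a H_level_D_dom[OF u] H_level_D_dom[OF c]] by simp
    also have "\<dots> = complex_of_real (lnorm2 n (D_comm a (unit_vec p)))" by (rule inner_H_self_level[OF c])
    finally show "inner_H (unit_vec p) (?T (unit_vec p)) = (case p of (w, k, l) \<Rightarrow>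
        complex_of_real (4 ^ n * ?h w k l))"
      unfolding p3 lnorm2_D_comm_unit[OF a w(1)] by simp
  qed
  also have "\<dots> = complex_of_real (4 ^ n * (\<Sum>w\<in>words n. \<Sum>k\<in>UNIV. \<Sum>l\<in>UNIV - {k}. ?h w k l))"
    unfolding sum_level_index of_real_sum of_real_mult sum_distrib_left ..
  also have "(\<Sum>w\<in>words n. \<Sum>k\<in>UNIV. \<Sum>l\<in>UNIV - {k}. ?h w k l) = energy n (rho n a)"
  proof -
    have "(\<Sum>w\<in>words n. \<Sum>k\<in>UNIV. \<Sum>l\<in>UNIV - {k}. ?h w k l) =
      (\<Sum>k\<in>UNIV. \<Sum>w\<in>words n. \<Sum>l\<in>UNIV - {k}. ?h w k l)"
      by (rule sum.swap)
    also have "\<dots> = (\<Sum>k\<in>UNIV. \<Sum>l\<in>UNIV - {k}. \<Sum>w\<in>words n. ?h w k l)"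
      by (intro sum.cong refl sum.swap)
    also have "\<dots> = energy n (rho n a)"
      unfolding energy_sum hs2_def by (intro sum.cong refl sum.swap)
    finally show ?thesis .
  qed
  finally show ?thesis .
qed

text \<open>Here 2^\<delta> = 4 * 3 / 5, so 2^(-s n) * 4^n is 2^(-(s - \<delta>) n) times the
  renormalization (5/3)^n of the energy.\<close>

lemma comm_zeta_term_eq:
  assumes "a \<in> gasket_inf"
  shows "comm_zeta_term a s n = complex_of_real ((2 powr (- (s - (2 - ln (5 / 3) / ln 2)))) ^ n) *
    complex_of_real ((5 / 3) ^ n * energy n (rho n a))"
proof -
  have e1: "2 powr (ln (5 / 3) / ln 2) = (5 / 3 :: real)" by (simp add: powr_def)
  have e2: "2 powr 2 = (4 :: real)" by (simp add: powr_numeral)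
  have "2 powr (- (s - (2 - ln (5 / 3) / ln 2))) * 2 powr (ln (5 / 3) / ln 2) = 2 powr (- s) * 2 powr 2"
    unfolding powr_add[symmetric] by simp
  then have e: "2 powr (- (s - (2 - ln (5 / 3) / ln 2))) * (5 / 3) = 2 powr (- s) * 4" unfolding e1 e2 .
  have "2 powr (- s * real n) * 4 ^ n = (2 powr (- s) * 4) ^ n"
    unfolding powr_neg_mult by (simp only: power_mult_distrib)
  also have "\<dots> = (2 powr (- (s - (2 - ln (5 / 3) / ln 2)))) ^ n * (5 / 3) ^ n"
    unfolding e[symmetric] by (rule power_mult_distrib)
  finally have "2 powr (- s * real n) * (4 ^ n * energy n (rho n a)) =
      (2 powr (- (s - (2 - ln (5 / 3) / ln 2)))) ^ n * ((5 / 3) ^ n * energy n (rho n a))"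
    by (simp only: mult.assoc[symmetric])
  then show ?thesis
    unfolding comm_zeta_term_def comm_trace[OF assms] of_real_mult[symmetric] by (simp only:)
qed

lemma energy_zeta_residue:
  assumes a: "a \<in> energy_dom"
  defines "\<delta> \<equiv> 2 - ln (5 / 3) / ln 2"
  shows "s > \<delta> \<Longrightarrow> summable (comm_zeta_term a s)"
    and "has_residue (\<lambda>s. \<Sum>n. comm_zeta_term a s n) \<delta> (complex_of_real (1 / ln 2 * enn2real (energy_inf a)))"
proof -
  have aG: "a \<in> gasket_inf" using a by (simp add: energy_dom_def)
  let ?x = "\<lambda>n. complex_of_real ((5 / 3) ^ n * energy n (rho n a))"
  have x: "?x \<longlonglongrightarrow> complex_of_real (enn2real (energy_inf a))"
    by (intro tendsto_of_real energy_inf_tendsto a)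
  have z: "comm_zeta_term a s = (\<lambda>n. complex_of_real ((2 powr (- (s - \<delta>))) ^ n) * ?x n)" for s
    unfolding \<delta>_def by (rule ext) (rule comm_zeta_term_eq[OF aG])
  show "summable (comm_zeta_term a s)" if "s > \<delta>"
    unfolding z using that by (intro summable_powr_series[OF x]) simp
  have "has_residue (\<lambda>s. \<Sum>n. comm_zeta_term a s n) \<delta> (complex_of_real (enn2real (energy_inf a)) / complex_of_real (ln 2))"
    by (rule has_residue_powr_series[OF x]) (simp only: z powr_series_def)
  then show "has_residue (\<lambda>s. \<Sum>n. comm_zeta_term a s n) \<delta> (complex_of_real (1 / ln 2 * enn2real (energy_inf a)))"
    by simp
qed

theorem theorem5p3:
  shows "spectral_triple gasket_inf H_sum inner_H pi_sum D_dom D_sum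
    \<and> metric_dimension H_sum inner_H D_dom D_sum = ln 3 / ln 2
    \<and> (\<exists>c>0. \<forall>a\<in>gasket_inf.
         (\<forall>s>ln 3 / ln 2. trace_class H_sum inner_H (pi_sum a \<circ> D_power (- s))) \<and>
         has_residue (\<lambda>s. op_trace H_sum inner_H (pi_sum a \<circ> D_power (- s))) (ln 3 / ln 2)
           (complex_of_real c * uhf_trace a))
    \<and> (\<exists>c>0. \<forall>a\<in>energy_dom.
         (\<forall>s>2 - ln (5 / 3) / ln 2. summable (comm_zeta_term a s)) \<and>
         has_residue (\<lambda>s. \<Sum>n. comm_zeta_term a s n) (2 - ln (5 / 3) / ln 2)
           (complex_of_real (c * enn2real (energy_inf a))))"
proof (intro conjI spectral_triple_gasket metric_dimension_gasket)
  show "\<exists>c>0. \<forall>a\<in>gasket_inf.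
         (\<forall>s>ln 3 / ln 2. trace_class H_sum inner_H (pi_sum a \<circ> D_power (- s))) \<and>
         has_residue (\<lambda>s. op_trace H_sum inner_H (pi_sum a \<circ> D_power (- s))) (ln 3 / ln 2)
           (complex_of_real c * uhf_trace a)"
    \<comment> \<open>The 6 comes from \<open>volume_trace\<close>, and 1 / ln 2 from the Abelian
      limit.\<close>
    by (rule exI[of _ "6 / ln 2"]) (use volume_trace(1) volume_residue in \<open>simp del: of_real_divide\<close>)
  show "\<exists>c>0. \<forall>a\<in>energy_dom.
         (\<forall>s>2 - ln (5 / 3) / ln 2. summable (comm_zeta_term a s)) \<and>
         has_residue (\<lambda>s. \<Sum>n. comm_zeta_term a s n) (2 - ln (5 / 3) / ln 2)
           (complex_of_real (c * enn2real (energy_inf a)))"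
  proof (rule exI[of _ "1 / ln 2"], intro conjI ballI allI impI)
    fix a assume a: "a \<in> energy_dom"
    show "summable (comm_zeta_term a s)" if "2 - ln (5 / 3) / ln 2 < s" for s
      using energy_zeta_residue(1)[OF a] that by blast
    show "has_residue (\<lambda>s. \<Sum>n. comm_zeta_term a s n) (2 - ln (5 / 3) / ln 2)
      (complex_of_real (1 / ln 2 * enn2real (energy_inf a)))"
      by (rule energy_zeta_residue(2)[OF a])
  qed simp
qed

end
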